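(* Let $(T,\mathcal T,\lambda)$ be a complete atomless probability space, $\mathcal F$ a countably generated sub-$\sigma$-algebra of $\mathcal T$, and $X$ a separable Banach space with norm dual $X^*$. If $\mathcal T$ is nowhere equivalent to $\mathcal F$, then the following hold. (D1) For any $\mathcal F$-measurable and weak$^*$ compact valued correspondence $F$ from $T$ to $X^*$, $G_F^{\mathcal T}$ is convex. (D2) For any $1<p\le\infty$ and any $\mathcal F$-measurable, $p$-integrably bounded and weak$^*$ compact valued correspondence $F$ from $T$ to $X^*$, $G_F^{\mathcal T}$ is weak$^*$ compact in $X^*$. (D3) For any $1<p\le\infty$ and any $\mathcal F$-measurable, $p$-integrably bounded and weak$^*$ compact valued correspondence $F$ from $T$ to $X^*$, $G_F^{\mathcal T}=G_{w^*\text{-}\overline{co}F}^{\mathcal T}$, where $w^*\text{-}\overline{co}F(t)$ is the weak$^*$ closure of the convex hull of $F(t)$ for each $t\in T$. (D4) Let $1<p\le\infty$, let $G$ be an $\mathcal F$-measurable, $p$-integrably bounded and weak$^*$ compact valued correspondence from $T$ to $X^*$, let $Y$ be a metric space, and let $F$ be a weak$^*$ closed valued correspondence from $T\times Y$ to $X^*$. If (a) for every $y\in Y$, $F(t,y)\subseteq G(t)$ for $\lambda$-almost all $t\in T$; (b) for every $y\in Y$, $F(\cdot,y)$ is $\mathcal F$-measurable; (c) for every $t\in T$, $F(t,\cdot)$ is weak$^*$ upper hemicontinuous; then $H(y)=G_{F_y}^{\mathcal T}$, with $F_y=F(\cdot,y)$, is weak$^*$ upper hemicontinuous from $Y$ to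 $X^*$.
   Context: Nowhere equivalence: $\mathcal T$ is nowhere equivalent to $\mathcal F$ if for every $D\in\mathcal T$ with $\lambda(D)>0$ there is a $\mathcal T$-measurable set $D_0\subseteq D$ such that $\lambda(D_0\triangle D_1)>0$ for every $D_1\in\mathcal F^D:=\{D\cap D':D'\in\mathcal F\}$. Correspondences: a correspondence from $T$ to a set $Z$ assigns to each $t\in T$ a nonempty subset of $Z$. If $Z$ is a topological space, $F$ is $\mathcal F$-measurable if $\{t\in T: F(t)\cap E\ne\emptyset\}\in\mathcal F$ for each closed $E\subseteq Z$; here $X^*$ carries its weak$^*$ topology, and measurability of mappings into $X^*$ is with respect to the weak$^*$ Borel $\sigma$-algebra. $F$ is closed (compact, ...) valued if $F(t)$ has this property for $\lambda$-almost all $t$. A selection of $F$ is a mapping $f$ with $f(t)\in F(t)$ for $\lambda$-almost all $t$. $F$ is $p$-integrably bounded if there is a measurable real function $h$ with $h^p$ integrable (for $p=\infty$: $h$ essentially bounded) and $\sup\{\|x^*\|:x^*\in F(t)\}\le h(t)$ for $\lambda$-almost all $t$. A correspondence $F$ from a topological space $Y$ to a topological space $Z$ is upper hemicontinuous if for each $y_0\in Y$ and each open $O_Z\supseteq F(y_0)$ there is an open neighborhood $O_Y$ of $y_0$ with $F(y)\subseteq O_Z$ for all $y\in O_Y$; "weak$^*$" means that the target carries its weak$^*$ topology. $f:T\to X^*$ is Gel'fand integrable if $t\mapsto f(t)(x)$ is integrable for each $x\in X$; its Gel'fand integral $\int_T f\,d\lambda\in X^*$ is the functional $x\mapsto\int_T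 f(t)(x)\,d\lambda(t)$. $G_F^{\mathcal T}=\{\int_T f\,d\lambda: f$ is a $\mathcal T$-measurable Gel'fand integrable selection of $F\}$. *)

theory Defs
  imports "HOL-Probability.Probability"
begin

section \<open>Measure-theoretic notions\<close>

definition atomless :: "'t measure \<Rightarrow> bool" where
  "atomless M \<longleftrightarrow>
     (\<forall>A\<in>sets M. measure M A > 0 \<longrightarrow>
        (\<exists>B\<in>sets M. B \<subseteq> A \<and> 0 < measure M B \<and> measure M B < measure M A))"

text \<open>A sub-sigma-algebra is represented by a measure \<open>N\<close> with \<open>subalgebra M N\<close>;
  only \<open>space N\<close> and \<open>sets N\<close> are used, never the values of \<open>N\<close>.\<close>

definition countably_generated :: "'t measure \<Rightarrow> bool" where
  "countably_generated N \<longleftrightarrow>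
     (\<exists>C. countable C \<and> C \<subseteq> Pow (space N) \<and> sets N = sigma_sets (space N) C)"

definition nowhere_equivalent :: "'t measure \<Rightarrow> 't measure \<Rightarrow> bool" where
  "nowhere_equivalent M N \<longleftrightarrow>
     (\<forall>D\<in>sets M. measure M D > 0 \<longrightarrow>
        (\<exists>D0\<in>sets M. D0 \<subseteq> D \<and>
           (\<forall>D1 \<in> {D \<inter> D' |D'. D' \<in> sets N}. measure M (sym_diff D0 D1) > 0)))"

section \<open>The dual space with its weak-star topology\<close>

type_synonym 'x dual = "'x \<Rightarrow>\<^sub>L real"

text \<open>For real-valued functionals the strong operator topology, i.e. the topology of
  pointwise convergence on \<open>'x\<close>, is the weak-star topology.\<close>

abbreviation weak_star :: "'x::real_normed_vector dual topology" where
  "weak_star \<equiv> strong_operator_topology"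

definition weak_star_borel :: "'x::real_normed_vector dual measure" where
  "weak_star_borel = sigma UNIV {U. openin weak_star U}"

section \<open>Correspondences\<close>

definition correspondence :: "'t set \<Rightarrow> ('t \<Rightarrow> 'z set) \<Rightarrow> bool" where
  "correspondence S F \<longleftrightarrow> (\<forall>t\<in>S. F t \<noteq> {})"

definition corr_measurable ::
    "'t measure \<Rightarrow> ('t \<Rightarrow> 'x::real_normed_vector dual set) \<Rightarrow> bool" where
  "corr_measurable N F \<longleftrightarrow>
     (\<forall>E. closedin weak_star E \<longrightarrow> {t \<in> space N. F t \<inter> E \<noteq> {}} \<in> sets N)"

definition weak_star_closed_valued ::
    "'t measure \<Rightarrow> ('t \<Rightarrow> 'x::real_normed_vector dual set) \<Rightarrow> bool" where
  "weak_star_closed_valued M F \<longleftrightarrow> (AE t in M. closedin weak_star (F t))"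

definition weak_star_compact_valued ::
    "'t measure \<Rightarrow> ('t \<Rightarrow> 'x::real_normed_vector dual set) \<Rightarrow> bool" where
  "weak_star_compact_valued M F \<longleftrightarrow> (AE t in M. compactin weak_star (F t))"

text \<open>For a correspondence, the bound forces \<open>h \<ge> 0\<close> almost everywhere, so \<open>powr\<close> is
  only evaluated at nonnegative arguments up to a null set.\<close>

definition integrably_bounded ::
    "ereal \<Rightarrow> 't measure \<Rightarrow> ('t \<Rightarrow> 'x::real_normed_vector dual set) \<Rightarrow> bool" where
  "integrably_bounded p M F \<longleftrightarrow>
     (\<exists>h \<in> borel_measurable M.
        (if p = \<infinity> then \<exists>C. AE t in M. \<bar>h t\<bar> \<le> C
         else integrable M (\<lambda>t. h t powr real_of_ereal p)) \<and>
        (AE t in M. (SUP \<phi>\<in>F t. ereal (norm \<phi>)) \<le> ereal (h t)))"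

definition upper_hemicontinuous ::
    "'y topology \<Rightarrow> 'z topology \<Rightarrow> ('y \<Rightarrow> 'z set) \<Rightarrow> bool" where
  "upper_hemicontinuous Y Z F \<longleftrightarrow>
     correspondence (topspace Y) F \<and> (\<forall>y\<in>topspace Y. F y \<subseteq> topspace Z) \<and>
     (\<forall>y0\<in>topspace Y. \<forall>V. openin Z V \<and> F y0 \<subseteq> V \<longrightarrow>
        (\<exists>U. openin Y U \<and> y0 \<in> U \<and> (\<forall>y\<in>U. F y \<subseteq> V)))"

section \<open>Gel'fand integrals\<close>

definition gelfand_integrable ::
    "'t measure \<Rightarrow> ('t \<Rightarrow> 'x::real_normed_vector dual) \<Rightarrow> bool" where
  "gelfand_integrable M f \<longleftrightarrow> (\<forall>x. integrable M (\<lambda>t. blinfun_apply (f t) x))"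

definition gelfand_integral ::
    "'t measure \<Rightarrow> ('t \<Rightarrow> 'x::real_normed_vector dual) \<Rightarrow> 'x dual" where
  "gelfand_integral M f = Blinfun (\<lambda>x. \<integral>t. blinfun_apply (f t) x \<partial>M)"

text \<open>\<open>Blinfun\<close> is meaningful only for bounded linear arguments; on a Banach space this
  is automatic.\<close>

lemma gelfand_bounded_linear:
  fixes f :: "'t \<Rightarrow> 'x::banach dual"
  assumes f: "gelfand_integrable M f"
  shows "bounded_linear (\<lambda>x. \<integral>t. blinfun_apply (f t) x \<partial>M)"
proof -
  have int: "integrable M (\<lambda>t. blinfun_apply (f t) x)" for x
    using f by (simp add: gelfand_integrable_def)
  define q where "q x = (\<integral>\<^sup>+t. ennreal \<bar>blinfun_apply (f t) x\<bar> \<partial>M)" for x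
  have q_eq: "q x = ennreal (\<integral>t. \<bar>blinfun_apply (f t) x\<bar> \<partial>M)" for x
    unfolding q_def by (intro nn_integral_eq_integral integrable_abs int) auto
  define S where "S n = {x. q x \<le> ennreal (real n)}" for n
  have clo: "closed (S n)" for n
    unfolding closed_sequential_limits
  proof (intro allI impI)
    fix X l assume X: "(\<forall>k. X k \<in> S n) \<and> X \<longlonglongrightarrow> l"
    have "q l = (\<integral>\<^sup>+t. liminf (\<lambda>k. ennreal \<bar>blinfun_apply (f t) (X k)\<bar>) \<partial>M)"
      unfolding q_def
    proof (rule nn_integral_cong)
      fix t
      have "(\<lambda>k. ennreal \<bar>blinfun_apply (f t) (X k)\<bar>) \<longlonglongrightarrow> ennreal \<bar>blinfun_apply (f t) l\<bar>"
        using X by (intro tendsto_ennrealI tendsto_rabs blinfun.tendsto tendsto_const) auto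
      then show "ennreal \<bar>blinfun_apply (f t) l\<bar>
          = liminf (\<lambda>k. ennreal \<bar>blinfun_apply (f t) (X k)\<bar>)"
        by (metis lim_imp_Liminf sequentially_bot)
    qed
    also have "\<dots> \<le> liminf (\<lambda>k. q (X k))"
      unfolding q_def using int by (intro nn_integral_liminf) auto
    also have "\<dots> \<le> ennreal (real n)"
      using X unfolding S_def
      by (intro order_trans[OF Liminf_le_Limsup Limsup_bounded]) auto
    finally show "l \<in> S n" by (simp add: S_def)
  qed
  have "\<exists>n. interior (S n) \<noteq> {}"
  proof (rule ccontr)
    assume no: "\<nexists>n. interior (S n) \<noteq> {}"
    have "euclidean interior_of (\<Union>(range S)) = {}"
      by (rule Baire_category_alt)
         (use no clo in \<open>auto simp: completely_metrizable_space_euclidean\<close>)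
    moreover have "\<Union>(range S) = UNIV"
    proof -
      have "\<exists>n. x \<in> S n" for x
        using real_arch_simple[of "\<integral>t. \<bar>blinfun_apply (f t) x\<bar> \<partial>M"]
        by (auto simp: S_def q_eq intro!: ennreal_leI)
      then show ?thesis by auto
    qed
    ultimately show False by auto
  qed
  then obtain n a e where e: "e > 0" and ball: "ball a e \<subseteq> S n"
    by (metis ex_in_conv mem_interior)
  have bnd: "(\<integral>t. \<bar>blinfun_apply (f t) x\<bar> \<partial>M) \<le> real n" if "x \<in> ball a e" for x
    using ball that by (auto simp: S_def q_eq)
  have bnd': "\<bar>\<integral>t. blinfun_apply (f t) x \<partial>M\<bar> \<le> real n" if "x \<in> ball a e" for x
    using integral_abs_bound bnd[OF that] by (rule order_trans)
  have small: "\<bar>\<integral>t. blinfun_apply (f t) x \<partial>M\<bar> \<le> 2 * real n" if x: "norm x < e" for x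
  proof -
    have "\<bar>\<integral>t. blinfun_apply (f t) x \<partial>M\<bar> =
        \<bar>(\<integral>t. blinfun_apply (f t) (a + x) \<partial>M) - (\<integral>t. blinfun_apply (f t) a \<partial>M)\<bar>"
      by (subst Bochner_Integration.integral_diff[symmetric]) (auto simp: int blinfun.add_right)
    also have "\<dots> \<le> real n + real n"
      using bnd'[of a] bnd'[of "a + x"] e x
      by (auto simp: dist_norm abs_le_iff)
    finally show ?thesis by simp
  qed
  show ?thesis
  proof (rule bounded_linear_intro)
    fix x y :: 'x and r :: real
    show "(\<integral>t. blinfun_apply (f t) (x + y) \<partial>M) =
        (\<integral>t. blinfun_apply (f t) x \<partial>M) + (\<integral>t. blinfun_apply (f t) y \<partial>M)"
      by (simp add: blinfun.add_right int)
    show scale: "(\<integral>t. blinfun_apply (f t) (r *\<^sub>R x) \<partial>M) = r *\<^sub>R (\<integral>t. blinfun_apply (f t) x \<partial>M)" for r x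
      by (simp add: blinfun.scaleR_right)
    show "norm (\<integral>t. blinfun_apply (f t) x \<partial>M) \<le> norm x * (4 * real n / e)"
    proof (cases "x = 0")
      case False
      define c where "c = e / (2 * norm x)"
      have c: "c > 0" "norm (c *\<^sub>R x) < e" using e False by (auto simp: c_def)
      have "c * \<bar>\<integral>t. blinfun_apply (f t) x \<partial>M\<bar> \<le> 2 * real n"
        using small[OF c(2)] c(1) scale[of c x] by (simp add: abs_mult)
      then have "\<bar>\<integral>t. blinfun_apply (f t) x \<partial>M\<bar> \<le> 2 * real n / c"
        using c(1) by (simp add: field_simps)
      then show ?thesis using False e by (simp add: c_def field_simps)
    qed simp
  qed
qed

lemma gelfand_integral_apply:
  fixes f :: "'t \<Rightarrow> 'x::banach dual"
  assumes "gelfand_integrable M f"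
  shows "blinfun_apply (gelfand_integral M f) x = (\<integral>t. blinfun_apply (f t) x \<partial>M)"
  using gelfand_bounded_linear[OF assms]
  by (simp add: gelfand_integral_def bounded_linear_Blinfun_apply)

definition selection :: "'t measure \<Rightarrow> ('t \<Rightarrow> 'z set) \<Rightarrow> ('t \<Rightarrow> 'z) \<Rightarrow> bool" where
  "selection M F f \<longleftrightarrow> (AE t in M. f t \<in> F t)"

definition gelfand_integrals ::
    "'t measure \<Rightarrow> ('t \<Rightarrow> 'x::real_normed_vector dual set) \<Rightarrow> 'x dual set" where
  "gelfand_integrals M F =
     {gelfand_integral M f |f.
        f \<in> measurable M weak_star_borel \<and> gelfand_integrable M f \<and> selection M F f}"

end

theory Submission
  imports Defs
begin

text \<open>Nowhere equivalence yields a conditional Lyapunov theorem: whenever \<open>\<integral>\<^sub>A p \<le> \<lambda>(A \<inter> D)\<close> for all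
  \<open>A \<in> \<F>\<close>, there is a measurable \<open>D' \<subseteq> D\<close> with \<open>\<lambda>(A \<inter> D') = \<integral>\<^sub>A p\<close> for all \<open>A \<in> \<F>\<close>. Applying it
  along the binary tree, every measurable family of probability measures on the Cantor space is,
  conditionally on \<open>\<F>\<close>, the law of a measurable map into the Cantor space. Binary digits of
  normalised coordinates code a weak-star compact valued correspondence by closed subsets of the
  Cantor space, so a selection of the closed convex hull, approximated by finite convex
  combinations of cells, can be replaced by a selection of the correspondence itself with the same
  conditional expectations. The limit of the approximations exists almost everywhere after passing
  to convex combinations of tails, by the parallelogram identity in \<open>L\<^sup>2\<close>. The same device
  gives closedness under weak-star limits, hence compactness and upper hemicontinuity.\<close>

section \<open>Subsets with prescribed conditional probability\<close>

text \<open>Two constraints shape the proof. Masses are controlled only over sets of the small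
  sigma-algebra, so whatever a selection must satisfy has to be expressed by such sets.
  Measurability of the correspondence puts there the events that the coded value set meets a given
  cell, and the norm bound used for normalisation is built from the correspondence itself, so that
  it is measurable there too and can be multiplied back into conditional expectations. Moreover, the
  finite combinations vary with the point and need not converge. Convex combinations of tails make
  the countably many cylinder masses converge at once, and tails are essential: a word at least as
  long as \<open>c\<close> decides whether its branch passes through \<open>c\<close>, so a cylinder
  whose cell misses the coded set gets mass zero in the limit, while the coordinate errors of the
  tail vanish. The selected point appears only at the end, when digits are read off the tree; hence
  measurable selections come from the same construction.\<close>

lemma exhaustion:
  assumes "finite_measure M" and "C E0"
    and meas: "\<And>E. C E \<Longrightarrow> E \<in> sets M"
    and union: "\<And>E. (\<And>n. C (E n)) \<Longrightarrow> incseq E \<Longrightarrow> C (\<Union>n::nat. E n)"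
  shows "\<exists>E. C E \<and> (\<forall>E'. C E' \<and> E \<subseteq> E' \<longrightarrow> measure M E' = measure M E)"
proof -
  interpret finite_measure M by fact
  \<comment> \<open>\<open>s E\<close> is the best mass still reachable from \<open>E\<close>. Each
    member of the chain below comes within \<open>(1/2)^n\<close> of it, and an admissible set above
    the union lies above every \<open>E n\<close>, so its mass is squeezed onto that of the
    union.\<close>
  define s where "s E = (SUP E'\<in>{E'. C E' \<and> E \<subseteq> E'}. measure M E')" for E
  have bdd: "bdd_above (measure M ` {E'. C E' \<and> E \<subseteq> E'})" for E
    by (intro bdd_aboveI[of _ "measure M (space M)"]) (auto intro: bounded_measure)
  have s_ge: "measure M E' \<le> s E" if "C E'" "E \<subseteq> E'" for E E'
    unfolding s_def by (intro cSUP_upper bdd) (use that in auto)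
  have step: "\<exists>E'. C E' \<and> E \<subseteq> E' \<and> s E - (1/2)^n \<le> measure M E'" if "C E" for E and n :: nat
  proof -
    have ne: "{E'. C E' \<and> E \<subseteq> E'} \<noteq> {}" using that by auto
    have "s E - (1/2)^n < s E" by simp
    then have "\<exists>E'\<in>{E'. C E' \<and> E \<subseteq> E'}. s E - (1/2)^n < measure M E'"
      unfolding s_def[of E] less_cSUP_iff[OF ne bdd] .
    then show ?thesis by (auto intro: less_imp_le)
  qed
  obtain E where C: "\<And>n. C (E n)"
    and sub: "\<And>n. E n \<subseteq> E (Suc n)" and ge: "\<And>n. s (E n) - (1/2)^n \<le> measure M (E (Suc n))"
  proof -
    have "\<exists>f. \<forall>n. C (f n) \<and> f n \<subseteq> f (Suc n) \<and> s (f n) - (1/2)^n \<le> measure M (f (Suc n))"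
      using assms(2) step by (intro dependent_nat_choice) auto
    then show ?thesis using that by auto
  qed
  have inc: "incseq E" using sub by (rule incseq_SucI)
  let ?U = "\<Union>n. E n"
  have CU: "C ?U" by (rule union[OF C inc])
  have "measure M E' = measure M ?U" if E': "C E'" "?U \<subseteq> E'" for E'
  proof (rule antisym)
    have "measure M E' \<le> measure M ?U + (1/2)^n" for n
    proof -
      have "measure M E' \<le> s (E n)" using E' by (intro s_ge) auto
      also have "\<dots> \<le> measure M (E (Suc n)) + (1/2)^n" using ge[of n] by simp
      also have "\<dots> \<le> measure M ?U + (1/2)^n"
        by (intro add_right_mono finite_measure_mono meas CU) auto
      finally show ?thesis .
    qed
    moreover have "(\<lambda>n. measure M ?U + (1/2)^n) \<longlonglongrightarrow> measure M ?U + 0"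
      by (intro tendsto_intros) auto
    ultimately show "measure M E' \<le> measure M ?U"
      by (intro LIMSEQ_le_const[of _ "measure M ?U"]) auto
    show "measure M ?U \<le> measure M E'"
      by (intro finite_measure_mono meas E')
  qed
  with CU show ?thesis by blast
qed

locale sub_prob_space = prob_space M + finite_measure_subalgebra M N for M N :: "'t measure"
begin

lemma sub_space: "space N = space M" and sub_sets: "A \<in> sets N \<Longrightarrow> A \<in> sets M"
  using subalg by (auto simp: subalgebra_def)

lemma set_integral_indicator_prob:
  assumes "A \<in> sets M" "B \<in> sets M"
  shows "(LINT t:A|M. indicator B t) = prob (A \<inter> B)"
  using assms by (simp add: set_lebesgue_integral_def flip: indicator_inter_arith)

lemma set_integrable_sub:
  fixes f :: "'t \<Rightarrow> real"
  assumes "integrable M f" "A \<in> sets N"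
  shows "set_integrable M A f"
  unfolding set_integrable_def using assms sub_sets by (intro integrable_mult_indicator) auto

end

locale nowhere_equivalent_subalgebra = sub_prob_space M N for M N :: "'t measure" +
  assumes nowhere_eq: "nowhere_equivalent M N"
begin

text \<open>Put together the part of \<open>D0\<close> where it carries at most half of the conditional mass of \<open>D\<close> and
  the part of \<open>D - D0\<close> where \<open>D0\<close> carries more; nowhere equivalence keeps the result from being null.\<close>

lemma exists_cond_half:
  assumes D: "D \<in> sets M" "prob D > 0"
  shows "\<exists>B\<in>sets M. B \<subseteq> D \<and> prob B > 0 \<and> (\<forall>A\<in>sets N. prob (A \<inter> B) \<le> prob (A \<inter> D) / 2)"
proof -
  from nowhere_eq D have "\<exists>D0\<in>sets M. D0 \<subseteq> D \<and>
      (\<forall>D1 \<in> {D \<inter> D' |D'. D' \<in> sets N}. prob (sym_diff D0 D1) > 0)"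
    unfolding nowhere_equivalent_def by simp
  then obtain D0 where D0[measurable]: "D0 \<in> sets M" and sub: "D0 \<subseteq> D"
    and ne: "\<forall>D1 \<in> {D \<inter> D' |D'. D' \<in> sets N}. prob (sym_diff D0 D1) > 0"
    by (elim bexE conjE)
  note D(1)[measurable]
  define g where "g = real_cond_exp M N (indicator D0)"
  define d where "d = real_cond_exp M N (indicator D)"
  have [measurable]: "g \<in> borel_measurable N" "d \<in> borel_measurable N"
    by (auto simp: g_def d_def)
  have int: "integrable M g" "integrable M d"
    unfolding g_def d_def by (intro real_cond_exp_int(1) integrable_real_indicator; simp add: emeasure_eq_measure)+
  have sg: "set_integrable M A g" "set_integrable M A d" "set_integrable M A (\<lambda>t. 2 * g t)" if "A \<in> sets N" for A
    using int that by (auto intro!: set_integrable_sub)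
  have gA: "(LINT t:A|M. g t) = prob (A \<inter> D0)" if "A \<in> sets N" for A
    unfolding g_def using that
    by (subst real_cond_exp_intA[symmetric])
      (simp_all add: set_integral_indicator_prob sub_sets emeasure_eq_measure)
  have dA: "(LINT t:A|M. d t) = prob (A \<inter> D)" if "A \<in> sets N" for A
    unfolding d_def using that
    by (subst real_cond_exp_intA[symmetric])
      (simp_all add: set_integral_indicator_prob sub_sets emeasure_eq_measure)
  define P where "P = {t \<in> space N. 2 * g t \<le> d t}"
  have P: "P \<in> sets N" unfolding P_def by measurable
  note PM = sub_sets[OF P]
  define B where "B = (D0 \<inter> P) \<union> ((D - D0) - P)"
  have B: "B \<in> sets M" "B \<subseteq> D" using PM sub by (auto simp: B_def)
  \<comment> \<open>The competitor for nowhere equivalence is the trace on \<open>D\<close> of the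
    complement of \<open>P\<close>: its symmetric difference with \<open>D0\<close> is exactly
    \<open>B\<close>, which is therefore not null.\<close>
  have "sym_diff D0 (D \<inter> (space N - P)) = B"
    using sub sets.sets_into_space[OF D(1)] by (auto simp: B_def sub_space)
  then have pos: "prob B > 0" using bspec[OF ne, of "D \<inter> (space N - P)"] P by auto
  have "prob (A \<inter> B) \<le> prob (A \<inter> D) / 2" if A: "A \<in> sets N" for A
  proof -
    note AM = sub_sets[OF A]
    have 1: "prob (A \<inter> P \<inter> D0) \<le> prob (A \<inter> P \<inter> D) / 2"
    proof -
      have AP: "A \<inter> P \<in> sets N" using A P by auto
      have "2 * prob (A \<inter> P \<inter> D0) = (LINT t:A\<inter>P|M. 2 * g t)"
        by (subst set_integral_mult_right) (simp add: gA[OF AP])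
      also have "\<dots> \<le> (LINT t:A\<inter>P|M. d t)"
        by (intro set_integral_mono sg AP) (auto simp: P_def)
      finally show ?thesis by (simp add: dA[OF AP])
    qed
    have 2: "prob (A \<inter> (D - D0) - P) \<le> prob (A \<inter> D - P) / 2"
    proof -
      have AP: "A - P \<in> sets N" using A P by auto
      have "prob ((A - P) \<inter> D) - prob ((A - P) \<inter> D0) = prob ((A - P) \<inter> D - (A - P) \<inter> D0)"
        using AM PM sub by (subst finite_measure_Diff) auto
      also have "(A - P) \<inter> D - (A - P) \<inter> D0 = A \<inter> (D - D0) - P" by auto
      finally have *: "prob (A \<inter> (D - D0) - P) = prob ((A - P) \<inter> D) - prob ((A - P) \<inter> D0)"
        by simp
      have "prob ((A - P) \<inter> D) \<le> 2 * prob ((A - P) \<inter> D0)"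
      proof -
        have "prob ((A - P) \<inter> D) = (LINT t:A-P|M. d t)" by (simp add: dA[OF AP])
        also have "\<dots> \<le> (LINT t:A-P|M. 2 * g t)"
          using sets.sets_into_space[OF A]
          by (intro set_integral_mono sg AP) (auto simp: P_def)
        also have "\<dots> = 2 * prob ((A - P) \<inter> D0)"
          by (subst set_integral_mult_right) (simp add: gA[OF AP])
        finally show ?thesis .
      qed
      moreover have "A \<inter> D - P = (A - P) \<inter> D" by auto
      ultimately show ?thesis using * by simp
    qed
    have "prob (A \<inter> B) = prob ((A \<inter> P \<inter> D0) \<union> (A \<inter> (D - D0) - P))"
      by (rule arg_cong[where f = prob]) (auto simp: B_def)
    also have "\<dots> = prob (A \<inter> P \<inter> D0) + prob (A \<inter> (D - D0) - P)"
      using AM PM by (intro finite_measure_Union) auto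
    also have "\<dots> \<le> (prob (A \<inter> P \<inter> D) + prob (A \<inter> D - P)) / 2"
      using 1 2 by simp
    also have "prob (A \<inter> P \<inter> D) + prob (A \<inter> D - P) = prob ((A \<inter> P \<inter> D) \<union> (A \<inter> D - P))"
      using AM PM by (intro finite_measure_Union[symmetric]) auto
    also have "(A \<inter> P \<inter> D) \<union> (A \<inter> D - P) = A \<inter> D" by auto
    finally show ?thesis .
  qed
  with B pos show ?thesis by blast
qed

text \<open>Halving is iterated to obtain a non-null set thin enough, conditionally, to fit into a
  deficit known only to exceed \<open>1/2^n\<close>.\<close>

lemma exists_cond_small:
  assumes D: "D \<in> sets M" "prob D > 0"
  shows "\<exists>B\<in>sets M. B \<subseteq> D \<and> prob B > 0 \<and> (\<forall>A\<in>sets N. prob (A \<inter> B) \<le> prob (A \<inter> D) / 2 ^ n)"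
proof (induction n)
  case 0
  show ?case using D by auto
next
  case (Suc n)
  then obtain B where B: "B \<in> sets M" "B \<subseteq> D" "prob B > 0"
    and le: "\<And>A. A \<in> sets N \<Longrightarrow> prob (A \<inter> B) \<le> prob (A \<inter> D) / 2 ^ n" by blast
  obtain B' where B': "B' \<in> sets M" "B' \<subseteq> B" "prob B' > 0"
    and le': "\<And>A. A \<in> sets N \<Longrightarrow> prob (A \<inter> B') \<le> prob (A \<inter> B) / 2"
    using exists_cond_half[OF B(1,3)] by blast
  have "prob (A \<inter> B') \<le> prob (A \<inter> D) / 2 ^ Suc n" if "A \<in> sets N" for A
    using le[OF that] le'[OF that] by simp
  with B B' show ?case by blast
qed

text \<open>Take a maximal \<open>E\<close> inside \<open>D\<close> whose mass over every set of
  \<open>sets N\<close> is at most that of \<open>p\<close>. A nonzero conditional deficit exceeds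
  some \<open>1/2^n\<close> on a non-null set \<open>P n\<close> of \<open>sets N\<close>. There
  \<open>D - E\<close> is non-null because \<open>p\<close> is dominated by \<open>D\<close>, and a
  thin piece of it could still be added to \<open>E\<close>, against maximality.\<close>

lemma exists_subset_with_cond_prob:
  fixes p :: "'t \<Rightarrow> real"
  assumes D: "D \<in> sets M" and p: "integrable M p"
    and nonneg: "\<And>A. A \<in> sets N \<Longrightarrow> 0 \<le> (LINT t:A|M. p t)"
    and le: "\<And>A. A \<in> sets N \<Longrightarrow> (LINT t:A|M. p t) \<le> prob (A \<inter> D)"
  shows "\<exists>D'\<in>sets M. D' \<subseteq> D \<and> (\<forall>A\<in>sets N. prob (A \<inter> D') = (LINT t:A|M. p t))"
proof -
  define C where "C E \<longleftrightarrow> E \<in> sets M \<and> E \<subseteq> D \<and> (\<forall>A\<in>sets N. prob (A \<inter> E) \<le> (LINT t:A|M. p t))" for E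
  have "\<exists>E. C E \<and> (\<forall>E'. C E' \<and> E \<subseteq> E' \<longrightarrow> prob E' = prob E)"
  proof (rule exhaustion)
    show "finite_measure M" by unfold_locales
    show "C {}" using nonneg by (auto simp: C_def)
    show "E \<in> sets M" if "C E" for E using that by (auto simp: C_def)
    show "C (\<Union>n. E n)" if E: "\<And>n. C (E n)" "incseq E" for E :: "nat \<Rightarrow> 't set"
      unfolding C_def
    proof (intro conjI ballI)
      show "(\<Union>n. E n) \<in> sets M" "(\<Union>n. E n) \<subseteq> D" using E(1) by (auto simp: C_def)
      fix A assume A: "A \<in> sets N"
      have "(\<lambda>n. prob (A \<inter> E n)) \<longlonglongrightarrow> prob (\<Union>n. A \<inter> E n)"
        using E A sub_sets by (intro finite_Lim_measure_incseq) (auto simp: C_def intro!: monoI dest: incseqD)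
      then show "prob (A \<inter> (\<Union>n. E n)) \<le> (LINT t:A|M. p t)"
        using E(1) A by (intro LIMSEQ_le_const2[of "\<lambda>n. prob (A \<inter> E n)"]) (auto simp: C_def)
    qed
  qed
  then obtain E where E: "C E" and max: "\<And>E'. C E' \<Longrightarrow> E \<subseteq> E' \<Longrightarrow> prob E' = prob E" by blast
  have EM[measurable]: "E \<in> sets M" and ED: "E \<subseteq> D" using E by (auto simp: C_def)
  have Ele: "prob (A \<inter> E) \<le> (LINT t:A|M. p t)" if "A \<in> sets N" for A
    using E that by (auto simp: C_def)
  have "prob (A \<inter> E) = (LINT t:A|M. p t)" if A: "A \<in> sets N" for A
  proof (rule ccontr)
    assume neq: "prob (A \<inter> E) \<noteq> (LINT t:A|M. p t)"
    define q where "q t = p t - indicator E t" for t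
    have q: "integrable M q" unfolding q_def using p EM
      by (intro Bochner_Integration.integrable_diff) (auto simp: emeasure_eq_measure)
    have qA: "(LINT t:A|M. q t) = (LINT t:A|M. p t) - prob (A \<inter> E)" if "A \<in> sets N" for A
      unfolding q_def using that
      by (subst set_integral_diff)
        (auto simp: set_integral_indicator_prob sub_sets emeasure_eq_measure intro!: set_integrable_sub p)
    define g where "g = real_cond_exp M N q"
    have gm[measurable]: "g \<in> borel_measurable N" by (simp add: g_def)
    have gi: "integrable M g" unfolding g_def by (intro real_cond_exp_int q)
    have gA: "(LINT t:A|M. g t) = (LINT t:A|M. p t) - prob (A \<inter> E)" if "A \<in> sets N" for A
      unfolding g_def using that q by (subst real_cond_exp_intA[symmetric]) (auto simp: qA)
    define P where "P n = {t \<in> space N. 1 / 2^n < g t}" for n :: nat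
    have P: "P n \<in> sets N" for n unfolding P_def by measurable
    have "\<exists>n. prob (P n) > 0"
    proof (rule ccontr)
      assume "\<nexists>n. prob (P n) > 0"
      then have "AE t in M. t \<notin> P n" for n
        using measure_nonneg[of M "P n"] sub_sets[OF P]
        by (intro AE_not_in) (auto simp: null_sets_def emeasure_eq_measure not_less intro!: antisym)
      then have "AE t in M. \<forall>n. t \<notin> P n" by (simp add: AE_all_countable)
      with AE_space have "AE t in M. g t \<le> 0"
      proof (eventually_elim)
        fix t assume t: "t \<in> space M" "\<forall>n. t \<notin> P n"
        then have "g t \<le> (1/2)^n" for n
          by (auto simp: P_def power_one_over not_less sub_space)
        then show "g t \<le> 0"
          by (intro LIMSEQ_le_const[of "\<lambda>n. (1/2)^n"]) (auto intro!: LIMSEQ_power_zero)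
      qed
      then have "(LINT t:A|M. g t) \<le> 0"
        unfolding set_lebesgue_integral_def
        using integral_nonneg_AE[of "\<lambda>t. - (indicator A t *\<^sub>R g t)" M]
        by (simp add: indicator_def eventually_mono)
      with gA[OF A] Ele[OF A] neq show False by simp
    qed
    then obtain n where n: "prob (P n) > 0" by blast
    \<comment> \<open>On \<open>A - P n\<close> the deficit has nonnegative integral and is dropped;
      on \<open>A \<inter> P n\<close> it exceeds \<open>1/2^n\<close> pointwise.\<close>
    have "1/2^n * prob (A \<inter> P n) \<le> (LINT t:A|M. p t) - prob (A \<inter> E)" if A: "A \<in> sets N" for A
    proof -
      have AP: "A \<inter> P n \<in> sets N" "A - P n \<in> sets N" using A P by auto
      have "1/2^n * prob (A \<inter> P n) = (LINT t:A\<inter>P n|M. 1/2^n)"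
        using sub_sets[OF AP(1)] by (simp add: set_lebesgue_integral_def)
      also have "\<dots> \<le> (LINT t:A\<inter>P n|M. g t)"
        using AP by (intro set_integral_mono set_integrable_sub gi) (auto simp: P_def)
      also have "\<dots> \<le> (LINT t:A\<inter>P n|M. g t) + (LINT t:A-P n|M. g t)"
        using gA[OF AP(2)] Ele[OF AP(2)] by simp
      also have "\<dots> = (LINT t:(A\<inter>P n)\<union>(A-P n)|M. g t)"
        using AP by (intro set_integral_Un[symmetric] set_integrable_sub gi) auto
      also have "(A\<inter>P n)\<union>(A-P n) = A" by auto
      finally show ?thesis by (simp add: gA[OF A])
    qed
    note key = this
    define D1 where "D1 = P n \<inter> (D - E)"
    have D1: "D1 \<in> sets M" using D sub_sets[OF P] by (auto simp: D1_def)
    have "0 < 1/2^n * prob (P n)" using n by simp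
    also have "\<dots> \<le> (LINT t:P n|M. p t) - prob (P n \<inter> E)" using key[OF P, of n] by simp
    also have "\<dots> \<le> prob (P n \<inter> D) - prob (P n \<inter> E)" using le[OF P] by simp
    also have "\<dots> = prob (P n \<inter> D - P n \<inter> E)"
      using sub_sets[OF P] D ED by (intro finite_measure_Diff[symmetric]) auto
    also have "P n \<inter> D - P n \<inter> E = D1" by (auto simp: D1_def)
    finally have "prob D1 > 0" .
    from exists_cond_small[OF D1 this, of n] obtain B
      where B: "B \<in> sets M" "B \<subseteq> D1" "prob B > 0"
        and Ble: "\<And>A. A \<in> sets N \<Longrightarrow> prob (A \<inter> B) \<le> prob (A \<inter> D1) / 2^n"
      by (elim bexE conjE) (rule that, auto)
    \<comment> \<open>Over \<open>A\<close> the new piece costs at most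
      \<open>prob (A \<inter> P n) / 2^n\<close>, which is just the room left by
      \<open>key\<close>.\<close>
    have "C (E \<union> B)" unfolding C_def
    proof (intro conjI ballI)
      show "E \<union> B \<in> sets M" "E \<union> B \<subseteq> D" using B ED by (auto simp: D1_def)
      fix A assume A: "A \<in> sets N"
      have "prob (A \<inter> (E \<union> B)) \<le> prob (A \<inter> E) + prob (A \<inter> B)"
        using A B sub_sets by (subst Int_Un_distrib) (auto intro!: measure_subadditive simp: emeasure_eq_measure)
      also have "prob (A \<inter> B) \<le> prob (A \<inter> P n) / 2^n"
        using Ble[OF A] sub_sets[OF A] sub_sets[OF P]
        by (elim order_trans) (intro divide_right_mono finite_measure_mono, auto simp: D1_def)
      finally show "prob (A \<inter> (E \<union> B)) \<le> (LINT t:A|M. p t)" using key[OF A] by simp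
    qed
    then have "prob (E \<union> B) = prob E" using max by blast
    moreover have "prob (E \<union> B) = prob E + prob B"
      using B by (intro finite_measure_Union) (auto simp: D1_def)
    ultimately show False using B by simp
  qed
  with EM ED show ?thesis by blast
qed

end

text \<open>Words are stored with their last bit at the head, so that \<open>x # c\<close> is a child of \<open>c\<close> in the
  binary tree.\<close>

primrec bits_upto :: "(nat \<Rightarrow> bool) \<Rightarrow> nat \<Rightarrow> bool list" where
  "bits_upto b 0 = []"
| "bits_upto b (Suc n) = b n # bits_upto b n"

lemma length_bits_upto[simp]: "length (bits_upto b n) = n"
  by (induction n) auto

section \<open>Trees of conditional masses realised by nested events\<close>

context nowhere_equivalent_subalgebra
begin

text \<open>Inside \<open>D c\<close> the conditional subset theorem cuts out the
  \<open>False\<close> child with the masses of \<open>p (False # c)\<close>; additivity of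
  \<open>p\<close> leaves the right masses for the \<open>True\<close> child. Only integrals of the
  weights over sets of \<open>sets N\<close> enter. The digits \<open>b t\<close> record the branch
  of nested sets that contains \<open>t\<close>.\<close>

lemma tree_realization:
  fixes p :: "bool list \<Rightarrow> 't \<Rightarrow> real"
  assumes int: "\<And>c. integrable M (p c)"
    and root: "AE t in M. p [] t = 1"
    and split: "\<And>c. AE t in M. p c t = p (False # c) t + p (True # c) t"
    and nonneg: "\<And>c. AE t in M. 0 \<le> p c t"
  obtains b :: "'t \<Rightarrow> nat \<Rightarrow> bool" where
    "\<And>i. {t \<in> space M. b t i} \<in> sets M"
    "\<And>c A. A \<in> sets N \<Longrightarrow> prob {t \<in> A. bits_upto (b t) (length c) = c} = (LINT t:A|M. p c t)"
proof -
  define ok where "ok c E D' \<longleftrightarrow> D' \<in> sets M \<and> D' \<subseteq> E \<and>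
    (\<forall>A\<in>sets N. prob (A \<inter> D') = (LINT t:A|M. p (False # c) t))" for c E D'
  \<comment> \<open>A total choice whose property is guaranteed once \<open>E\<close> carries the
    masses of \<open>p c\<close>; this is established together with the induction
    \<open>inv\<close>.\<close>
  define S where "S c E = (SOME D'. ok c E D')" for c E
  define D where "D = rec_list (space M) (\<lambda>x c E. if x then E - S c E else S c E)"
  have D_Nil: "D [] = space M" and D_True: "D (True # c) = D c - S c (D c)"
    and D_False: "D (False # c) = S c (D c)" for c
    by (auto simp: D_def)
  have set_nonneg: "0 \<le> (LINT t:A|M. p c t)" for A c
    unfolding set_lebesgue_integral_def using nonneg[of c]
    by (intro integral_nonneg_AE) (auto simp: indicator_def elim: eventually_mono)
  have set_split: "(LINT t:A|M. p c t) = (LINT t:A|M. p (False # c) t) + (LINT t:A|M. p (True # c) t)"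
    if A: "A \<in> sets N" for A c
  proof -
    have "(LINT t:A|M. p c t) = (LINT t:A|M. p (False # c) t + p (True # c) t)"
      using split[of c] int sub_sets[OF A] unfolding set_lebesgue_integral_def
      by (intro integral_cong_AE) (auto elim: eventually_mono)
    then show ?thesis using A by (simp add: set_integral_add set_integrable_sub int)
  qed
  have ok_S: "ok c (D c) (S c (D c))"
    if D: "D c \<in> sets M" "\<forall>A\<in>sets N. prob (A \<inter> D c) = (LINT t:A|M. p c t)" for c
  proof -
    have "(LINT t:A|M. p (False # c) t) \<le> prob (A \<inter> D c)" if A: "A \<in> sets N" for A
      using D(2) A set_split[OF A, of c] set_nonneg[of A "True # c"] by simp
    then have "\<exists>D'. ok c (D c) D'"
      unfolding ok_def using exists_subset_with_cond_prob[OF D(1) int set_nonneg]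
      by (simp add: Bex_def)
    then show ?thesis unfolding S_def by (rule someI_ex)
  qed
  have inv: "D c \<in> sets M \<and> (\<forall>A\<in>sets N. prob (A \<inter> D c) = (LINT t:A|M. p c t))" for c
  proof (induction c)
    case Nil
    show ?case unfolding D_Nil
    proof (intro conjI ballI)
      fix A assume A: "A \<in> sets N"
      have "(LINT t:A|M. p [] t) = (LINT t:A|M. 1)"
        using root int sub_sets[OF A] unfolding set_lebesgue_integral_def
        by (intro integral_cong_AE) (auto elim: eventually_mono)
      then show "prob (A \<inter> space M) = (LINT t:A|M. p [] t)"
        using sub_sets[OF A] by (simp add: set_lebesgue_integral_def)
    qed auto
  next
    case (Cons x c)
    have "ok c (D c) (S c (D c))" using Cons by (intro ok_S) auto
    then have S: "S c (D c) \<in> sets M" "S c (D c) \<subseteq> D c"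
      and SA: "\<And>A. A \<in> sets N \<Longrightarrow> prob (A \<inter> S c (D c)) = (LINT t:A|M. p (False # c) t)"
      by (auto simp: ok_def)
    show ?case
    proof (cases x)
      case False
      then show ?thesis using S SA by (simp add: D_False)
    next
      case True
      have "prob (A \<inter> (D c - S c (D c))) = (LINT t:A|M. p (True # c) t)" if A: "A \<in> sets N" for A
      proof -
        have "A \<inter> (D c - S c (D c)) = A \<inter> D c - A \<inter> S c (D c)" by auto
        then have "prob (A \<inter> (D c - S c (D c))) = prob (A \<inter> D c) - prob (A \<inter> S c (D c))"
          using finite_measure_Diff[of "A \<inter> D c" "A \<inter> S c (D c)"] S Cons sub_sets[OF A] by auto
        then show ?thesis using Cons A set_split[OF A, of c] SA[OF A] by simp
      qed
      then show ?thesis using S Cons True by (auto simp: D_True)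
    qed
  qed
  have sub: "D (x # c) \<subseteq> D c" for x c
    using ok_S[of c] inv[of c] by (cases x) (auto simp: ok_def D_True D_False)
  have unique: "c = c'" if "length c = length c'" "t \<in> D c" "t \<in> D c'" for c c' t
    using that
  proof (induction c c' rule: list_induct2)
    case (Cons x c y c')
    then have "c = c'" using sub by blast
    with Cons show ?case by (cases x; cases y) (auto simp: D_True D_False)
  qed simp
  \<comment> \<open>By \<open>unique\<close> at most one word \<open>c\<close> of length
    \<open>i\<close> has \<open>t\<close> in \<open>D c\<close>; digit \<open>i\<close> says into
    which child of that word \<open>t\<close> falls.\<close>
  define b where "b t i = (\<exists>c. length c = i \<and> t \<in> D (True # c))" for t i
  have b_iff: "b t (length c) \<longleftrightarrow> t \<in> D (True # c)" if "t \<in> D c" for t c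
    using that unique[of _ c t] sub unfolding b_def by blast
  have D_iff: "t \<in> D c \<longleftrightarrow> bits_upto (b t) (length c) = c" if "t \<in> space M" for t c
  proof (induction c)
    case (Cons x c)
    have "t \<in> D (x # c) \<longleftrightarrow> t \<in> D c \<and> b t (length c) = x"
      using b_iff[of t c] sub[of x c] by (cases x) (auto simp: D_True D_False)
    then show ?case using Cons by auto
  qed (simp add: D_Nil that)
  show thesis
  proof (rule that)
    fix i
    have "{t \<in> space M. b t i} = (\<Union>c\<in>{c. length c = i}. D (True # c))"
      using inv sets.sets_into_space by (fastforce simp: b_def)
    also have "\<dots> \<in> sets M" using inv by (intro sets.countable_UN') auto
    finally show "{t \<in> space M. b t i} \<in> sets M" .
  next
    fix c A assume A: "A \<in> sets N"
    have "{t \<in> A. bits_upto (b t) (length c) = c} = A \<inter> D c"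
      using D_iff sets.sets_into_space[OF sub_sets[OF A]] by auto
    then show "prob {t \<in> A. bits_upto (b t) (length c) = c} = (LINT t:A|M. p c t)"
      using inv A by simp
  qed
qed

end

section \<open>Convergence of convex combinations of tails\<close>

lemma abs_convex_combination_le:
  fixes w a :: "'i \<Rightarrow> real"
  assumes w: "\<And>j. 0 \<le> w j" "sum w J = 1" and a: "\<And>j. j \<in> J \<Longrightarrow> \<bar>a j\<bar> \<le> c"
  shows "\<bar>\<Sum>j\<in>J. w j * a j\<bar> \<le> c"
proof -
  have "\<bar>\<Sum>j\<in>J. w j * a j\<bar> \<le> (\<Sum>j\<in>J. w j * c)"
    by (intro order_trans[OF sum_abs] sum_mono) (simp add: abs_mult w(1) mult_left_mono a)
  also have "\<dots> = c" unfolding sum_distrib_right[symmetric] w(2) by simp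
  finally show ?thesis .
qed

text \<open>\<open>I n\<close>, the infimum of squared norms over combinations of indices from
  \<open>n\<close> on, increases to \<open>L\<close>. For near-minimisers the midpoint is again such
  a combination, so their squared distances are of order \<open>(1/16)^k\<close> and their mean
  distances of order \<open>(1/4)^k\<close>. These sum up, so the successive differences are
  absolutely summable almost everywhere.\<close>

lemma convex_combinations_converge_AE:
  fixes u :: "nat \<Rightarrow> 'a \<Rightarrow> real"
  assumes "prob_space P" and meas[measurable]: "\<And>n. u n \<in> borel_measurable P"
    and bound: "\<And>n x. x \<in> space P \<Longrightarrow> \<bar>u n x\<bar> \<le> 1"
  obtains J :: "nat \<Rightarrow> nat set" and w :: "nat \<Rightarrow> nat \<Rightarrow> real" where
    "\<And>n. finite (J n)" "\<And>n. J n \<subseteq> {n..}" "\<And>n j. 0 \<le> w n j" "\<And>n. sum (w n) (J n) = 1"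
    "AE x in P. convergent (\<lambda>n. \<Sum>j\<in>J n. w n j * u j x)"
proof -
  interpret prob_space P by fact
  define adm where "adm n J w \<longleftrightarrow> finite J \<and> J \<subseteq> {n..} \<and> (\<forall>j. 0 \<le> w j) \<and> sum w J = 1"
    for n :: nat and J and w :: "nat \<Rightarrow> real"
  define comb where "comb J w x = (\<Sum>j\<in>J. w j * u j x)" for J w x
  have comb_meas[measurable]: "comb J w \<in> borel_measurable P" for J w
    unfolding comb_def by measurable
  have comb_bound: "\<bar>comb J w x\<bar> \<le> 1" if "adm n J w" "x \<in> space P" for n J w x
    using that bound unfolding comb_def by (intro abs_convex_combination_le) (auto simp: adm_def)
  have int2: "integrable P (\<lambda>x. (comb J w x)\<^sup>2)" if "adm n J w" for n J w
    using comb_bound[OF that]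
    by (intro integrable_const_bound[where B = 1] AE_I2) (auto simp: abs_square_le_1)
  define Q where "Q J w = expectation (\<lambda>x. (comb J w x)\<^sup>2)" for J w
  define S where "S n = {Q J w |J w. adm n J w}" for n
  define I where "I n = Inf (S n)" for n
  have S_ne: "S n \<noteq> {}" for n
  proof -
    have "adm n {n} (\<lambda>_. 1)" by (simp add: adm_def)
    then show ?thesis unfolding S_def by blast
  qed
  have Q_nonneg: "0 \<le> Q J w" for J w unfolding Q_def by simp
  have S_bdd: "bdd_below (S n)" for n
    by (rule bdd_belowI[of _ 0]) (auto simp: S_def Q_nonneg)
  have I_le: "I n \<le> Q J w" if "adm n J w" for n J w
    unfolding I_def using that by (intro cInf_lower S_bdd) (auto simp: S_def)
  have Q_le: "Q J w \<le> 1" if "adm n J w" for n J w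
    unfolding Q_def using comb_bound[OF that]
    by (intro integral_le_const int2[OF that] AE_I2) (auto simp: abs_square_le_1)
  have adm_mono: "adm m J w" if "adm n J w" "m \<le> n" for m n J w
    using that by (auto simp: adm_def)
  have I_mono: "I m \<le> I n" if "m \<le> n" for m n
  proof -
    have "S n \<subseteq> S m" using adm_mono[OF _ that] unfolding S_def by blast
    then show ?thesis unfolding I_def by (intro cInf_superset_mono S_ne S_bdd)
  qed
  have I_le1: "I n \<le> 1" for n
  proof -
    have "adm n {n} (\<lambda>_. 1)" by (simp add: adm_def)
    from I_le[OF this] Q_le[OF this] show ?thesis by simp
  qed
  define L where "L = Sup (range I)"
  have I_le_L: "I n \<le> L" for n
    unfolding L_def by (intro cSUP_upper) (auto intro!: bdd_aboveI[of _ 1] I_le1)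
  \<comment> \<open>The tolerance \<open>(1/16)^k\<close> is chosen because its square root must be
    summable. Passing to \<open>max n k\<close> moves the combination into the tail from
    \<open>k\<close> on while \<open>I\<close> stays close to \<open>L\<close> by
    monotonicity.\<close>
  have near: "\<exists>J w n. k \<le> n \<and> adm n J w \<and> L - (1/16)^k \<le> I n \<and> Q J w \<le> L + (1/16)^k" for k :: nat
  proof -
    have "\<exists>n. L - (1/16)^k < I n"
    proof -
      have "bdd_above (range I)" by (auto intro!: bdd_aboveI[of _ 1] I_le1)
      then show ?thesis using less_cSUP_iff[of UNIV I "L - (1/16)^k"] unfolding L_def by simp
    qed
    then obtain n where n: "L - (1/16)^k < I n" by blast
    let ?n = "max n k"
    have "I ?n < I ?n + (1/16)^k" by simp
    then obtain q where "q \<in> S ?n" "q < I ?n + (1/16)^k"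
      unfolding I_def[of ?n] by (subst (asm) cInf_less_iff[OF S_ne S_bdd]) auto
    then obtain J w where "adm ?n J w" "Q J w \<le> I ?n + (1/16)^k"
      by (auto simp: S_def)
    moreover have "L - (1/16)^k \<le> I ?n" using n I_mono[of n ?n] by simp
    ultimately show ?thesis using I_le_L[of ?n]
      by (intro exI[of _ J] exI[of _ w] exI[of _ ?n]) auto
  qed
  then obtain J w \<nu> where \<nu>: "\<And>k::nat. k \<le> \<nu> k" and adm: "\<And>k. adm (\<nu> k) (J k) (w k)"
    and I\<nu>: "\<And>k. L - (1/16)^k \<le> I (\<nu> k)" and Q\<nu>: "\<And>k. Q (J k) (w k) \<le> L + (1/16)^k"
    by metis
  define g where "g k = comb (J k) (w k)" for k
  have g_meas[measurable]: "g k \<in> borel_measurable P" for k by (simp add: g_def)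
  have g_int2: "integrable P (\<lambda>x. (g k x)\<^sup>2)" for k
    unfolding g_def by (rule int2[OF adm])
  have g_bound: "\<bar>g k x\<bar> \<le> 1" if "x \<in> space P" for k x
    unfolding g_def by (rule comb_bound[OF adm that])
  have gint: "integrable P (\<lambda>x. \<bar>g (Suc k) x - g k x\<bar>)" "integrable P (\<lambda>x. (g (Suc k) x - g k x)\<^sup>2)"
    "integrable P (\<lambda>x. ((g (Suc k) x + g k x) / 2)\<^sup>2)" for k
  proof -
    have *: "\<bar>g (Suc k) x - g k x\<bar> \<le> 2" "\<bar>(g (Suc k) x + g k x) / 2\<bar> \<le> 2" if "x \<in> space P" for x
      using g_bound[OF that, of k] g_bound[OF that, of "Suc k"] by (auto simp: abs_le_iff)
    show "integrable P (\<lambda>x. \<bar>g (Suc k) x - g k x\<bar>)"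
      using * by (intro integrable_const_bound[where B = 2] AE_I2) auto
    show "integrable P (\<lambda>x. (g (Suc k) x - g k x)\<^sup>2)"
      using *(1) power_mono[OF *(1), of _ 2] by (intro integrable_const_bound[where B = 4] AE_I2) auto
    show "integrable P (\<lambda>x. ((g (Suc k) x + g k x) / 2)\<^sup>2)"
      using power_mono[OF *(2), of _ 2, unfolded power2_abs] by (intro integrable_const_bound[where B = 4] AE_I2) auto
  qed
  (* By the parallelogram identity, near-minimisers of the L2 norm form a Cauchy sequence. *)
  have d2: "expectation (\<lambda>x. (g (Suc k) x - g k x)\<^sup>2) \<le> 8 * (1/16)^k" for k
  proof -
    \<comment> \<open>The midpoint uses indices of both tails, so it is admissible only from the
      earlier of the two starting points.\<close>
    define n where "n = min (\<nu> k) (\<nu> (Suc k))"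
    have pow: "(1/16::real)^Suc k \<le> (1/16)^k" by simp
    have I_Suc: "L - (1/16)^k \<le> I (\<nu> (Suc k))"
      by (rule order_trans[OF diff_left_mono[OF pow] I\<nu>])
    have Q_Suc: "Q (J (Suc k)) (w (Suc k)) \<le> L + (1/16)^k"
      by (rule order_trans[OF Q\<nu> add_left_mono[OF pow]])
    have In: "L - (1/16)^k \<le> I n"
      using I\<nu>[of k] I_Suc unfolding n_def by (cases "\<nu> k \<le> \<nu> (Suc k)") (auto simp: min_def)
    define v where "v j = ((if j \<in> J k then w k j else 0) + (if j \<in> J (Suc k) then w (Suc k) j else 0)) / 2" for j
    let ?J = "J k \<union> J (Suc k)"
    have fin: "finite (J k)" for k using adm by (auto simp: adm_def)
    have restr: "(\<Sum>j\<in>?J. (if j \<in> J k then h j else 0)) = (\<Sum>j\<in>J k. h j)"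
      "(\<Sum>j\<in>?J. (if j \<in> J (Suc k) then h j else 0)) = (\<Sum>j\<in>J (Suc k). h j)" for h :: "nat \<Rightarrow> real"
      using fin by (auto intro!: sum.mono_neutral_cong_right)
    have "sum v ?J = (sum (w k) (J k) + sum (w (Suc k)) (J (Suc k))) / 2"
      unfolding v_def by (simp add: sum.distrib restr flip: sum_divide_distrib)
    also have "\<dots> = 1" using adm[of k] adm[of "Suc k"] by (simp add: adm_def)
    finally have "adm n ?J v"
      using adm[of k] adm[of "Suc k"] by (auto simp: adm_def n_def v_def)
    then have "I n \<le> Q ?J v" by (rule I_le)
    moreover have "comb ?J v x = (g (Suc k) x + g k x) / 2" for x
    proof -
      have "comb ?J v x = (\<Sum>j\<in>?J. ((if j \<in> J k then w k j * u j x else 0) +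
          (if j \<in> J (Suc k) then w (Suc k) j * u j x else 0)) / 2)"
        unfolding comb_def v_def by (intro sum.cong) (auto simp: field_simps)
      also have "\<dots> = (g (Suc k) x + g k x) / 2"
        unfolding g_def comb_def by (simp add: sum.distrib restr add.commute flip: sum_divide_distrib)
      finally show ?thesis .
    qed
    ultimately have mid: "I n \<le> expectation (\<lambda>x. ((g (Suc k) x + g k x) / 2)\<^sup>2)"
      unfolding Q_def by (simp only:)
    have "expectation (\<lambda>x. (g (Suc k) x - g k x)\<^sup>2) =
        expectation (\<lambda>x. 2 * (g (Suc k) x)\<^sup>2 + 2 * (g k x)\<^sup>2 - 4 * ((g (Suc k) x + g k x) / 2)\<^sup>2)"
      by (intro Bochner_Integration.integral_cong) (auto simp: power2_eq_square field_simps)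
    also have "\<dots> = 2 * expectation (\<lambda>x. (g (Suc k) x)\<^sup>2) + 2 * expectation (\<lambda>x. (g k x)\<^sup>2)
        - 4 * expectation (\<lambda>x. ((g (Suc k) x + g k x) / 2)\<^sup>2)"
      using g_int2 gint(3) by simp
    also have "\<dots> \<le> 2 * (L + (1/16)^k) + 2 * (L + (1/16)^k) - 4 * (L - (1/16)^k)"
      using Q\<nu>[of k] Q_Suc mid In unfolding Q_def g_def[symmetric] by simp
    finally show ?thesis by simp
  qed
  have d1: "expectation (\<lambda>x. \<bar>g (Suc k) x - g k x\<bar>) \<le> 5 * (1/4)^k" for k
  proof -
    \<comment> \<open>The weight \<open>4^k\<close> balances the two terms: a squared norm of at
      most \<open>8 * (1/16)^k\<close> yields \<open>9/2 * (1/4)^k\<close>, rounded up to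
      \<open>5 * (1/4)^k\<close>.\<close>
    have "\<bar>y\<bar> \<le> ((1/4)^k + 4^k * y\<^sup>2) / 2" for y :: real
    proof -
      have "0 \<le> 4^k * (\<bar>y\<bar> - (1/4)^k)\<^sup>2" by simp
      also have "\<dots> = (1/4)^k + 4^k * y\<^sup>2 - 2 * \<bar>y\<bar>"
        by (simp add: power2_eq_square algebra_simps power_one_over)
      finally show ?thesis by simp
    qed
    then have "expectation (\<lambda>x. \<bar>g (Suc k) x - g k x\<bar>)
        \<le> expectation (\<lambda>x. ((1/4)^k + 4^k * (g (Suc k) x - g k x)\<^sup>2) / 2)"
      using gint by (intro integral_mono) auto
    also have "\<dots> = ((1/4)^k + 4^k * expectation (\<lambda>x. (g (Suc k) x - g k x)\<^sup>2)) / 2"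
      using gint by (simp add: prob_space)
    also have "\<dots> \<le> ((1/4)^k + 4^k * (8 * (1/16)^k)) / 2"
      using d2[of k] by (intro divide_right_mono add_left_mono mult_left_mono) auto
    also have "(4::real)^k * (8 * (1/16)^k) = 8 * (1/4)^k"
      by (simp add: power_mult_distrib[symmetric])
    also have "((1/4)^k + 8 * (1/4)^k) / 2 \<le> 5 * (1/4::real)^k" by simp
    finally show ?thesis .
  qed
  have "(\<integral>\<^sup>+x. (\<Sum>k. ennreal \<bar>g (Suc k) x - g k x\<bar>) \<partial>P) = (\<Sum>k. \<integral>\<^sup>+x. ennreal \<bar>g (Suc k) x - g k x\<bar> \<partial>P)"
    by (intro nn_integral_suminf) auto
  also have "\<dots> = (\<Sum>k. ennreal (expectation (\<lambda>x. \<bar>g (Suc k) x - g k x\<bar>)))"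
    using gint(1) by (subst nn_integral_eq_integral) auto
  also have "\<dots> \<le> (\<Sum>k. ennreal (5 * (1/4)^k))"
    using d1 by (intro suminf_le summableI ennreal_leI)
  also have "\<dots> < \<infinity>"
    by (subst suminf_ennreal2) (auto intro!: summable_mult summable_geometric)
  finally have "AE x in P. (\<Sum>k. ennreal \<bar>g (Suc k) x - g k x\<bar>) \<noteq> \<infinity>"
    by (intro nn_integral_PInf_AE) auto
  then have "AE x in P. convergent (\<lambda>k. \<Sum>j\<in>J k. w k j * u j x)"
  proof eventually_elim
    fix x assume "(\<Sum>k. ennreal \<bar>g (Suc k) x - g k x\<bar>) \<noteq> \<infinity>"
    then have "summable (\<lambda>k. \<bar>g (Suc k) x - g k x\<bar>)"
      by (intro summable_suminf_not_top) auto
    then have "summable (\<lambda>k. g (Suc k) x - g k x)" by (rule summable_rabs_cancel)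
    then have "convergent (\<lambda>n. g n x - g 0 x)"
      using sum_lessThan_telescope[of "\<lambda>k. g k x"] by (simp add: summable_iff_convergent)
    then have "convergent (\<lambda>n. (g n x - g 0 x) + g 0 x)" by (intro convergent_add convergent_const)
    then show "convergent (\<lambda>k. \<Sum>j\<in>J k. w k j * u j x)" by (simp add: g_def comb_def)
  qed
  moreover have "J k \<subseteq> {k..}" for k using adm[of k] \<nu>[of k] by (auto simp: adm_def)
  ultimately show thesis using adm by (intro that[of J w]) (auto simp: adm_def)
qed

text \<open>The same weights must serve all indices. The index is turned into a second random
  variable with geometric law, so that the family becomes one function on a product space. Every
  natural number has positive geometric mass, hence convergence almost everywhere on the product
  gives it for each index.\<close>

lemma convex_combinations_converge_AE_family:
  fixes u :: "nat \<Rightarrow> 'i::countable \<Rightarrow> 'a \<Rightarrow> real"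
  assumes "prob_space M" and meas[measurable]: "\<And>n i. u n i \<in> borel_measurable M"
    and bound: "\<And>n i x. x \<in> space M \<Longrightarrow> \<bar>u n i x\<bar> \<le> 1"
  obtains J :: "nat \<Rightarrow> nat set" and w :: "nat \<Rightarrow> nat \<Rightarrow> real" where
    "\<And>n. finite (J n)" "\<And>n. J n \<subseteq> {n..}" "\<And>n j. 0 \<le> w n j" "\<And>n. sum (w n) (J n) = 1"
    "AE x in M. \<forall>i. convergent (\<lambda>n. \<Sum>j\<in>J n. w n j * u j i x)"
proof -
  interpret M: prob_space M by fact
  define G where "G = measure_pmf (geometric_pmf (1/2))"
  interpret G: prob_space G unfolding G_def by (rule measure_pmf.prob_space_axioms)
  interpret GM: pair_prob_space G M ..
  define v where "v n z = u n (from_nat (fst z)) (snd z)" for n and z :: "nat \<times> 'a"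
  have "v n \<in> borel_measurable (count_space UNIV \<Otimes>\<^sub>M M)" for n
    unfolding v_def case_prod_beta'[symmetric]
    by (rule measurable_pair_measure_countable1) (auto simp: case_prod_beta)
  moreover have "sets (G \<Otimes>\<^sub>M M) = sets (count_space UNIV \<Otimes>\<^sub>M M)"
    by (intro sets_pair_measure_cong) (auto simp: G_def)
  ultimately have v: "v n \<in> borel_measurable (G \<Otimes>\<^sub>M M)" for n
    by (simp cong: measurable_cong_sets)
  obtain J w where J: "\<And>n. finite (J n)" "\<And>n. J n \<subseteq> {n..}" "\<And>n j. 0 \<le> w n j" "\<And>n. sum (w n) (J n) = 1"
    and AE: "AE z in G \<Otimes>\<^sub>M M. convergent (\<lambda>n. \<Sum>j\<in>J n. w n j * v j z)"
  proof (rule convex_combinations_converge_AE[of "G \<Otimes>\<^sub>M M" v])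
    show "prob_space (G \<Otimes>\<^sub>M M)" by (rule GM.prob_space_axioms)
    show "\<bar>v n z\<bar> \<le> 1" if "z \<in> space (G \<Otimes>\<^sub>M M)" for n z
      using that by (auto simp: v_def space_pair_measure intro: bound)
  qed (auto intro: v)
  have "AE k in G. AE x in M. convergent (\<lambda>n. \<Sum>j\<in>J n. w n j * v j (k, x))"
    using GM.AE_pair[OF AE] by simp
  then have "\<forall>k. AE x in M. convergent (\<lambda>n. \<Sum>j\<in>J n. w n j * v j (k, x))"
    unfolding G_def by (subst (asm) AE_measure_pmf_iff) (auto simp: set_pmf_geometric)
  then have "AE x in M. \<forall>k. convergent (\<lambda>n. \<Sum>j\<in>J n. w n j * v j (k, x))"
    by (simp add: AE_all_countable)
  then have "AE x in M. \<forall>i. convergent (\<lambda>n. \<Sum>j\<in>J n. w n j * u j i x)"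
  proof eventually_elim
    fix x assume *: "\<forall>k. convergent (\<lambda>n. \<Sum>j\<in>J n. w n j * v j (k, x))"
    show "\<forall>i. convergent (\<lambda>n. \<Sum>j\<in>J n. w n j * u j i x)"
    proof
      fix i :: 'i
      show "convergent (\<lambda>n. \<Sum>j\<in>J n. w n j * u j i x)"
        using *[rule_format, of "to_nat i"] by (simp add: v_def)
    qed
  qed
  with J show thesis by (rule that)
qed

section \<open>Coding the cube by the Cantor space\<close>

text \<open>With digits -1 and 1 the expansions fill the symmetric interval \<open>[-1,1]\<close>,
  and an expected digit is the difference of two masses.\<close>

definition bit_sign :: "bool \<Rightarrow> real" where
  "bit_sign x = (if x then 1 else -1)"

text \<open>A continuous map of the Cantor space onto the Hilbert cube: the pairing function splits
  the digits into rows, and row \<open>k\<close> is the signed binary expansion of coordinate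
  \<open>k\<close>.\<close>

definition cube_point :: "(nat \<Rightarrow> bool) \<Rightarrow> nat \<Rightarrow> real" where
  "cube_point b k = (\<Sum>j. bit_sign (b (prod_encode (k, j))) * (1/2)^Suc j)"

lemma abs_bit_sign[simp]: "\<bar>bit_sign x\<bar> = 1"
  by (simp add: bit_sign_def)

lemma summable_half_powers: "summable (\<lambda>j. (1/2::real)^Suc j)"
  by (intro summable_mult summable_geometric | simp)+

lemma summable_cube_point: "summable (\<lambda>j. bit_sign (b j) * (1/2)^Suc j)"
  by (rule summable_comparison_test'[OF summable_half_powers, of 0]) (simp add: abs_mult)

lemma continuous_cube_point: "continuous_on UNIV (\<lambda>b. cube_point b)"
proof (rule continuous_on_coordinatewise_then_product)
  fix k
  have "continuous_on UNIV (\<lambda>b. bit_sign (b i))" for i :: nat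
  proof -
    have "continuous_on UNIV (bit_sign \<circ> (\<lambda>b. b i))"
      by (intro continuous_on_compose continuous_on_product_coordinates) simp
    then show ?thesis by (simp add: o_def)
  qed
  then have cont: "continuous_on UNIV (\<lambda>b. \<Sum>j<n. bit_sign (b (prod_encode (k, j))) * (1/2)^Suc j)" for n
    by (intro continuous_intros)
  have "uniform_limit UNIV (\<lambda>n b. \<Sum>j<n. bit_sign (b (prod_encode (k, j))) * (1/2)^Suc j)
      (\<lambda>b. cube_point b k) sequentially"
    unfolding cube_point_def
    by (rule Weierstrass_m_test[OF _ summable_half_powers]) (simp add: abs_mult)
  from uniform_limit_theorem[OF _ this] cont show "continuous_on UNIV (\<lambda>b. cube_point b k)"
    by simp
qed

lemma cube_point_surj:
  fixes y :: "nat \<Rightarrow> real"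
  assumes "\<And>k. \<bar>y k\<bar> \<le> 1"
  obtains b where "cube_point b = y"
proof -
  have "\<exists>d. (\<lambda>j. bit_sign (d j) * (1/2)^Suc j) sums x" if x: "\<bar>x\<bar> \<le> 1" for x :: real
  proof -
    \<comment> \<open>Greedy digits: \<open>r n\<close> is \<open>2^n\<close> times the remainder
      after \<open>n\<close> digits. Subtracting the sign of \<open>r n\<close> after doubling keeps
      it in \<open>[-1,1]\<close>.\<close>
    define r where "r = rec_nat x (\<lambda>_ z. 2 * z - bit_sign (0 \<le> z))"
    have r0: "r 0 = x" and rS: "r (Suc n) = 2 * r n - bit_sign (0 \<le> r n)" for n
      by (auto simp: r_def)
    have r_le: "\<bar>r n\<bar> \<le> 1" for n
    proof (induction n)
      case (Suc n)
      then show ?case by (auto simp: rS bit_sign_def abs_le_iff)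
    qed (simp add: r0 x)
    have part: "(\<Sum>j<n. bit_sign (0 \<le> r j) * (1/2)^Suc j) = x - (1/2)^n * r n" for n
      by (induction n) (auto simp: r0 rS algebra_simps)
    have "(\<lambda>n. (1/2)^n * r n) \<longlonglongrightarrow> 0"
    proof (rule Lim_null_comparison)
      show "\<forall>\<^sub>F n in sequentially. norm ((1/2)^n * r n) \<le> (1/2)^n"
        using r_le by (intro always_eventually) (auto simp: abs_mult intro: mult_left_le)
    qed (auto intro!: LIMSEQ_power_zero)
    then have "(\<lambda>n. x - (1/2)^n * r n) \<longlonglongrightarrow> x - 0" by (intro tendsto_intros)
    then have "(\<lambda>j. bit_sign (0 \<le> r j) * (1/2)^Suc j) sums x"
      unfolding sums_def part by simp
    then show ?thesis by (rule exI[of _ "\<lambda>j. 0 \<le> r j"])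
  qed
  then have "\<forall>k. \<exists>d. (\<lambda>j. bit_sign (d j) * (1/2)^Suc j) sums y k" using assms by simp
  then obtain d where "\<forall>k. (\<lambda>j. bit_sign (d k j) * (1/2)^Suc j) sums y k"
    by (rule choice[THEN exE])
  then have d: "(\<lambda>j. bit_sign (d k j) * (1/2)^Suc j) sums y k" for k ..
  have "cube_point (\<lambda>i. case prod_decode i of (k, j) \<Rightarrow> d k j) = y"
    unfolding cube_point_def using d by (auto simp: sums_iff)
  then show thesis by (rule that)
qed

lemma compact_bits_upto: "compact {b. bits_upto b (length c) = c}"
proof -
  have cont: "continuous_on UNIV (\<lambda>b::nat \<Rightarrow> bool. b i)" for i
    by (rule continuous_on_product_coordinates)
  have "closed {b. bits_upto b (length c) = c}"
  proof (induction c)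
    case (Cons x c)
    have "{b::nat \<Rightarrow> bool. b (length c) = x} = (\<lambda>b. b (length c)) -` {x}" by auto
    also have "closed \<dots>"
      using cont by (intro closed_vimage) auto
    finally have "closed ({b. b (length c) = x} \<inter> {b. bits_upto b (length c) = c})"
      using Cons by (intro closed_Int)
    moreover have "{b. b (length c) = x} \<inter> {b. bits_upto b (length c) = c}
        = {b. bits_upto b (length (x # c)) = x # c}" by auto
    ultimately show ?case by simp
  qed simp
  moreover have "compact (UNIV :: (nat \<Rightarrow> bool) set)"
  proof -
    have "compact_space (product_topology (\<lambda>_::nat. euclidean :: bool topology) UNIV)"
      unfolding compact_space_product_topology by (simp add: compact_space_def finite_imp_compact)
    then show ?thesis by (simp add: compact_space_def euclidean_product_topology)
  qed
  ultimately show ?thesis using compact_Int_closed by fastforce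
qed

text \<open>Cells of one level overlap at points with two expansions. This does no harm, since
  masses are attached to words and not to cells.\<close>

abbreviation cell :: "bool list \<Rightarrow> (nat \<Rightarrow> real) set" where
  "cell c \<equiv> cube_point ` {b. bits_upto b (length c) = c}"

lemma compact_cell: "compact (cell c)"
  using continuous_on_subset[OF continuous_cube_point] compact_bits_upto
  by (intro compact_continuous_image) auto

lemma bits_upto_eq_iff: "bits_upto b n = bits_upto b' n \<longleftrightarrow> (\<forall>i<n. b i = b' i)"
  by (induction n) (auto simp: less_Suc_eq)

lemma tendsto_fun_iff:
  fixes f :: "'a \<Rightarrow> 'i \<Rightarrow> 'b::topological_space"
  shows "(f \<longlongrightarrow> l) F \<longleftrightarrow> (\<forall>i. ((\<lambda>x. f x i) \<longlongrightarrow> l i) F)"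
  using limitin_componentwise[of "\<lambda>_. euclidean" UNIV f l F]
  by (simp add: euclidean_product_topology)

lemma bits_upto_limit:
  assumes "\<And>n. bits_upto (\<beta> n) n = bits_upto b n"
  shows "\<beta> \<longlonglongrightarrow> b"
  unfolding tendsto_fun_iff
proof
  fix i
  have "\<beta> n i = b i" if "i < n" for n using assms that by (auto simp: bits_upto_eq_iff)
  then have "\<forall>\<^sub>F n in sequentially. \<beta> n i = b i"
    using eventually_gt_at_top[of i] by (rule eventually_mono[rotated])
  then show "(\<lambda>n. \<beta> n i) \<longlonglongrightarrow> b i" by (rule tendsto_eventually)
qed

section \<open>The weak-star topology over a separable space\<close>

text \<open>Density is asked only of the scalar multiples, which suffices for linear functionals;
  the directions can then be kept in the unit ball, where a functional is bounded by its
  norm.\<close>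

definition dense_dirs :: "(nat \<Rightarrow> 'x::real_normed_vector) \<Rightarrow> bool" where
  "dense_dirs e \<longleftrightarrow>
     (\<forall>k. norm (e k) \<le> 1) \<and> (\<forall>x. \<forall>\<epsilon>>0. \<exists>k r. norm (x - r *\<^sub>R e k) < \<epsilon>)"

lemma exists_dense_dirs:
  assumes "separable_space (euclidean :: 'x::real_normed_vector topology)"
  obtains e :: "nat \<Rightarrow> 'x::real_normed_vector" where "dense_dirs e"
proof -
  obtain C :: "'x set" where C: "countable C" "closure C = UNIV"
    using assms unfolding separable_space_def by auto
  then have "C \<noteq> {}" by auto
  define d where "d = from_nat_into C"
  have range: "range d = C" unfolding d_def using \<open>C \<noteq> {}\<close> C(1) by (rule range_from_nat_into)
  \<comment> \<open>The denominator \<open>1 + norm (d k)\<close> also covers zero vectors.\<close>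
  define e where "e k = d k /\<^sub>R (1 + norm (d k))" for k
  have "dense_dirs e"
    unfolding dense_dirs_def
  proof (intro conjI allI impI)
    fix k
    have "norm (d k) / (1 + norm (d k)) \<le> 1"
      by (rule divide_le_eq_1[THEN iffD2]) (use norm_ge_zero[of "d k"] in linarith)
    then show "norm (e k) \<le> 1" by (simp add: e_def field_simps)
  next
    fix x and \<epsilon> :: real assume "\<epsilon> > 0"
    then obtain c where "c \<in> C" "dist c x < \<epsilon>"
      using C(2) by (metis UNIV_I closure_approachable)
    then obtain k where k: "dist (d k) x < \<epsilon>" using range by auto
    have pos: "1 + norm (d k) > 0" by (smt (verit) norm_ge_zero)
    have "norm (x - (1 + norm (d k)) *\<^sub>R e k) < \<epsilon>"
      using k pos by (simp add: e_def dist_norm norm_minus_commute)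
    then show "\<exists>k r. norm (x - r *\<^sub>R e k) < \<epsilon>" by blast
  qed
  then show thesis by (rule that)
qed

lemma dense_dirs_tendsto:
  assumes "dense_dirs e"
  obtains k :: "nat \<Rightarrow> nat" and r :: "nat \<Rightarrow> real" where "(\<lambda>n. r n *\<^sub>R e (k n)) \<longlonglongrightarrow> x"
proof -
  have "\<forall>n. \<exists>k r. norm (x - r *\<^sub>R e k) < inverse (real (Suc n))"
    using assms unfolding dense_dirs_def by (simp del: of_nat_Suc)
  then obtain k where "\<forall>n. \<exists>r. norm (x - r *\<^sub>R e (k n)) < inverse (real (Suc n))"
    by (rule choice[THEN exE])
  then obtain r where "\<forall>n. norm (x - r n *\<^sub>R e (k n)) < inverse (real (Suc n))"
    by (rule choice[THEN exE])
  then have kr: "norm (x - r n *\<^sub>R e (k n)) < inverse (real (Suc n))" for n ..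
  have "(\<lambda>n. x - r n *\<^sub>R e (k n)) \<longlonglongrightarrow> 0"
    by (rule Lim_null_comparison[OF always_eventually LIMSEQ_inverse_real_of_nat])
      (rule allI, rule less_imp_le, rule kr)
  then have "(\<lambda>n. x - (x - r n *\<^sub>R e (k n))) \<longlonglongrightarrow> x - 0" by (intro tendsto_diff tendsto_const)
  then have "(\<lambda>n. r n *\<^sub>R e (k n)) \<longlonglongrightarrow> x" by simp
  then show thesis by (rule that)
qed

lemma blinfun_eq_on_dense_dirs:
  fixes \<phi> \<psi> :: "'x::real_normed_vector dual" and e :: "nat \<Rightarrow> 'x"
  assumes e: "dense_dirs e" and eq: "\<And>k. \<phi> (e k) = \<psi> (e k)"
  shows "\<phi> = \<psi>"
proof (rule blinfun_eqI)
  fix x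
  obtain k r where x: "(\<lambda>n. r n *\<^sub>R e (k n)) \<longlonglongrightarrow> x" using dense_dirs_tendsto[OF e] .
  have "(\<lambda>n. \<phi> (r n *\<^sub>R e (k n))) \<longlonglongrightarrow> \<phi> x" "(\<lambda>n. \<psi> (r n *\<^sub>R e (k n))) \<longlonglongrightarrow> \<psi> x"
    using x by (auto intro!: blinfun.tendsto)
  then show "\<phi> x = \<psi> x" by (auto simp: blinfun.scaleR_right eq intro: LIMSEQ_unique)
qed

text \<open>The norm bound makes the approximation of \<open>x\<close> by multiples of directions
  uniform in \<open>n\<close>, so the values at \<open>x\<close> form a Cauchy sequence; their
  limits are linear in \<open>x\<close> and inherit the bound.\<close>

lemma bounded_dual_limit:
  fixes \<phi> :: "nat \<Rightarrow> 'x::real_normed_vector dual" and e :: "nat \<Rightarrow> 'x"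
  assumes e: "dense_dirs e" and C: "\<And>n. norm (\<phi> n) \<le> C"
    and conv: "\<And>k. convergent (\<lambda>n. \<phi> n (e k))"
  obtains \<psi> :: "'x dual" where "norm \<psi> \<le> C" "\<And>x. (\<lambda>n. \<phi> n x) \<longlonglongrightarrow> \<psi> x"
proof -
  have C0: "0 \<le> C" using C[of 0] norm_ge_zero order_trans by blast
  have bd: "\<bar>\<phi> n x\<bar> \<le> C * norm x" for n x
    using norm_blinfun[of "\<phi> n" x] C[of n] mult_right_mono[OF C norm_ge_zero, of n x] by simp
  have "convergent (\<lambda>n. \<phi> n x)" for x
  proof -
    have "Cauchy (\<lambda>n. \<phi> n x)"
    proof (rule metric_CauchyI)
      fix \<epsilon> :: real assume \<epsilon>: "\<epsilon> > 0"
      \<comment> \<open>\<open>C + 1\<close> keeps the denominator positive when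
        \<open>C = 0\<close>.\<close>
      define \<delta> where "\<delta> = \<epsilon> / (3 * (C + 1))"
      have \<delta>: "\<delta> > 0" "C * \<delta> < \<epsilon> / 3" using \<epsilon> C0 by (auto simp: \<delta>_def field_simps)
      from e \<delta>(1) obtain k r where kr: "norm (x - r *\<^sub>R e k) < \<delta>"
        unfolding dense_dirs_def by blast
      have small: "\<bar>\<phi> n x - r * \<phi> n (e k)\<bar> < \<epsilon> / 3" for n
      proof -
        have "\<bar>\<phi> n x - r * \<phi> n (e k)\<bar> = \<bar>\<phi> n (x - r *\<^sub>R e k)\<bar>"
          by (simp add: blinfun.diff_right blinfun.scaleR_right)
        also have "\<dots> \<le> C * norm (x - r *\<^sub>R e k)" by (rule bd)
        also have "\<dots> \<le> C * \<delta>" using kr C0 by (intro mult_left_mono) auto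
        finally show ?thesis using \<delta>(2) by simp
      qed
      have "Cauchy (\<lambda>n. r * \<phi> n (e k))"
        using conv[of k] by (intro convergent_Cauchy convergent_mult convergent_const)
      then obtain n0 where n0: "\<And>m n. m \<ge> n0 \<Longrightarrow> n \<ge> n0 \<Longrightarrow> dist (r * \<phi> m (e k)) (r * \<phi> n (e k)) < \<epsilon> / 3"
        using \<epsilon> by (meson metric_CauchyD divide_pos_pos zero_less_numeral)
      show "\<exists>M. \<forall>m\<ge>M. \<forall>n\<ge>M. dist (\<phi> m x) (\<phi> n x) < \<epsilon>"
      proof (intro exI[of _ n0] allI impI)
        fix m n assume "m \<ge> n0" "n \<ge> n0"
        then show "dist (\<phi> m x) (\<phi> n x) < \<epsilon>"
          using small[of m] small[of n] n0[of m n] unfolding dist_real_def by linarith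
      qed
    qed
    then show ?thesis by (rule Cauchy_convergent)
  qed
  then have lim: "(\<lambda>n. \<phi> n x) \<longlonglongrightarrow> lim (\<lambda>n. \<phi> n x)" for x
    by (simp add: convergent_LIMSEQ_iff)
  have le: "\<bar>lim (\<lambda>n. \<phi> n x)\<bar> \<le> norm x * C" for x
    using bd by (intro LIMSEQ_le_const2[OF tendsto_rabs[OF lim]]) (auto simp: mult.commute)
  have bl: "bounded_linear (\<lambda>x. lim (\<lambda>n. \<phi> n x))"
  proof (rule bounded_linear_intro)
    show "lim (\<lambda>n. \<phi> n (x + y)) = lim (\<lambda>n. \<phi> n x) + lim (\<lambda>n. \<phi> n y)" for x y
      using tendsto_add[OF lim[of x] lim[of y]] lim[of "x + y"]
      by (auto simp: blinfun.add_right intro: LIMSEQ_unique)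
    show "lim (\<lambda>n. \<phi> n (r *\<^sub>R x)) = r *\<^sub>R lim (\<lambda>n. \<phi> n x)" for r x
      using tendsto_scaleR[OF tendsto_const lim[of x], of r] lim[of "r *\<^sub>R x"]
      by (auto simp: blinfun.scaleR_right intro: LIMSEQ_unique)
    show "norm (lim (\<lambda>n. \<phi> n x)) \<le> norm x * C" for x using le by simp
  qed
  define \<psi> where "\<psi> = Blinfun (\<lambda>x. lim (\<lambda>n. \<phi> n x))"
  have \<psi>: "\<psi> x = lim (\<lambda>n. \<phi> n x)" for x
    unfolding \<psi>_def by (simp add: bounded_linear_Blinfun_apply[OF bl])
  show thesis
  proof (rule that)
    show "norm \<psi> \<le> C" using C0 le by (intro norm_blinfun_bound) (auto simp: \<psi> mult.commute)
    show "(\<lambda>n. \<phi> n x) \<longlonglongrightarrow> \<psi> x" for x unfolding \<psi> by (rule lim)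
  qed
qed

lemma bounded_dual_tendsto:
  fixes \<phi> :: "nat \<Rightarrow> 'x::real_normed_vector dual" and \<psi> :: "'x dual" and e :: "nat \<Rightarrow> 'x"
  assumes e: "dense_dirs e" and C: "\<And>n. norm (\<phi> n) \<le> C"
    and lim: "\<And>k. (\<lambda>n. \<phi> n (e k)) \<longlonglongrightarrow> \<psi> (e k)"
  shows "(\<lambda>n. \<phi> n x) \<longlonglongrightarrow> \<psi> x"
proof -
  have "convergent (\<lambda>n. \<phi> n (e k))" for k using lim by (rule convergentI)
  from bounded_dual_limit[OF e C this] obtain \<psi>' :: "'x dual" where \<psi>': "\<And>x. (\<lambda>n. \<phi> n x) \<longlonglongrightarrow> \<psi>' x"
    by blast
  have "\<psi>' = \<psi>" by (rule blinfun_eq_on_dense_dirs[OF e LIMSEQ_unique[OF \<psi>' lim]])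
  with \<psi>' show ?thesis by simp
qed

text \<open>The values at the directions form a sequence in the compact metrizable cube
  \<open>[-C,C]^nat\<close>; a convergent subsequence there already determines a limit
  functional.\<close>

lemma bounded_dual_subseq:
  fixes \<phi> :: "nat \<Rightarrow> 'x::real_normed_vector dual" and e :: "nat \<Rightarrow> 'x"
  assumes e: "dense_dirs e" and C: "\<And>n. norm (\<phi> n) \<le> C"
  obtains r :: "nat \<Rightarrow> nat" and \<psi> :: "'x dual"
  where "strict_mono r" "norm \<psi> \<le> C" "\<And>x. (\<lambda>n. \<phi> (r n) x) \<longlonglongrightarrow> \<psi> x"
proof -
  let ?B = "PiE UNIV (\<lambda>_::nat. {-C..C})"
  have "compactin (product_topology (\<lambda>_::nat. euclidean) UNIV) ?B"
    by (simp add: compactin_PiE)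
  then have "seq_compact ?B"
    by (simp add: euclidean_product_topology compact_imp_seq_compact)
  moreover have "\<forall>n. (\<lambda>k. \<phi> n (e k)) \<in> ?B"
  proof (intro allI PiE_I)
    fix n k
    have "\<bar>\<phi> n (e k)\<bar> \<le> norm (\<phi> n) * norm (e k)" using norm_blinfun[of "\<phi> n" "e k"] by simp
    also have "\<dots> \<le> C * 1"
      using e C order_trans[OF norm_ge_zero C] by (intro mult_mono) (auto simp: dense_dirs_def)
    finally show "\<phi> n (e k) \<in> {-C..C}" by (auto simp: abs_le_iff)
  qed auto
  ultimately obtain l r where r: "strict_mono r" and "((\<lambda>n k. \<phi> n (e k)) \<circ> r) \<longlonglongrightarrow> l"
    by (rule seq_compactE)
  then have "(\<lambda>n. \<phi> (r n) (e k)) \<longlonglongrightarrow> l k" for k by (simp add: tendsto_fun_iff)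
  then have "convergent (\<lambda>n. \<phi> (r n) (e k))" for k by (rule convergentI)
  then obtain \<psi> :: "'x dual" where "norm \<psi> \<le> C" "\<And>x. (\<lambda>n. \<phi> (r n) x) \<longlonglongrightarrow> \<psi> x"
    using bounded_dual_limit[of e "\<lambda>n. \<phi> (r n)"] e C by blast
  with r show thesis by (rule that)
qed

lemma limitin_weak_star:
  fixes \<phi> :: "nat \<Rightarrow> 'x::real_normed_vector dual" and \<psi> :: "'x dual"
  assumes "\<And>x. (\<lambda>n. \<phi> n x) \<longlonglongrightarrow> \<psi> x"
  shows "limitin weak_star \<phi> \<psi> sequentially"
  unfolding limitin_def
proof (intro conjI allI impI)
  show "\<psi> \<in> topspace weak_star" by (simp add: strong_operator_topology_topspace)
  fix U :: "'x dual set" assume U: "openin weak_star U \<and> \<psi> \<in> U"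
  then obtain V where V: "open V" "U = blinfun_apply -` V"
    unfolding strong_operator_topology_def openin_pullback_topology by auto
  have "(\<lambda>n. blinfun_apply (\<phi> n)) \<longlonglongrightarrow> blinfun_apply \<psi>"
    using assms by (simp add: tendsto_fun_iff)
  from topological_tendstoD[OF this V(1)] U V(2) show "\<forall>\<^sub>F n in sequentially. \<phi> n \<in> U" by simp
qed

lemma closedin_weak_star_limit:
  fixes \<phi> :: "nat \<Rightarrow> 'x::real_normed_vector dual" and \<psi> :: "'x dual"
  assumes "closedin weak_star E" "\<And>n. \<phi> n \<in> E" "\<And>x. (\<lambda>n. \<phi> n x) \<longlonglongrightarrow> \<psi> x"
  shows "\<psi> \<in> E"
  using limitin_closedin[OF limitin_weak_star[OF assms(3)] assms(1)] assms(2) by simp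

text \<open>The sequential form of the Banach--Alaoglu theorem; separability makes bounded sets
  metrizable.\<close>

lemma compactin_weak_star:
  fixes S :: "'x::real_normed_vector dual set" and e :: "nat \<Rightarrow> 'x"
  assumes e: "dense_dirs e" and C: "\<And>\<phi>. \<phi> \<in> S \<Longrightarrow> norm \<phi> \<le> C"
    and closed: "\<And>(\<phi> :: nat \<Rightarrow> 'x dual) (\<psi>::'x dual). (\<And>n. \<phi> n \<in> S) \<Longrightarrow>
      (\<And>x. (\<lambda>n. blinfun_apply (\<phi> n) x) \<longlonglongrightarrow> blinfun_apply \<psi> x) \<Longrightarrow> \<psi> \<in> S"
  shows "compactin weak_star S"
proof -
  \<comment> \<open>\<open>J\<close> embeds the dual into real sequences, where sequential
    compactness is compactness. The plan is to prove \<open>J\<close> + "\<open>S\<close>" compact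
    there and to transport it back.\<close>
  define J where "J \<phi> k = blinfun_apply \<phi> (e k)" for \<phi> :: "'x dual" and k
  have inj: "inj J"
    by (rule injI, rule blinfun_eq_on_dense_dirs[OF e]) (metis J_def)
  have "seq_compact (J ` S)"
  proof (rule seq_compactI)
    fix y :: "nat \<Rightarrow> nat \<Rightarrow> real" assume "\<forall>n. y n \<in> J ` S"
    then have "\<forall>n. \<exists>\<phi>. \<phi> \<in> S \<and> y n = J \<phi>" by auto
    then obtain \<phi> :: "nat \<Rightarrow> 'x dual" where "\<forall>n. \<phi> n \<in> S \<and> y n = J (\<phi> n)"
      by (rule choice[THEN exE])
    then have \<phi>: "\<And>n. \<phi> n \<in> S" "\<And>n. y n = J (\<phi> n)" by auto
    have "norm (\<phi> n) \<le> C" for n by (rule C[OF \<phi>(1)])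
    then obtain r and \<psi> :: "'x dual" where r: "strict_mono r" and "norm \<psi> \<le> C"
      and lim: "\<And>x. (\<lambda>n. \<phi> (r n) x) \<longlonglongrightarrow> \<psi> x"
      using bounded_dual_subseq[OF e, of \<phi> C] by blast
    have "\<psi> \<in> S" using closed[of "\<lambda>n. \<phi> (r n)" \<psi>] \<phi>(1) lim by auto
    moreover have "(y \<circ> r) \<longlonglongrightarrow> J \<psi>" using lim by (simp add: tendsto_fun_iff \<phi>(2) J_def)
    ultimately show "\<exists>l\<in>J ` S. \<exists>r. strict_mono r \<and> (y \<circ> r) \<longlonglongrightarrow> l" using r by auto
  qed
  then have comp: "compactin (subtopology euclidean (J ` S)) (J ` S)"
    by (simp add: compactin_subtopology seq_compact_eq_compact)
  \<comment> \<open>The norm bound on \<open>S\<close> upgrades convergence along the directions to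
    convergence at every \<open>x\<close>, so the inverse of \<open>J\<close> is continuous into the
    weak-star topology.\<close>
  have "continuous_map (subtopology euclidean (J ` S)) weak_star (inv J)"
    unfolding continuous_on_strong_operator_topo_iff_coordinatewise
  proof
    fix x
    have "continuous_on (J ` S) (\<lambda>y. blinfun_apply (inv J y) x)"
      unfolding continuous_on_sequentially
    proof (intro allI ballI impI)
      fix y a assume a: "a \<in> J ` S" and y: "(\<forall>n. y n \<in> J ` S) \<and> y \<longlonglongrightarrow> a"
      have S: "inv J z \<in> S" "J (inv J z) = z" if "z \<in> J ` S" for z
        using that inj by (auto simp: inv_f_f)
      have "(\<lambda>n. J (inv J (y n)) k) \<longlonglongrightarrow> J (inv J a) k" for k
        using y a by (simp add: S(2) tendsto_fun_iff)
      then have lim: "(\<lambda>n. blinfun_apply (inv J (y n)) (e k)) \<longlonglongrightarrow> blinfun_apply (inv J a) (e k)" for k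
        by (simp only: J_def)
      have "norm (inv J (y n)) \<le> C" for n using y by (intro C S(1)) auto
      from bounded_dual_tendsto[of e "\<lambda>n. inv J (y n)", OF e this lim]
      have "(\<lambda>n. blinfun_apply (inv J (y n)) x) \<longlonglongrightarrow> blinfun_apply (inv J a) x" .
      then show "((\<lambda>y. blinfun_apply (inv J y) x) \<circ> y) \<longlonglongrightarrow> blinfun_apply (inv J a) x"
        by (simp add: o_def)
    qed
    then show "continuous_map (subtopology euclidean (J ` S)) euclidean (\<lambda>y. blinfun_apply (inv J y) x)"
      by simp
  qed
  from image_compactin[OF comp this] show ?thesis
    using inj by (simp add: image_comp inv_f_f o_def)
qed

text \<open>The whole dual need not be metrizable, but a weak-star closed set is a countable union
  of bounded, hence compact, pieces. Their images under the injective map \<open>J\<close> are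
  closed sets of real sequences, so membership of \<open>f t\<close> is decided by the countably
  many functions \<open>f t (e k)\<close>.\<close>

lemma weak_star_borel_measurableI:
  fixes f :: "'t \<Rightarrow> 'x::real_normed_vector dual" and e :: "nat \<Rightarrow> 'x"
  assumes e: "dense_dirs e" and meas: "\<And>k. (\<lambda>t. f t (e k)) \<in> borel_measurable M"
  shows "f \<in> measurable M weak_star_borel"
  unfolding weak_star_borel_def
proof (rule measurable_measure_of)
  show "f \<in> space M \<rightarrow> UNIV" by simp
  fix U :: "'x dual set" assume "U \<in> {U. openin weak_star U}"
  then have E: "closedin weak_star (- U)" by (simp add: closedin_def strong_operator_topology_topspace)
  define J where "J \<phi> k = blinfun_apply \<phi> (e k)" for \<phi> :: "'x dual" and k
  have J_eq: "J \<phi> = J \<psi> \<Longrightarrow> \<phi> = \<psi>" for \<phi> \<psi>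
    by (rule blinfun_eq_on_dense_dirs[OF e]) (metis J_def)
  have Jf[measurable]: "(\<lambda>t. J (f t)) \<in> borel_measurable M"
    unfolding J_def by (rule measurable_coordinatewise_then_product) (rule meas)
  have J_cont: "continuous_map weak_star euclidean J"
    unfolding J_def euclidean_product_topology[symmetric]
    by (rule continuous_map_coordinatewise_then_product)
      (auto intro: strong_operator_topology_continuous_evaluation)
  define C where "C n = {\<phi> \<in> - U. norm \<phi> \<le> real n}" for n
  have "compactin weak_star (C n)" for n
  proof (rule compactin_weak_star[OF e, of _ "real n"])
    fix \<phi> :: "nat \<Rightarrow> 'x dual" and \<psi> :: "'x dual" assume \<phi>: "\<And>i::nat. \<phi> i \<in> C n" and lim: "\<And>x. (\<lambda>i. \<phi> i x) \<longlonglongrightarrow> \<psi> x"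
    have "\<psi> \<in> - U" using closedin_weak_star_limit[OF E _ lim] \<phi> by (auto simp: C_def)
    moreover have "norm \<psi> \<le> real n"
    proof (rule norm_blinfun_bound)
      show "norm (\<psi> x) \<le> real n * norm x" for x
      proof (rule LIMSEQ_le_const2[OF tendsto_norm[OF lim]], intro exI allI impI)
        fix i
        have "norm (\<phi> i x) \<le> norm (\<phi> i) * norm x" by (rule norm_blinfun)
        also have "\<dots> \<le> real n * norm x" using \<phi>[of i] by (intro mult_right_mono) (auto simp: C_def)
        finally show "norm (\<phi> i x) \<le> real n * norm x" .
      qed
    qed simp
    ultimately show "\<psi> \<in> C n" by (simp add: C_def)
  qed (auto simp: C_def)
  from image_compactin[OF this J_cont] have [measurable]: "J ` C n \<in> sets borel" for n
    by (intro borel_closed compact_imp_closed) simp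
  have "f t \<in> U \<longleftrightarrow> (\<forall>n. J (f t) \<notin> J ` C n)" for t
  proof -
    obtain n where "norm (f t) \<le> real n" using real_arch_simple by blast
    then have "f t \<notin> U \<Longrightarrow> f t \<in> C n" by (simp add: C_def)
    then show ?thesis using J_eq by (auto simp: C_def)
  qed
  then have "f -` U \<inter> space M = {t \<in> space M. \<forall>n. J (f t) \<notin> J ` C n}" by auto
  also have "\<dots> \<in> sets M" by measurable
  finally show "f -` U \<inter> space M \<in> sets M" .
qed simp

lemma weak_star_borel_measurableD:
  fixes f :: "'t \<Rightarrow> 'x::real_normed_vector dual"
  assumes "f \<in> measurable M weak_star_borel"
  shows "(\<lambda>t. f t x) \<in> borel_measurable M"
proof -
  have "(\<lambda>\<phi>. blinfun_apply \<phi> x) \<in> borel_measurable (weak_star_borel :: 'x dual measure)"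
  proof (rule borel_measurableI)
    fix V :: "real set" assume "open V"
    then have "openin weak_star {\<phi> \<in> topspace weak_star. blinfun_apply \<phi> x \<in> V}"
      by (intro openin_continuous_map_preimage[OF strong_operator_topology_continuous_evaluation]) simp
    then show "(\<lambda>\<phi>. blinfun_apply \<phi> x) -` V \<inter> space weak_star_borel \<in> sets weak_star_borel"
      by (auto simp: weak_star_borel_def strong_operator_topology_topspace vimage_def)
  qed
  from measurable_compose[OF assms this] show ?thesis .
qed

text \<open>The uniform boundedness principle in seminorm form: the closed sets where
  \<open>q\<close> is at most \<open>n\<close> cover the space, so by Baire one contains a ball, and
  subadditivity and scaling move the ball to the origin. It serves both for weak-star compact sets
  and for the mean absolute values of Gelfand integrable maps.\<close>

lemma seminorm_bounded:
  fixes q :: "'x::banach \<Rightarrow> real"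
  assumes add: "\<And>x y. q (x + y) \<le> q x + q y" and scale: "\<And>r x. q (r *\<^sub>R x) = \<bar>r\<bar> * q x"
    and closed: "\<And>c. closed {x. q x \<le> c}"
  obtains C where "\<And>x. q x \<le> C * norm x"
proof -
  have "\<exists>n. interior {x. q x \<le> real n} \<noteq> {}"
  proof (rule ccontr)
    assume no: "\<nexists>n. interior {x. q x \<le> real n} \<noteq> {}"
    have "euclidean interior_of (\<Union>(range (\<lambda>n. {x. q x \<le> real n}))) = {}"
      by (rule Baire_category_alt)
         (use no closed in \<open>auto simp: completely_metrizable_space_euclidean\<close>)
    moreover have "\<Union>(range (\<lambda>n. {x. q x \<le> real n})) = UNIV"
      using real_arch_simple by auto
    ultimately show False by auto
  qed
  then obtain n a \<epsilon> where \<epsilon>: "\<epsilon> > 0" and ball: "ball a \<epsilon> \<subseteq> {x. q x \<le> real n}"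
    by (metis ex_in_conv mem_interior)
  have small: "q x \<le> 2 * real n" if "norm x < \<epsilon>" for x
  proof -
    have "q x = q ((a + x) + (-1) *\<^sub>R a)" by simp
    also have "\<dots> \<le> q (a + x) + q a" using add[of "a + x" "(-1) *\<^sub>R a"] scale[of "-1" a] by simp
    also have "\<dots> \<le> real n + real n"
      using ball \<epsilon> that by (intro add_mono) (auto simp: subset_iff dist_norm)
    finally show ?thesis by simp
  qed
  have "q x \<le> (4 * real n / \<epsilon>) * norm x" for x
  proof (cases "x = 0")
    case True
    then show ?thesis using scale[of 0 x] by simp
  next
    case False
    define c where "c = \<epsilon> / (2 * norm x)"
    have c: "c > 0" "norm (c *\<^sub>R x) < \<epsilon>" using \<epsilon> False by (auto simp: c_def)
    have "c * q x \<le> 2 * real n" using small[OF c(2)] c(1) by (simp add: scale)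
    then have "q x \<le> 2 * real n / c" using c(1) by (simp add: field_simps)
    then show ?thesis using False \<epsilon> by (simp add: c_def field_simps)
  qed
  then show thesis by (rule that)
qed

section \<open>Averages of words and realization of trees\<close>

text \<open>An arbitrary infinite branch through the word \<open>c\<close>, standing for its
  cell.\<close>

definition word_point :: "bool list \<Rightarrow> nat \<Rightarrow> bool" where
  "word_point c = (SOME b. bits_upto b (length c) = c)"

text \<open>The mass of the cylinder of \<open>c\<close> under the uniform distribution on the
  branches \<open>word_point w\<close>, where \<open>w\<close> runs through the list with
  multiplicities.\<close>

definition word_freq :: "bool list list \<Rightarrow> bool list \<Rightarrow> real" where
  "word_freq L c = (\<Sum>w\<leftarrow>L. of_bool (bits_upto (word_point w) (length c) = c)) / real (length L)"

text \<open>If \<open>p\<close> gives the cylinder masses of a probability measure on the Cantor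
  space, this is the expectation of the signed digit \<open>i\<close>; \<open>mean_coord p k\<close>
  below is then the expectation of coordinate \<open>k\<close> of \<open>cube_point\<close>. Stated
  through masses alone, both pass to limits of trees.\<close>

definition mean_bit :: "(bool list \<Rightarrow> real) \<Rightarrow> nat \<Rightarrow> real" where
  "mean_bit p i = (\<Sum>c | length c = i. p (True # c) - p (False # c))"

abbreviation mean_coord :: "(bool list \<Rightarrow> real) \<Rightarrow> nat \<Rightarrow> real" where
  "mean_coord p k \<equiv> \<Sum>j. mean_bit p (prod_encode (k, j)) * (1/2)^Suc j"

lemma finite_bool_lists[simp]: "finite {c :: bool list. length c = i}"
  using finite_lists_length_eq[of "UNIV :: bool set" i] by simp

lemma mean_bit_bits_upto:
  "mean_bit (\<lambda>c. of_bool (bits_upto b (length c) = c)) i = bit_sign (b i)"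
proof -
  have "mean_bit (\<lambda>c. of_bool (bits_upto b (length c) = c)) i =
      (\<Sum>c | length c = i. if c = bits_upto b i then bit_sign (b i) else 0)"
    unfolding mean_bit_def by (intro sum.cong) (auto simp: bit_sign_def)
  then show ?thesis by simp
qed

lemma mean_bit_sum: "mean_bit (\<lambda>c. \<Sum>j\<in>J. a j * p j c) i = (\<Sum>j\<in>J. a j * mean_bit (p j) i)"
  unfolding mean_bit_def
  by (simp add: sum_distrib_left sum_subtractf[symmetric] right_diff_distrib sum.swap[of _ J])

lemma mean_bit_word_freq:
  "mean_bit (word_freq L) i = (\<Sum>w\<leftarrow>L. bit_sign (word_point w i)) / real (length L)"
proof -
  have "mean_bit (\<lambda>c. \<Sum>w\<leftarrow>L. of_bool (bits_upto (word_point w) (length c) = c)) i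
      = (\<Sum>w\<leftarrow>L. bit_sign (word_point w i))"
  proof (induction L)
    case (Cons w L)
    then show ?case using mean_bit_bits_upto[of "word_point w" i]
      by (simp add: mean_bit_def sum.distrib sum_subtractf)
  qed (simp add: mean_bit_def)
  then show ?thesis
    by (simp add: word_freq_def mean_bit_def diff_divide_distrib[symmetric] sum_divide_distrib[symmetric])
qed

lemma word_freq_bounds: "0 \<le> word_freq L c" "word_freq L c \<le> 1"
proof -
  have "0 \<le> (\<Sum>w\<leftarrow>L. of_bool (bits_upto (word_point w) (length c) = c) :: real) \<and>
    (\<Sum>w\<leftarrow>L. of_bool (bits_upto (word_point w) (length c) = c) :: real) \<le> real (length L)"
    by (induction L) auto
  then show "0 \<le> word_freq L c" "word_freq L c \<le> 1"
    by (auto simp: word_freq_def divide_le_eq_1)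
qed

lemma word_freq_Nil: "L \<noteq> [] \<Longrightarrow> word_freq L [] = 1"
  by (simp add: word_freq_def sum_list_triv)

lemma word_freq_split: "word_freq L c = word_freq L (False # c) + word_freq L (True # c)"
proof -
  have "(\<Sum>w\<leftarrow>L. of_bool (bits_upto (word_point w) (length c) = c) :: real) =
    (\<Sum>w\<leftarrow>L. of_bool (bits_upto (word_point w) (length (False # c)) = False # c)) +
    (\<Sum>w\<leftarrow>L. of_bool (bits_upto (word_point w) (length (True # c)) = True # c))"
    by (induction L) auto
  then show ?thesis by (simp only: word_freq_def add_divide_distrib)
qed

lemma word_freq_pos:
  assumes "word_freq L c \<noteq> 0"
  shows "\<exists>w\<in>set L. bits_upto (word_point w) (length c) = c"
proof (rule ccontr)
  assume "\<not> ?thesis"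
  then have "map (\<lambda>w. of_bool (bits_upto (word_point w) (length c) = c) :: real) L = map (\<lambda>_. 0) L"
    by (intro map_cong) auto
  with assms show False by (simp add: word_freq_def sum_list_triv del: map_eq_conv)
qed

text \<open>At each level the masses add up to 1, and the difference of the masses of two children
  is at most the mass of the parent.\<close>

lemma mean_bit_abs_le:
  assumes "\<And>c. 0 \<le> p c" "p [] = 1" "\<And>c. p c = p (False # c) + p (True # c)"
  shows "\<bar>mean_bit p i\<bar> \<le> 1"
proof -
  have total: "(\<Sum>c | length c = i. p c) = 1" for i
  proof (induction i)
    case (Suc i)
    have "{c :: bool list. length c = Suc i} = Cons False ` {c. length c = i} \<union> Cons True ` {c. length c = i}"
      by (auto simp: length_Suc_conv image_iff)
    then have "(\<Sum>c | length c = Suc i. p c) = (\<Sum>c\<in>Cons False ` {c. length c = i}. p c) + (\<Sum>c\<in>Cons True ` {c. length c = i}. p c)"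
      by (simp only:) (rule sum.union_disjoint, auto)
    also have "\<dots> = (\<Sum>c | length c = i. p (False # c)) + (\<Sum>c | length c = i. p (True # c))"
      by (simp add: sum.reindex)
    also have "\<dots> = (\<Sum>c | length c = i. p c)"
      unfolding sum.distrib[symmetric] assms(3)[symmetric] ..
    finally show ?case using Suc by simp
  qed (simp add: assms(2))
  have "\<bar>mean_bit p i\<bar> \<le> (\<Sum>c | length c = i. p c)"
    unfolding mean_bit_def
  proof (rule order_trans[OF sum_abs], rule sum_mono)
    fix c show "\<bar>p (True # c) - p (False # c)\<bar> \<le> p c"
      using assms(1)[of "True # c"] assms(1)[of "False # c"] assms(3)[of c] by linarith
  qed
  with total show ?thesis by simp
qed

text \<open>Expectation under an empirical measure is the average over its atoms, and the series of
  digits is additive in them.\<close>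

lemma cube_point_mean_bit_word_freq:
  "mean_coord (word_freq L) k
     = (\<Sum>w\<leftarrow>L. cube_point (word_point w) k) / real (length L)"
proof -
  have "(\<lambda>j. (\<Sum>w\<leftarrow>L. bit_sign (word_point w (prod_encode (k, j)))) * (1/2)^Suc j) sums
      (\<Sum>w\<leftarrow>L. cube_point (word_point w) k)"
  proof (induction L)
    case (Cons w L)
    have "(\<lambda>j. bit_sign (word_point w (prod_encode (k, j))) * (1/2)^Suc j) sums cube_point (word_point w) k"
      unfolding cube_point_def using summable_cube_point[of "\<lambda>j. word_point w (prod_encode (k, j))"]
      by (rule summable_sums)
    from sums_add[OF this Cons] show ?case by (simp add: algebra_simps)
  qed simp
  from sums_unique[OF sums_divide[OF this, of "real (length L)"], symmetric] show ?thesis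
    by (simp only: mean_bit_word_freq times_divide_eq_left)
qed

text \<open>Rounding the weights of a convex combination to multiples of \<open>1/m\<close> turns it into the average
  over a finite list of words, and there are only countably many such lists.\<close>

lemma convex_combination_word_approx:
  fixes S :: "(nat \<Rightarrow> real) set" and u :: "(nat \<Rightarrow> real) \<Rightarrow> real"
  assumes S: "finite S" "\<And>y. y \<in> S \<Longrightarrow> \<forall>k. \<bar>y k\<bar> \<le> 1" and u: "\<And>y. y \<in> S \<Longrightarrow> 0 \<le> u y" "sum u S = 1"
    and \<epsilon>: "\<epsilon> > 0"
  obtains L :: "bool list list" where "L \<noteq> []"
    "\<And>c. c \<in> set L \<Longrightarrow> n \<le> length c \<and> bits_upto (word_point c) (length c) = c \<and>
       S \<inter> cell c \<noteq> {}"
    "\<And>k. k < n \<Longrightarrow> \<bar>(\<Sum>c\<leftarrow>L. cube_point (word_point c) k) / real (length L) - (\<Sum>y\<in>S. u y * y k)\<bar> < \<epsilon>"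
proof -
  obtain ys where ys: "set ys = S" "distinct ys" using finite_distinct_list[OF S(1)] by blast
  have "\<forall>y. \<exists>b. y \<in> S \<longrightarrow> cube_point b = y"
    using S(2) cube_point_surj by blast
  then obtain \<beta> where "\<forall>y. y \<in> S \<longrightarrow> cube_point (\<beta> y) = y" by (rule choice[THEN exE])
  then have \<beta>: "\<And>y. y \<in> S \<Longrightarrow> cube_point (\<beta> y) = y" by blast
  \<comment> \<open>The point \<open>y\<close> is represented by the length \<open>m\<close> prefix
    of one of its codes. The chosen branches through these prefixes converge to that code, so their
    cube points converge to \<open>y\<close>.\<close>
  define v where "v m y = bits_upto (\<beta> y) m" for m :: nat and y
  have len_v: "length (v m y) = m" for m y by (simp add: v_def)
  have v: "bits_upto (word_point (v m y)) m = v m y" for m y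
  proof -
    have "bits_upto (word_point (v m y)) (length (v m y)) = v m y"
      unfolding word_point_def by (rule someI[of _ "\<beta> y"]) (simp add: v_def)
    then show ?thesis by (simp add: len_v)
  qed
  \<comment> \<open>Multiplicity of \<open>y\<close> in the list: its weight rounded down to a
    multiple of \<open>1/m\<close>.\<close>
  define r where "r m y = nat \<lfloor>real m * u y\<rfloor>" for m :: nat and y
  define L where "L m = concat (map (\<lambda>y. replicate (r m y) (v m y)) ys)" for m :: nat
  have sum_L: "(\<Sum>c\<leftarrow>L m. g c) = (\<Sum>y\<in>S. real (r m y) * g (v m y))" for m and g :: "bool list \<Rightarrow> real"
  proof -
    have "(\<Sum>c\<leftarrow>concat (map (\<lambda>y. replicate (r m y) (v m y)) zs). g c) = (\<Sum>y\<leftarrow>zs. real (r m y) * g (v m y))" for zs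
      by (induction zs) (auto simp: sum_list_replicate)
    then show ?thesis using ys by (simp add: L_def sum_list_distinct_conv_sum_set)
  qed
  have len_L: "real (length (L m)) = (\<Sum>y\<in>S. real (r m y))" for m
    using sum_L[where g = "\<lambda>_. 1"] by (simp add: sum_list_triv)
  have r: "(\<lambda>m. real (r m y) / real m) \<longlonglongrightarrow> u y" if "y \<in> S" for y
  proof (rule tendsto_sandwich)
    show "\<forall>\<^sub>F m in sequentially. u y - 1 / real m \<le> real (r m y) / real m"
    proof (intro eventually_sequentiallyI[of 1])
      fix m :: nat assume "1 \<le> m"
      have "real m * u y - 1 \<le> real (r m y)" unfolding r_def by linarith
      then show "u y - 1 / real m \<le> real (r m y) / real m"
        using \<open>1 \<le> m\<close> by (simp add: pos_le_divide_eq left_diff_distrib mult.commute[of "real m"])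
    qed
    show "\<forall>\<^sub>F m in sequentially. real (r m y) / real m \<le> u y"
    proof (intro eventually_sequentiallyI[of 1])
      fix m :: nat assume "1 \<le> m"
      have "0 \<le> real m * u y" using u(1)[OF that] by simp
      then have "real (r m y) \<le> real m * u y" unfolding r_def by linarith
      then show "real (r m y) / real m \<le> u y"
        using \<open>1 \<le> m\<close> by (simp add: pos_divide_le_eq mult.commute)
    qed
    have "(\<lambda>m. u y - 1 / real m) \<longlonglongrightarrow> u y - 0"
      by (intro tendsto_diff tendsto_const lim_1_over_n)
    then show "(\<lambda>m. u y - 1 / real m) \<longlonglongrightarrow> u y" by simp
  qed simp
  have pt: "(\<lambda>m. cube_point (word_point (v m y)) k) \<longlonglongrightarrow> y k" if "y \<in> S" for y k
  proof -
    have "(\<lambda>m. word_point (v m y)) \<longlonglongrightarrow> \<beta> y"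
      by (rule bits_upto_limit) (simp add: v, simp add: v_def)
    then have "(\<lambda>m. cube_point (word_point (v m y))) \<longlonglongrightarrow> cube_point (\<beta> y)"
      using continuous_cube_point by (intro continuous_on_tendsto_compose[of UNIV cube_point]) auto
    then show ?thesis using \<beta>[OF that] by (simp add: tendsto_fun_iff)
  qed
  \<comment> \<open>Rounding loses some copies, so the list length is not \<open>m\<close>. That its
    ratio to \<open>m\<close> tends to 1 justifies averaging over the actual length, and shows that
    the list is eventually nonempty.\<close>
  have len_lim: "(\<lambda>m. real (length (L m)) / real m) \<longlonglongrightarrow> 1"
  proof -
    have "(\<lambda>m. \<Sum>y\<in>S. real (r m y) / real m) \<longlonglongrightarrow> (\<Sum>y\<in>S. u y)" by (intro tendsto_sum r)
    then show ?thesis by (simp add: len_L u(2) sum_divide_distrib)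
  qed
  have avg: "(\<lambda>m. (\<Sum>c\<leftarrow>L m. cube_point (word_point c) k) / real (length (L m))) \<longlonglongrightarrow> (\<Sum>y\<in>S. u y * y k)" for k
  proof -
    have "(\<lambda>m. (\<Sum>y\<in>S. (real (r m y) / real m) * cube_point (word_point (v m y)) k) / (real (length (L m)) / real m))
        \<longlonglongrightarrow> (\<Sum>y\<in>S. u y * y k) / 1"
      by (intro tendsto_divide tendsto_sum tendsto_mult r pt len_lim) auto
    moreover have "\<forall>\<^sub>F m in sequentially.
        (\<Sum>y\<in>S. (real (r m y) / real m) * cube_point (word_point (v m y)) k) / (real (length (L m)) / real m)
        = (\<Sum>c\<leftarrow>L m. cube_point (word_point c) k) / real (length (L m))"
      by (intro eventually_sequentiallyI[of 1])
        (simp add: sum_L[of "\<lambda>c. cube_point (word_point c) k"] flip: sum_divide_distrib)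
    ultimately have "(\<lambda>m. (\<Sum>c\<leftarrow>L m. cube_point (word_point c) k) / real (length (L m))) \<longlonglongrightarrow> (\<Sum>y\<in>S. u y * y k) / 1"
      by (rule Lim_transform_eventually)
    then show ?thesis by simp
  qed
  have "\<forall>\<^sub>F m in sequentially. 0 < real (length (L m)) / real m"
    using len_lim by (rule order_tendstoD) simp
  moreover have "\<forall>\<^sub>F m in sequentially. \<forall>k\<in>{..<n}.
      \<bar>(\<Sum>c\<leftarrow>L m. cube_point (word_point c) k) / real (length (L m)) - (\<Sum>y\<in>S. u y * y k)\<bar> < \<epsilon>"
    using avg tendstoD[OF avg \<epsilon>] by (intro eventually_ball_finite) (auto simp: dist_real_def)
  ultimately have "\<forall>\<^sub>F m in sequentially. n \<le> m \<and> L m \<noteq> [] \<and> (\<forall>k\<in>{..<n}.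
      \<bar>(\<Sum>c\<leftarrow>L m. cube_point (word_point c) k) / real (length (L m)) - (\<Sum>y\<in>S. u y * y k)\<bar> < \<epsilon>)"
    using eventually_ge_at_top[of n] by eventually_elim auto
  then obtain m where m: "n \<le> m" "L m \<noteq> []" "\<forall>k\<in>{..<n}.
      \<bar>(\<Sum>c\<leftarrow>L m. cube_point (word_point c) k) / real (length (L m)) - (\<Sum>y\<in>S. u y * y k)\<bar> < \<epsilon>"
    by (auto dest: eventually_happens)
  show thesis
  proof (rule that[of "L m"])
    fix c assume "c \<in> set (L m)"
    then obtain y where y: "y \<in> S" "c = v m y" using ys by (auto simp: L_def)
    then have "y \<in> cell c"
      using \<beta>[OF y(1)] by (auto simp: len_v v_def intro!: image_eqI[of y cube_point "\<beta> y"])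
    then show "n \<le> length c \<and> bits_upto (word_point c) (length c) = c \<and>
       S \<inter> cell c \<noteq> {}"
      using y m(1) v by (auto simp: len_v)
  qed (use m in auto)
qed

lemma set_integral_sum:
  fixes f :: "'i \<Rightarrow> 't \<Rightarrow> real"
  assumes "\<And>i. i \<in> S \<Longrightarrow> set_integrable M A (f i)"
  shows "(LINT t:A|M. (\<Sum>i\<in>S. f i t)) = (\<Sum>i\<in>S. LINT t:A|M. f i t)"
  using assms unfolding set_lebesgue_integral_def set_integrable_def scaleR_sum_right
  by (rule Bochner_Integration.integral_sum)

section \<open>Random points of the cube with prescribed conditional means\<close>

context sub_prob_space
begin

lemma set_integral_half_series:
  fixes X :: "nat \<Rightarrow> 't \<Rightarrow> real"
  assumes X[measurable]: "\<And>j. X j \<in> borel_measurable M" and bound: "AE t in M. \<forall>j. \<bar>X j t\<bar> \<le> 1"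
    and A[measurable]: "A \<in> sets M"
  shows "(LINT t:A|M. (\<Sum>j. X j t * (1/2)^Suc j)) = (\<Sum>j. (LINT t:A|M. X j t) * (1/2)^Suc j)"
proof -
  define Z where "Z j t = indicator A t * (X j t * (1/2)^Suc j)" for j t
  have Z_le: "AE t in M. \<forall>j. \<bar>Z j t\<bar> \<le> (1/2)^Suc j"
    using bound by eventually_elim (auto simp: Z_def abs_mult indicator_def)
  have Zm[measurable]: "Z j \<in> borel_measurable M" for j unfolding Z_def by measurable
  have Zint: "integrable M (Z j)" for j
    using Z_le by (intro integrable_const_bound[where B = "(1/2)^Suc j"]) (auto elim: eventually_mono)
  have "(\<integral>t. (\<Sum>j. Z j t) \<partial>M) = (\<Sum>j. \<integral>t. Z j t \<partial>M)"
  proof (rule integral_suminf[OF Zint])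
    show "AE t in M. summable (\<lambda>j. norm (Z j t))"
      using Z_le
    proof eventually_elim
      fix t assume "\<forall>j. \<bar>Z j t\<bar> \<le> (1/2)^Suc j"
      then show "summable (\<lambda>j. norm (Z j t))"
        by (intro summable_comparison_test'[OF summable_half_powers, of 0]) auto
    qed
    have "(\<integral>t. norm (Z j t) \<partial>M) \<le> (1/2)^Suc j" for j
      using Z_le by (intro integral_le_const integrable_norm Zint) (auto elim: eventually_mono)
    then show "summable (\<lambda>j. \<integral>t. norm (Z j t) \<partial>M)"
      by (intro summable_comparison_test'[OF summable_half_powers, of 0]) auto
  qed
  moreover have "(\<integral>t. Z j t \<partial>M) = (LINT t:A|M. X j t) * (1/2)^Suc j" for j
    unfolding set_lebesgue_integral_def Z_def real_scaleR_def mult.assoc[symmetric]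
    by (rule integral_mult_left_zero)
  moreover have "(\<integral>t. (\<Sum>j. Z j t) \<partial>M) = (LINT t:A|M. (\<Sum>j. X j t * (1/2)^Suc j))"
    unfolding set_lebesgue_integral_def
    by (rule Bochner_Integration.integral_cong) (auto simp: Z_def indicator_def)
  ultimately show ?thesis by simp
qed

end

context nowhere_equivalent_subalgebra
begin

text \<open>The branch \<open>b t\<close> realised by the tree follows almost surely only words
  whose cell meets \<open>K t\<close>; as \<open>K t\<close> is closed and the cells along a branch
  shrink to a point, that point lies in \<open>K t\<close>. Its coordinates are series of digits,
  and the conditional means of the digits are fixed by the masses.\<close>

lemma tree_realization_cube:
  fixes p :: "bool list \<Rightarrow> 't \<Rightarrow> real" and K :: "'t \<Rightarrow> (nat \<Rightarrow> real) set"
  assumes meas[measurable]: "\<And>c. p c \<in> borel_measurable M"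
    and tree: "AE t in M. (\<forall>c. 0 \<le> p c t \<and> p c t \<le> 1 \<and> p c t = p (False # c) t + p (True # c) t) \<and> p [] t = 1"
    and closed: "AE t in M. closed (K t)"
    and B: "\<And>c. {t \<in> space M. K t \<inter> cell c \<noteq> {}} \<in> sets N"
    and supp: "AE t in M. \<forall>c. p c t \<noteq> 0 \<longrightarrow> K t \<inter> cell c \<noteq> {}"
  obtains h :: "'t \<Rightarrow> nat \<Rightarrow> real" where
    "\<And>k. (\<lambda>t. h t k) \<in> borel_measurable M" "\<And>t k. \<bar>h t k\<bar> \<le> 1" "AE t in M. h t \<in> K t"
    "\<And>k A. A \<in> sets N \<Longrightarrow>
       (LINT t:A|M. h t k) = (LINT t:A|M. mean_coord (\<lambda>c. p c t) k)"
proof -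
  have root: "AE t in M. p [] t = 1" and split: "AE t in M. p c t = p (False # c) t + p (True # c) t"
    and nonneg: "AE t in M. 0 \<le> p c t" and le1: "AE t in M. p c t \<le> 1" for c
    by (rule eventually_mono[OF tree], blast)+
  have int: "integrable M (p c)" for c
  proof (rule integrable_const_bound[where B = 1])
    show "AE t in M. norm (p c t) \<le> 1" using nonneg[of c] le1[of c] by eventually_elim simp
  qed simp
  obtain b where bm: "\<And>i. {t \<in> space M. b t i} \<in> sets M"
    and b: "\<And>c A. A \<in> sets N \<Longrightarrow> prob {t \<in> A. bits_upto (b t) (length c) = c} = (LINT t:A|M. p c t)"
    using tree_realization[of p, OF int root split nonneg] by blast
  have bm'[measurable]: "Measurable.pred M (\<lambda>t. b t i)" for i
    using bm[of i] by (simp add: pred_def)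
  have init_m[measurable]: "Measurable.pred M (\<lambda>t. bits_upto (b t) n = c)" for n c
  proof (induction n arbitrary: c)
    case (Suc n)
    note Suc[measurable]
    show ?case
    proof (cases c)
      case (Cons x c')
      have "Measurable.pred M (\<lambda>t. (b t n \<longleftrightarrow> x) \<and> bits_upto (b t) n = c')" by measurable
      then show ?thesis by (simp add: Cons)
    qed simp
  qed simp
  have sign_m[measurable]: "(\<lambda>t. bit_sign (b t i)) \<in> borel_measurable M" for i
    unfolding bit_sign_def by measurable
  define h where "h t = cube_point (b t)" for t
  show thesis
  proof (rule that[of h])
    show "(\<lambda>t. h t k) \<in> borel_measurable M" for k
      unfolding h_def cube_point_def by measurable
    show "\<bar>h t k\<bar> \<le> 1" for t k
    proof -
      have "\<bar>h t k\<bar> \<le> (\<Sum>j. \<bar>bit_sign (b t (prod_encode (k, j))) * (1/2)^Suc j\<bar>)"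
        unfolding h_def cube_point_def
        by (rule summable_rabs) (use summable_half_powers in \<open>simp add: abs_mult\<close>)
      also have "\<dots> = (\<Sum>j. (1/2)^Suc j)" by (simp add: abs_mult)
      also have "\<dots> = 1" using power_half_series by (simp add: sums_iff)
      finally show ?thesis .
    qed
    have "AE t in M. bits_upto (b t) (length c) = c \<longrightarrow> K t \<inter> cell c \<noteq> {}" for c
    proof -
      \<comment> \<open>Here measurability over \<open>N\<close> is decisive: the masses of words
        are prescribed only over sets of \<open>sets N\<close>, and \<open>A\<close>, where the cell
        is missed, is one of them. Since \<open>p c\<close> vanishes almost everywhere on
        \<open>A\<close>, so does the probability of the word there.\<close>
      define A where "A = space N - {t \<in> space M. K t \<inter> cell c \<noteq> {}}"
      have A: "A \<in> sets N" unfolding A_def using B[of c] by auto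
      have "(LINT t:A|M. p c t) = (LINT t:A|M. 0)"
      proof (rule set_lebesgue_integral_cong_AE[OF sub_sets[OF A]])
        show "AE t\<in>A in M. p c t = 0"
          using supp by eventually_elim (auto simp: A_def sub_space)
      qed auto
      then have "prob {t \<in> A. bits_upto (b t) (length c) = c} = 0" by (simp add: b[OF A] set_lebesgue_integral_def)
      moreover have "{t \<in> A. bits_upto (b t) (length c) = c} \<in> sets M"
      proof -
        have "{t \<in> A. bits_upto (b t) (length c) = c} = A \<inter> {t \<in> space M. bits_upto (b t) (length c) = c}"
          using sets.sets_into_space[OF sub_sets[OF A]] by auto
        also have "\<dots> \<in> sets M" using sub_sets[OF A] init_m[of "length c" c] by (auto simp: pred_def)
        finally show ?thesis .
      qed
      ultimately have "AE t in M. t \<notin> {t \<in> A. bits_upto (b t) (length c) = c}"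
        by (intro AE_not_in) (auto simp: null_sets_def emeasure_eq_measure)
      with AE_space show ?thesis by eventually_elim (auto simp: A_def sub_space)
    qed
    then have "AE t in M. \<forall>c. bits_upto (b t) (length c) = c \<longrightarrow> K t \<inter> cell c \<noteq> {}"
      by (simp add: AE_all_countable)
    with closed show "AE t in M. h t \<in> K t"
    proof eventually_elim
      fix t assume cl: "closed (K t)"
        and c: "\<forall>c. bits_upto (b t) (length c) = c \<longrightarrow> K t \<inter> cell c \<noteq> {}"
      \<comment> \<open>Points of \<open>K t\<close> in the cells of the prefixes of
        \<open>b t\<close> have codes that agree with \<open>b t\<close> on ever longer prefixes, so
        they converge to \<open>h t\<close> by continuity of \<open>cube_point\<close>.\<close>
      have "\<forall>n. \<exists>\<beta>. bits_upto \<beta> n = bits_upto (b t) n \<and> cube_point \<beta> \<in> K t"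
      proof
        fix n show "\<exists>\<beta>. bits_upto \<beta> n = bits_upto (b t) n \<and> cube_point \<beta> \<in> K t"
          using c[rule_format, of "bits_upto (b t) n"] by auto
      qed
      then obtain \<beta> where "\<forall>n. bits_upto (\<beta> n) n = bits_upto (b t) n \<and> cube_point (\<beta> n) \<in> K t"
        by (rule choice[THEN exE])
      then have \<beta>: "\<And>n. bits_upto (\<beta> n) n = bits_upto (b t) n" "\<And>n. cube_point (\<beta> n) \<in> K t" by auto
      have lim: "(\<lambda>n. cube_point (\<beta> n)) \<longlonglongrightarrow> cube_point (b t)"
        using bits_upto_limit[OF \<beta>(1)] continuous_cube_point
        by (intro continuous_on_tendsto_compose[of UNIV cube_point]) auto
      show "h t \<in> K t" unfolding h_def by (rule closed_sequentially[OF cl \<beta>(2) lim])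
    qed
    fix k A assume A: "A \<in> sets N"
    note AM[measurable] = sub_sets[OF A]
    \<comment> \<open>Digit \<open>i\<close> is the \<open>mean_bit\<close> of the point mass at
      \<open>b t\<close>, a finite combination of indicators of words, whose integrals over
      \<open>A\<close> are known.\<close>
    have mean: "(LINT t:A|M. bit_sign (b t i)) = (LINT t:A|M. mean_bit (\<lambda>c. p c t) i)" for i
    proof -
      have *: "(LINT t:A|M. of_bool (bits_upto (b t) (length c) = c)) = (LINT t:A|M. p c t)" for c
      proof -
        have "{t \<in> A. bits_upto (b t) (length c) = c} = A \<inter> {t \<in> space M. bits_upto (b t) (length c) = c}"
          using sets.sets_into_space[OF AM] by auto
        moreover have "{t \<in> space M. bits_upto (b t) (length c) = c} \<in> sets M"
          using init_m[of "length c" c] by (auto simp: pred_def)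
        ultimately have "(LINT t:A|M. p c t) = (LINT t:A|M. indicator {t \<in> space M. bits_upto (b t) (length c) = c} t)"
          by (simp add: set_integral_indicator_prob flip: b[OF A])
        then show ?thesis unfolding set_lebesgue_integral_def
          by (simp add: indicator_def cong: Bochner_Integration.integral_cong)
      qed
      have si: "set_integrable M A (\<lambda>t. of_bool (bits_upto (b t) (length c) = c) :: real)" for c
        by (intro set_integrable_sub A integrable_const_bound[where B = 1]) auto
      have sp: "set_integrable M A (p c)" for c by (intro set_integrable_sub A int)
      have "(LINT t:A|M. bit_sign (b t i)) = (LINT t:A|M. mean_bit (\<lambda>c. of_bool (bits_upto (b t) (length c) = c)) i)"
        by (simp add: mean_bit_bits_upto)
      also have "\<dots> = (\<Sum>c | length c = i. LINT t:A|M. of_bool (bits_upto (b t) (length (True # c)) = True # c)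
          - of_bool (bits_upto (b t) (length (False # c)) = False # c))"
        unfolding mean_bit_def by (rule set_integral_sum) (intro set_integral_diff(1) si)
      also have "\<dots> = (\<Sum>c | length c = i. LINT t:A|M. p (True # c) t - p (False # c) t)"
        using *[of "_ # _"] by (simp only: set_integral_diff[OF si si] set_integral_diff[OF sp sp] *)
      also have "\<dots> = (LINT t:A|M. mean_bit (\<lambda>c. p c t) i)"
        unfolding mean_bit_def by (rule set_integral_sum[symmetric]) (intro set_integral_diff(1) sp)
      finally show ?thesis .
    qed
    have "(LINT t:A|M. h t k) = (\<Sum>j. (LINT t:A|M. bit_sign (b t (prod_encode (k, j)))) * (1/2)^Suc j)"
      unfolding h_def cube_point_def by (rule set_integral_half_series) auto
    also have "\<dots> = (\<Sum>j. (LINT t:A|M. mean_bit (\<lambda>c. p c t) (prod_encode (k, j))) * (1/2)^Suc j)"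
      by (simp only: mean)
    also have "\<dots> = (LINT t:A|M. mean_coord (\<lambda>c. p c t) k)"
    proof (rule set_integral_half_series[symmetric])
      show "(\<lambda>t. mean_bit (\<lambda>c. p c t) (prod_encode (k, j))) \<in> borel_measurable M" for j
        unfolding mean_bit_def by measurable
      show "AE t in M. \<forall>j. \<bar>mean_bit (\<lambda>c. p c t) (prod_encode (k, j))\<bar> \<le> 1"
      proof (rule eventually_mono[OF tree], rule allI)
        fix t j
        assume "(\<forall>c. 0 \<le> p c t \<and> p c t \<le> 1 \<and> p c t = p (False # c) t + p (True # c) t) \<and> p [] t = 1"
        then show "\<bar>mean_bit (\<lambda>c. p c t) (prod_encode (k, j))\<bar> \<le> 1"
          by (intro mean_bit_abs_le) blast+
      qed
    qed simp
    finally show "(LINT t:A|M. h t k) = (LINT t:A|M. mean_coord (\<lambda>c. p c t) k)" .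
  qed
qed

text \<open>Over all \<open>n\<close> this says that the coordinates of \<open>z\<close> in
  \<open>I\<close> are limits of finite convex combinations of points of \<open>K\<close> in the
  cube. Even for empty \<open>I\<close> it has content: \<open>sum u S = 1\<close> forces
  \<open>S\<close>, and hence \<open>K\<close>, to be nonempty.\<close>

abbreviation cube_approx :: "(nat \<Rightarrow> real) set \<Rightarrow> nat set \<Rightarrow> (nat \<Rightarrow> real) \<Rightarrow> nat \<Rightarrow> bool" where
  "cube_approx K I z n \<equiv> \<exists>S u. finite S \<and> S \<subseteq> K \<and> (\<forall>y\<in>S. \<forall>k. \<bar>y k\<bar> \<le> 1) \<and>
     (\<forall>y\<in>S. 0 \<le> u y) \<and> sum u S = 1 \<and>
     (\<forall>k\<in>I. k < n \<longrightarrow> \<bar>z k - (\<Sum>y\<in>S. u y * y k)\<bar> < 1 / real (Suc n))"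

text \<open>The index set \<open>I\<close> lists the coordinates whose conditional expectations are prescribed; with
  \<open>I = {}\<close> this is a measurable selection theorem.\<close>

lemma cube_selection:
  fixes K :: "'t \<Rightarrow> (nat \<Rightarrow> real) set" and I :: "nat set" and f :: "nat \<Rightarrow> 't \<Rightarrow> real"
  assumes closed: "AE t in M. closed (K t)"
    and B: "\<And>c. {t \<in> space M. K t \<inter> cell c \<noteq> {}} \<in> sets N"
    and f[measurable]: "\<And>k. k \<in> I \<Longrightarrow> f k \<in> borel_measurable M"
    and approx: "AE t in M. \<forall>n. cube_approx (K t) I (\<lambda>k. f k t) n"
  obtains h :: "'t \<Rightarrow> nat \<Rightarrow> real" where
    "\<And>k. (\<lambda>t. h t k) \<in> borel_measurable M" "\<And>t k. \<bar>h t k\<bar> \<le> 1" "AE t in M. h t \<in> K t"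
    "\<And>k A. k \<in> I \<Longrightarrow> A \<in> sets N \<Longrightarrow> (LINT t:A|M. h t k) = (LINT t:A|M. f k t)"
proof -
  define B where "B c t \<longleftrightarrow> K t \<inter> cell c \<noteq> {}" for c t
  have B_m[measurable]: "Measurable.pred M (B c)" for c
    using sub_sets[OF B[of c]] by (simp add: B_def pred_def)
  define avg where "avg L k = (\<Sum>w\<leftarrow>L. cube_point (word_point w) k) / real (length L)" for L k
  \<comment> \<open>One \<open>1 / real (Suc n)\<close> of the tolerance comes from the given convex
    combination, the other from its replacement by a list of words. The condition involves
    \<open>t\<close> only through the events \<open>B w\<close> and the functions
    \<open>f k\<close>, so it is measurable.\<close>
  define ok where "ok n L t \<longleftrightarrow> L \<noteq> [] \<and>
      (\<forall>w\<in>set L. n \<le> length w \<and> bits_upto (word_point w) (length w) = w \<and> B w t) \<and>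
      (\<forall>k\<in>I \<inter> {..<n}. \<bar>f k t - avg L k\<bar> \<le> 2 / real (Suc n))" for n L t
  have ok_m[measurable]: "Measurable.pred M (ok n L)" for n L
    unfolding ok_def by measurable
  have ex_ok: "AE t in M. \<forall>n. \<exists>L. ok n L t"
    using approx
  proof (eventually_elim, intro allI)
    fix t n
    assume "\<forall>n. cube_approx (K t) I (\<lambda>k. f k t) n"
    then obtain S u where S: "finite S" "S \<subseteq> K t" "\<forall>y\<in>S. \<forall>k. \<bar>y k\<bar> \<le> 1"
      "\<forall>y\<in>S. 0 \<le> u y" "sum u S = 1"
      and fS: "\<forall>k\<in>I. k < n \<longrightarrow> \<bar>f k t - (\<Sum>y\<in>S. u y * y k)\<bar> < 1 / real (Suc n)"
      by (elim allE[of _ n] exE conjE)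
    have pos: "0 < 1 / real (Suc n)" by simp
    have bnd: "\<forall>k. \<bar>y k\<bar> \<le> 1" and u0: "0 \<le> u y" if "y \<in> S" for y using S that by auto
    obtain L where L: "L \<noteq> []"
      "\<And>c. c \<in> set L \<Longrightarrow> n \<le> length c \<and> bits_upto (word_point c) (length c) = c \<and>
         S \<inter> cell c \<noteq> {}"
      "\<And>k. k < n \<Longrightarrow> \<bar>avg L k - (\<Sum>y\<in>S. u y * y k)\<bar> < 1 / real (Suc n)"
      using convex_combination_word_approx[OF S(1) bnd u0 S(5) pos, of n, folded avg_def] by blast
    have "\<bar>f k t - avg L k\<bar> \<le> 2 / real (Suc n)" if "k \<in> I" "k < n" for k
    proof -
      have "\<bar>f k t - avg L k\<bar> \<le> 1 / real (Suc n) + 1 / real (Suc n)"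
        using fS[rule_format, OF that] L(3)[OF that(2)] by linarith
      then show ?thesis by simp
    qed
    moreover have "B c t" if "c \<in> set L" for c
      using L(2)[OF that] S(2) unfolding B_def by blast
    ultimately have "ok n L t" using L(1,2) unfolding ok_def by blast
    then show "\<exists>L. ok n L t" by blast
  qed
  \<comment> \<open>The first admissible list in an enumeration of all lists: with countably many
    candidates the choice is measurable.\<close>
  define L where "L n t = (from_nat (LEAST i. ok n (from_nat i) t) :: bool list list)" for n t
  have ok_L: "AE t in M. \<forall>n. ok n (L n t) t"
    using ex_ok
  proof (eventually_elim, intro allI)
    fix t n assume "\<forall>n. \<exists>L. ok n L t"
    then obtain L0 where "ok n L0 t" by blast
    then have "ok n (from_nat (to_nat L0)) t" by simp
    then show "ok n (L n t) t" unfolding L_def by (rule LeastI)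
  qed
  have L_m[measurable]: "L n \<in> measurable M (count_space UNIV)" for n
    unfolding L_def by measurable
  define p where "p n c t = word_freq (L n t) c" for n c t
  have p_m[measurable]: "p n c \<in> borel_measurable M" for n c
    unfolding p_def by (rule measurable_compose[OF L_m]) simp
  obtain J w where J: "\<And>n. finite (J n)" "\<And>n. J n \<subseteq> {n..}" "\<And>n j. 0 \<le> w n j" "\<And>n. sum (w n) (J n) = 1"
    and conv: "AE t in M. \<forall>c. convergent (\<lambda>n. \<Sum>j\<in>J n. w n j * p j c t)"
  proof (rule convex_combinations_converge_AE_family[of M p])
    show "prob_space M" by (rule prob_space_axioms)
    show "\<bar>p n c t\<bar> \<le> 1" for n c t using word_freq_bounds[of "L n t" c] by (simp add: p_def)
  qed (auto intro: p_m)
  let ?C = "\<lambda>n c t. \<Sum>j\<in>J n. w n j * p j c t"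
  define P where "P c t = lim (\<lambda>n. ?C n c t)" for c t
  have P_m[measurable]: "P c \<in> borel_measurable M" for c unfolding P_def by measurable
  let ?lim = "\<lambda>t. \<forall>c. (\<lambda>n. ?C n c t) \<longlonglongrightarrow> P c t"
  have lim: "AE t in M. ?lim t"
    using conv by eventually_elim (simp add: P_def convergent_LIMSEQ_iff)
  have comb_split: "?C n c t =
      ?C n (False # c) t + ?C n (True # c) t" for n c t
    unfolding sum.distrib[symmetric] distrib_left[symmetric] p_def word_freq_split[symmetric] ..
  have comb_nonneg: "0 \<le> ?C n c t" for n c t
    using J(3) by (intro sum_nonneg mult_nonneg_nonneg) (auto simp: p_def word_freq_bounds)
  have comb_le: "?C n c t \<le> 1" for n c t
  proof -
    have "?C n c t \<le> (\<Sum>j\<in>J n. w n j * 1)"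
      using J(3) by (intro sum_mono mult_left_mono) (auto simp: p_def word_freq_bounds)
    then show ?thesis by (simp add: J(4))
  qed
  have comb_root: "?C n [] t = 1" if "\<forall>n. ok n (L n t) t" for n t
  proof -
    have "p j [] t = 1" for j using that by (simp add: p_def ok_def word_freq_Nil)
    then show ?thesis by (simp add: J(4))
  qed
  have tree: "AE t in M. (\<forall>c. 0 \<le> P c t \<and> P c t \<le> 1 \<and> P c t = P (False # c) t + P (True # c) t) \<and> P [] t = 1"
    using lim ok_L
  proof (eventually_elim, intro conjI allI)
    fix t c assume lim: "?lim t" and ok: "\<forall>n. ok n (L n t) t"
    show "0 \<le> P c t" using lim comb_nonneg by (intro LIMSEQ_le_const[OF lim[rule_format]]) auto
    show "P c t \<le> 1" using lim comb_le by (intro LIMSEQ_le_const2[OF lim[rule_format]]) auto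
    have "(\<lambda>n. ?C n c t) \<longlonglongrightarrow> P (False # c) t + P (True # c) t"
      unfolding comb_split[of _ c] by (intro tendsto_add lim[rule_format])
    then show "P c t = P (False # c) t + P (True # c) t"
      by (rule LIMSEQ_unique[OF lim[rule_format]])
    have "(\<lambda>n. 1) \<longlonglongrightarrow> P [] t"
      using lim[rule_format, of "[]"] by (simp only: comb_root[OF ok])
    then show "P [] t = 1" by (simp add: LIMSEQ_const_iff)
  qed
  have supp: "AE t in M. \<forall>c. P c t \<noteq> 0 \<longrightarrow> B c t"
    using lim ok_L
  proof (eventually_elim, intro allI impI)
    fix t c assume lim: "?lim t" and ok: "\<forall>n. ok n (L n t) t"
      and P: "P c t \<noteq> 0"
    show "B c t"
    proof (rule ccontr)
      assume nB: "\<not> B c t"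
      \<comment> \<open>Words in the list \<open>L j t\<close> have length at least
        \<open>j\<close>. One whose branch passes through \<open>c\<close> therefore extends
        \<open>c\<close>, and a point of \<open>K t\<close> in its cell also lies in the cell of
        \<open>c\<close>.\<close>
      have "p j c t = 0" if "length c \<le> j" for j
      proof (rule ccontr)
        assume "p j c t \<noteq> 0"
        then obtain v where v: "v \<in> set (L j t)" "bits_upto (word_point v) (length c) = c"
          using word_freq_pos unfolding p_def by blast
        then have "length c \<le> length v" "bits_upto (word_point v) (length v) = v" "B v t"
          using ok that unfolding ok_def by (meson order_trans)+
        then obtain b where b: "cube_point b \<in> K t" "bits_upto b (length v) = bits_upto (word_point v) (length v)"
          by (auto simp: B_def)
        then have "bits_upto b (length c) = bits_upto (word_point v) (length c)"
          using \<open>length c \<le> length v\<close> unfolding bits_upto_eq_iff by auto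
        then have "B c t" using b(1) v(2) by (auto simp: B_def)
        with nB show False ..
      qed
      then have "?C n c t = 0" if "length c \<le> n" for n
        using J(2)[of n] that by (intro sum.neutral) force
      then have "(\<lambda>n. ?C n c t) \<longlonglongrightarrow> 0"
        by (intro tendsto_eventually eventually_sequentiallyI[of "length c"]) auto
      with lim P show False using LIMSEQ_unique by blast
    qed
  qed
  have mean: "AE t in M. \<forall>k\<in>I. mean_coord (\<lambda>c. P c t) k = f k t"
    using lim ok_L
  proof (eventually_elim, intro ballI)
    fix t k assume lim: "?lim t" and ok: "\<forall>n. ok n (L n t) t"
      and k: "k \<in> I"
    \<comment> \<open>The terms of the expected coordinate \<open>k\<close> of the
      \<open>n\<close>-th combination, read in two ways: a limit in \<open>n\<close> under the sum,
      by Tannery's theorem, gives the coordinate of \<open>P\<close>, while summation over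
      \<open>j\<close> for fixed \<open>n\<close> gives averages of lists, which are close to
      \<open>f k t\<close>.\<close>
    define a where "a j n = mean_bit (\<lambda>c. ?C n c t) (prod_encode (k, j)) * (1/2)^Suc j" for j n
    have a_le: "norm (a j n) \<le> (1/2)^Suc j" for j n
    proof -
      have "\<bar>mean_bit (\<lambda>c. ?C n c t) (prod_encode (k, j))\<bar> \<le> 1"
        by (intro mean_bit_abs_le comb_nonneg comb_root[OF ok] comb_split)
      then have "\<bar>mean_bit (\<lambda>c. ?C n c t) (prod_encode (k, j))\<bar> * (1/2)^Suc j \<le> 1 * (1/2)^Suc j"
        by (rule mult_right_mono) simp
      then show ?thesis by (simp add: a_def abs_mult)
    qed
    have a_lim: "(\<lambda>n. a j n) \<longlonglongrightarrow> mean_bit (\<lambda>c. P c t) (prod_encode (k, j)) * (1/2)^Suc j" for j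
      unfolding a_def mean_bit_def by (intro tendsto_intros lim[rule_format])
    have tan: "(\<lambda>n. \<Sum>j. a j n) \<longlonglongrightarrow> mean_coord (\<lambda>c. P c t) k"
      by (rule tannerys_theorem[OF a_lim _ summable_half_powers, THEN conjunct2, THEN conjunct2])
        (use a_le in \<open>auto intro!: always_eventually simp del: power_Suc\<close>)
    have sum_a: "(\<Sum>j. a j n) = (\<Sum>i\<in>J n. w n i * avg (L i t) k)" for n
    proof -
      have "(\<lambda>j. mean_bit (word_freq (L i t)) (prod_encode (k, j)) * (1/2)^Suc j) sums avg (L i t) k" for i
      proof -
        have "summable (\<lambda>j. mean_bit (word_freq (L i t)) (prod_encode (k, j)) * (1/2)^Suc j)"
        proof (rule summable_comparison_test'[OF summable_half_powers, of 0])
          fix j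
          have "\<bar>mean_bit (word_freq (L i t)) (prod_encode (k, j))\<bar> \<le> 1"
            using ok by (intro mean_bit_abs_le word_freq_bounds word_freq_Nil word_freq_split) (auto simp: ok_def)
          then have "\<bar>mean_bit (word_freq (L i t)) (prod_encode (k, j))\<bar> * (1/2)^Suc j \<le> 1 * (1/2)^Suc j"
            by (rule mult_right_mono) simp
          then show "norm (mean_bit (word_freq (L i t)) (prod_encode (k, j)) * (1/2)^Suc j) \<le> (1/2)^Suc j"
            by (simp add: abs_mult)
        qed
        then show ?thesis unfolding avg_def by (simp only: summable_sums flip: cube_point_mean_bit_word_freq)
      qed
      then have "(\<lambda>j. \<Sum>i\<in>J n. w n i * (mean_bit (word_freq (L i t)) (prod_encode (k, j)) * (1/2)^Suc j))
          sums (\<Sum>i\<in>J n. w n i * avg (L i t) k)"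
        by (intro sums_sum sums_mult)
      moreover have "a j n = (\<Sum>i\<in>J n. w n i * (mean_bit (word_freq (L i t)) (prod_encode (k, j)) * (1/2)^Suc j))" for j
        unfolding a_def mean_bit_sum p_def by (simp add: sum_distrib_right mult.assoc)
      ultimately show ?thesis by (simp add: sums_iff)
    qed
    \<comment> \<open>All indices in \<open>J n\<close> are at least \<open>n\<close>, and
      \<open>k < n\<close> ensures that coordinate \<open>k\<close> is among those controlled by
      each of their lists.\<close>
    have "(\<lambda>n. (\<Sum>j. a j n) - f k t) \<longlonglongrightarrow> 0"
    proof (rule Lim_null_comparison)
      show "\<forall>\<^sub>F n in sequentially. norm ((\<Sum>j. a j n) - f k t) \<le> 2 * inverse (real (Suc n))"
        using eventually_gt_at_top[of k]
      proof eventually_elim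
        fix n assume n: "k < n"
        have "\<bar>(\<Sum>j. a j n) - f k t\<bar> = \<bar>\<Sum>i\<in>J n. w n i * (avg (L i t) k - f k t)\<bar>"
          unfolding sum_a right_diff_distrib sum_subtractf sum_distrib_right[symmetric] J(4) by simp
        also have "\<dots> \<le> 2 * inverse (real (Suc n))"
        proof (rule abs_convex_combination_le[OF J(3,4)])
          fix i assume "i \<in> J n"
          then have i: "n \<le> i" using J(2) by auto
          have "\<bar>f k t - avg (L i t) k\<bar> \<le> 2 / real (Suc i)"
            using ok k n i unfolding ok_def by (meson IntI lessThan_iff less_le_trans)
          also have "\<dots> \<le> 2 / real (Suc n)" using i by (intro divide_left_mono) auto
          finally show "\<bar>avg (L i t) k - f k t\<bar> \<le> 2 * inverse (real (Suc n))"
            by (simp add: abs_minus_commute divide_inverse)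
        qed
        finally show "norm ((\<Sum>j. a j n) - f k t) \<le> 2 * inverse (real (Suc n))" by simp
      qed
      show "(\<lambda>n. 2 * inverse (real (Suc n))) \<longlonglongrightarrow> 0"
        using tendsto_mult_left[OF LIMSEQ_inverse_real_of_nat, of 2] by simp
    qed
    then have "(\<lambda>n. \<Sum>j. a j n) \<longlonglongrightarrow> f k t" by (simp add: LIM_zero_iff)
    with tan show "mean_coord (\<lambda>c. P c t) k = f k t"
      by (rule LIMSEQ_unique)
  qed
  obtain h :: "'t \<Rightarrow> nat \<Rightarrow> real" where h: "\<And>k. (\<lambda>t. h t k) \<in> borel_measurable M" "\<And>t k. \<bar>h t k\<bar> \<le> 1"
    "AE t in M. h t \<in> K t"
    and h_int: "\<And>k A. A \<in> sets N \<Longrightarrow>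
       (LINT t:A|M. h t k) = (LINT t:A|M. mean_coord (\<lambda>c. P c t) k)"
    using tree_realization_cube[of P K, OF P_m tree closed B supp[unfolded B_def]] by blast
  show thesis
  proof (rule that[of h])
    fix k A assume k: "k \<in> I" and A: "A \<in> sets N"
    show "(LINT t:A|M. h t k) = (LINT t:A|M. f k t)"
      unfolding h_int[OF A]
    proof (rule set_lebesgue_integral_cong_AE[OF sub_sets[OF A]])
      show "(\<lambda>t. mean_coord (\<lambda>c. P c t) k) \<in> borel_measurable M"
        unfolding mean_bit_def by measurable
      show "AE t\<in>A in M. mean_coord (\<lambda>c. P c t) k = f k t"
        using mean k by (auto elim!: eventually_mono)
    qed (use f k in auto)
  qed (use h in auto)
qed

end

section \<open>Selections of correspondences into the dual\<close>

text \<open>The odd coordinates make the absolute values, and hence integrability, pass to the new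
  selection when the correspondence is not integrably bounded.\<close>

definition probe :: "(nat \<Rightarrow> 'x::real_normed_vector) \<Rightarrow> nat \<Rightarrow> 'x dual \<Rightarrow> real" where
  "probe e k \<phi> = (if even k then blinfun_apply \<phi> (e (k div 2)) else \<bar>blinfun_apply \<phi> (e (k div 2))\<bar>)"

text \<open>The counterpart of \<open>cube_approx\<close> in the dual. The odd probes are nonlinear,
  so this is approximation by convex combinations of the probe sequences of points of
  \<open>F\<close>, not of the points alone.\<close>

abbreviation hull_approx ::
    "(nat \<Rightarrow> 'x::real_normed_vector) \<Rightarrow> 'x dual set \<Rightarrow> nat set \<Rightarrow> (nat \<Rightarrow> real) \<Rightarrow> nat \<Rightarrow> bool" where
  "hull_approx e F I z n \<equiv> \<exists>S u. finite S \<and> S \<subseteq> F \<and> (\<forall>\<phi>\<in>S. 0 \<le> u \<phi>) \<and> sum u S = 1 \<and>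
     (\<forall>k\<in>I. k < n \<longrightarrow> \<bar>z k - (\<Sum>\<phi>\<in>S. u \<phi> * probe e k \<phi>)\<bar> < 1 / real (Suc n))"

lemma probe_le:
  assumes "dense_dirs e"
  shows "\<bar>probe e k \<phi>\<bar> \<le> norm \<phi>"
proof -
  have "\<bar>blinfun_apply \<phi> (e j)\<bar> \<le> norm \<phi> * norm (e j)" for j using norm_blinfun[of \<phi> "e j"] by simp
  also have "norm \<phi> * norm (e j) \<le> norm \<phi>" for j
    using assms by (intro mult_left_le) (auto simp: dense_dirs_def)
  finally show ?thesis by (simp add: probe_def)
qed

lemma continuous_map_probe: "continuous_map weak_star euclideanreal (probe e k)"
  using strong_operator_topology_continuous_evaluation[of "e (k div 2)"]
  by (cases "even k") (auto simp: probe_def[abs_def] intro: continuous_map_real_abs)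

lemma continuous_map_probes: "continuous_map weak_star euclidean (\<lambda>\<phi> k. probe e k \<phi> / r)"
  unfolding euclidean_product_topology[symmetric]
proof (rule continuous_map_coordinatewise_then_product)
  fix k :: nat
  have "continuous_map weak_star euclideanreal (\<lambda>\<phi>. inverse r * probe e k \<phi>)"
    by (intro continuous_map_real_mult_left continuous_map_probe)
  then show "continuous_map weak_star euclidean (\<lambda>\<phi>. probe e k \<phi> / r)"
    by (simp add: divide_inverse mult.commute)
qed auto

text \<open>Each evaluation is bounded on \<open>S\<close> by continuity, and the supremum of its
  absolute values is a seminorm in \<open>x\<close> whose sublevel sets are intersections of closed
  sets; uniform boundedness does the rest.\<close>

lemma compactin_weak_star_norm_bounded:
  fixes S :: "'x::banach dual set"
  assumes S: "compactin weak_star S"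
  obtains C where "\<And>\<phi>. \<phi> \<in> S \<Longrightarrow> norm \<phi> \<le> C"
proof (cases "S = {}")
  case False
  define q where "q x = (SUP \<phi>\<in>S. \<bar>blinfun_apply \<phi> x\<bar>)" for x :: 'x
  have bdd: "bdd_above ((\<lambda>\<phi>. \<bar>blinfun_apply \<phi> x\<bar>) ` S)" for x :: 'x
  proof -
    have "continuous_map weak_star euclideanreal (\<lambda>\<phi>. \<bar>blinfun_apply \<phi> x\<bar>)"
      by (intro continuous_map_real_abs strong_operator_topology_continuous_evaluation)
    from image_compactin[OF S this] show ?thesis
      by (simp add: compact_imp_bounded bounded_imp_bdd_above)
  qed
  have q_ge: "\<bar>blinfun_apply \<phi> x\<bar> \<le> q x" if "\<phi> \<in> S" for \<phi> x
    unfolding q_def by (rule cSUP_upper[OF that bdd])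
  have q_le: "q x \<le> c \<longleftrightarrow> (\<forall>\<phi>\<in>S. \<bar>blinfun_apply \<phi> x\<bar> \<le> c)" for x c
    unfolding q_def by (rule cSUP_le_iff[OF False bdd])
  obtain C where C: "\<And>x. q x \<le> C * norm x"
  proof (rule seminorm_bounded[of q])
    show "q (x + y) \<le> q x + q y" for x y
      unfolding q_le
    proof
      fix \<phi> assume "\<phi> \<in> S"
      then show "\<bar>blinfun_apply \<phi> (x + y)\<bar> \<le> q x + q y"
        using q_ge[of \<phi> x] q_ge[of \<phi> y] by (simp add: blinfun.add_right)
    qed
    show "q (r *\<^sub>R x) = \<bar>r\<bar> * q x" for r x
    proof (rule antisym)
      show "q (r *\<^sub>R x) \<le> \<bar>r\<bar> * q x" for r x
        unfolding q_le using q_ge by (auto simp: blinfun.scaleR_right abs_mult intro: mult_left_mono)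
      from this[of "inverse r" "r *\<^sub>R x"] show "\<bar>r\<bar> * q x \<le> q (r *\<^sub>R x)"
      proof (cases "r = 0")
        case True
        obtain \<phi> where "\<phi> \<in> S" using False by blast
        then show ?thesis using q_ge[of \<phi> 0] True by simp
      qed (simp add: field_simps abs_mult)
    qed
    show "closed {x. q x \<le> c}" for c
    proof -
      have "{x. q x \<le> c} = (\<Inter>\<phi>\<in>S. {x. \<bar>blinfun_apply \<phi> x\<bar> \<le> c})" by (auto simp: q_le)
      also have "closed \<dots>"
        by (intro closed_INT ballI closed_Collect_le continuous_intros)
      finally show ?thesis .
    qed
  qed blast
  show thesis
  proof (rule that)
    fix \<phi> assume \<phi>: "\<phi> \<in> S"
    show "norm \<phi> \<le> max C 0"
    proof (rule norm_blinfun_bound)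
      fix x
      have "norm (blinfun_apply \<phi> x) \<le> C * norm x" using q_ge[OF \<phi>, of x] C[of x] by simp
      also have "\<dots> \<le> max C 0 * norm x" by (intro mult_right_mono) auto
      finally show "norm (blinfun_apply \<phi> x) \<le> max C 0 * norm x" .
    qed simp
  qed
qed (use that in blast)

text \<open>It expresses a norm bound by countably many weak-star closed conditions, a form in which
  the measurability of a correspondence can be used.\<close>

lemma norm_le_iff_dense_dirs:
  fixes \<phi> :: "'x::real_normed_vector dual" and e :: "nat \<Rightarrow> 'x"
  assumes e: "dense_dirs e" and C: "0 \<le> C"
  shows "norm \<phi> \<le> C \<longleftrightarrow> (\<forall>k. \<bar>\<phi> (e k)\<bar> \<le> C * norm (e k))"
proof
  assume "norm \<phi> \<le> C"
  then show "\<forall>k. \<bar>\<phi> (e k)\<bar> \<le> C * norm (e k)"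
    using norm_blinfun[of \<phi>] by (metis mult_right_mono norm_ge_zero order_trans real_norm_def)
next
  assume *: "\<forall>k. \<bar>\<phi> (e k)\<bar> \<le> C * norm (e k)"
  show "norm \<phi> \<le> C"
  proof (rule norm_blinfun_bound[OF C])
    fix x
    obtain k r where x: "(\<lambda>n. r n *\<^sub>R e (k n)) \<longlonglongrightarrow> x" using dense_dirs_tendsto[OF e] .
    have "norm (\<phi> (r n *\<^sub>R e (k n))) \<le> C * norm (r n *\<^sub>R e (k n))" for n
      using mult_left_mono[OF *[rule_format, of "k n"], of "\<bar>r n\<bar>"]
      by (simp add: blinfun.scaleR_right abs_mult mult.left_commute)
    then show "norm (\<phi> x) \<le> C * norm x"
      using x by (intro tendsto_le[OF _ tendsto_mult_left[OF tendsto_norm[OF x]] tendsto_norm[OF blinfun.tendsto[OF tendsto_const x]]]) auto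
  qed
qed

section \<open>Restoring a factor that is measurable over the sub-sigma-algebra\<close>

context sub_prob_space
begin

text \<open>Equal integrals over all sets of \<open>sets N\<close> mean equal conditional
  expectations, and a factor measurable over \<open>N\<close>, even an unbounded one, passes through
  them.\<close>

lemma weighted_integral_eq:
  fixes X Y r :: "'t \<Rightarrow> real"
  assumes [measurable]: "integrable M X" "integrable M Y" "r \<in> borel_measurable N"
    and eq: "\<And>A. A \<in> sets N \<Longrightarrow> (LINT t:A|M. X t) = (LINT t:A|M. Y t)"
    and int: "integrable M (\<lambda>t. r t * X t)" "integrable M (\<lambda>t. r t * Y t)"
  shows "(\<integral>t. r t * X t \<partial>M) = (\<integral>t. r t * Y t \<partial>M)"
proof -
  have rM[measurable]: "r \<in> borel_measurable M" using assms(3) subalg measurable_from_subalg by blast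
  have "AE t in M. real_cond_exp M N X t = real_cond_exp M N Y t"
  proof (rule real_cond_exp_charact)
    fix A assume "A \<in> sets N"
    then show "(LINT t:A|M. X t) = (LINT t:A|M. real_cond_exp M N Y t)"
      by (simp add: eq real_cond_exp_intA[OF assms(2), symmetric])
  qed (use assms real_cond_exp_int(1)[OF assms(2)] in auto)
  then have "(\<integral>t. r t * real_cond_exp M N X t \<partial>M) = (\<integral>t. r t * real_cond_exp M N Y t \<partial>M)"
    by (intro integral_cong_AE) (auto elim!: eventually_mono)
  then show ?thesis using int by (simp add: real_cond_exp_intg(2))
qed

text \<open>In the nonnegative case both sides may be infinite, so finiteness of one integral can be
  inferred from the other.\<close>

lemma weighted_nn_integral_eq:
  fixes X Y r :: "'t \<Rightarrow> real"
  assumes int: "integrable M X" "integrable M Y" and r[measurable]: "r \<in> borel_measurable N"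
    and eq: "\<And>A. A \<in> sets N \<Longrightarrow> (LINT t:A|M. X t) = (LINT t:A|M. Y t)"
    and nonneg: "AE t in M. 0 \<le> X t" "AE t in M. 0 \<le> Y t" "\<And>t. 0 \<le> r t"
  shows "(\<integral>\<^sup>+t. ennreal (r t * X t) \<partial>M) = (\<integral>\<^sup>+t. ennreal (r t * Y t) \<partial>M)"
proof -
  have rM[measurable]: "r \<in> borel_measurable M" using assms(3) subalg measurable_from_subalg by blast
  note [measurable] = borel_measurable_integrable[OF int(1)] borel_measurable_integrable[OF int(2)]
  have nn: "(\<integral>\<^sup>+t\<in>A. ennreal (Z t) \<partial>M) = ennreal (LINT t:A|M. Z t)"
    if "integrable M Z" "AE t in M. 0 \<le> Z t" "A \<in> sets N" for Z A
  proof -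
    have "(\<integral>\<^sup>+t\<in>A. ennreal (Z t) \<partial>M) = (\<integral>\<^sup>+t. ennreal (indicator A t * Z t) \<partial>M)"
      by (intro nn_integral_cong) (auto simp: indicator_def)
    also have "\<dots> = ennreal (\<integral>t. indicator A t * Z t \<partial>M)"
    proof (rule nn_integral_eq_integral)
      show "integrable M (\<lambda>t. indicator A t * Z t)"
        using set_integrable_sub[OF that(1,3)] by (simp add: set_integrable_def)
      show "AE t in M. 0 \<le> indicator A t * Z t" using that(2) by (auto elim!: eventually_mono)
    qed
    finally show ?thesis by (simp add: set_lebesgue_integral_def)
  qed
  have "AE t in M. nn_cond_exp M N Y t = nn_cond_exp M N X t"
  proof (rule nn_cond_exp_charact)
    fix A assume A: "A \<in> sets N"
    have "(\<integral>\<^sup>+t\<in>A. nn_cond_exp M N Y t \<partial>M) = (\<integral>\<^sup>+t. indicator A t * nn_cond_exp M N Y t \<partial>M)"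
      by (simp add: mult.commute)
    also have "\<dots> = (\<integral>\<^sup>+t. indicator A t * ennreal (Y t) \<partial>M)"
      using A by (intro nn_cond_exp_intg) auto
    also have "\<dots> = (\<integral>\<^sup>+t\<in>A. ennreal (Y t) \<partial>M)" by (simp add: mult.commute)
    finally show "(\<integral>\<^sup>+t\<in>A. ennreal (X t) \<partial>M) = (\<integral>\<^sup>+t\<in>A. nn_cond_exp M N Y t \<partial>M)"
      using A by (simp add: nn[OF int(1) nonneg(1)] nn[OF int(2) nonneg(2)] eq)
  qed auto
  then have "(\<integral>\<^sup>+t. ennreal (r t) * nn_cond_exp M N X t \<partial>M) = (\<integral>\<^sup>+t. ennreal (r t) * nn_cond_exp M N Y t \<partial>M)"
    by (intro nn_integral_cong_AE) (auto elim!: eventually_mono)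
  then show ?thesis using nonneg(3) by (simp add: nn_cond_exp_intg ennreal_mult')
qed

end

context nowhere_equivalent_subalgebra
begin

text \<open>Violating a norm bound at a direction is a strict, hence open, condition, whereas
  measurability of \<open>F\<close> speaks of closed sets. The margin
  \<open>1 / real (Suc m)\<close> writes the violation as a countable union of the closed sets
  \<open>E k m\<close>.\<close>

lemma norm_bound_measurable:
  fixes F :: "'t \<Rightarrow> 'x::real_normed_vector dual set" and e :: "nat \<Rightarrow> 'x"
  assumes e: "dense_dirs e" and F: "corr_measurable N F"
  shows "{t \<in> space N. \<forall>\<phi>\<in>F t. norm \<phi> \<le> real n} \<in> sets N"
proof -
  define E where "E k m = {\<phi> :: 'x dual. real n * norm (e k) + 1 / real (Suc m) \<le> \<bar>blinfun_apply \<phi> (e k)\<bar>}" for k m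
  have "closedin weak_star (E k m)" for k m
  proof -
    have "continuous_map weak_star euclideanreal (\<lambda>\<phi>. \<bar>blinfun_apply \<phi> (e k)\<bar>)"
      by (intro continuous_map_real_abs strong_operator_topology_continuous_evaluation)
    then have "closedin weak_star {\<phi> \<in> topspace weak_star. \<bar>blinfun_apply \<phi> (e k)\<bar> \<in> {real n * norm (e k) + 1 / real (Suc m)..}}"
      by (rule closedin_continuous_map_preimage) simp
    then show ?thesis by (simp add: E_def strong_operator_topology_topspace)
  qed
  then have E: "{t \<in> space N. F t \<inter> E k m \<noteq> {}} \<in> sets N" for k m
    using F unfolding corr_measurable_def by blast
  have E_iff: "norm \<phi> \<le> real n \<longleftrightarrow> (\<forall>k m. \<phi> \<notin> E k m)" for \<phi>
  proof -
    have "\<bar>blinfun_apply \<phi> (e k)\<bar> \<le> real n * norm (e k) \<longleftrightarrow> (\<forall>m. \<phi> \<notin> E k m)" for k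
    proof
      assume *: "\<forall>m. \<phi> \<notin> E k m"
      show "\<bar>blinfun_apply \<phi> (e k)\<bar> \<le> real n * norm (e k)"
      proof (rule field_le_epsilon)
        fix \<epsilon> :: real assume "\<epsilon> > 0"
        then obtain m where "inverse (real (Suc m)) < \<epsilon>" using reals_Archimedean by blast
        moreover have "\<bar>blinfun_apply \<phi> (e k)\<bar> < real n * norm (e k) + 1 / real (Suc m)"
          using * by (simp add: E_def not_le del: of_nat_Suc)
        ultimately show "\<bar>blinfun_apply \<phi> (e k)\<bar> \<le> real n * norm (e k) + \<epsilon>"
          by (simp add: inverse_eq_divide)
      qed
    next
      assume *: "\<bar>blinfun_apply \<phi> (e k)\<bar> \<le> real n * norm (e k)"
      show "\<forall>m. \<phi> \<notin> E k m"
      proof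
        fix m
        have "0 < 1 / real (Suc m)" by simp
        with * show "\<phi> \<notin> E k m" unfolding E_def mem_Collect_eq by linarith
      qed
    qed
    then show ?thesis using norm_le_iff_dense_dirs[OF e, of "real n" \<phi>] by auto
  qed
  have "{t \<in> space N. \<forall>\<phi>\<in>F t. norm \<phi> \<le> real n} = space N - (\<Union>k m. {t \<in> space N. F t \<inter> E k m \<noteq> {}})"
    using E_iff by auto
  also have "\<dots> \<in> sets N" using E by auto
  finally show ?thesis .
qed

text \<open>To pass through conditional expectations the bound must be measurable over
  \<open>N\<close>, so it is taken from \<open>F\<close> itself as the least integer bound; one
  exists because weak-star compact sets are norm bounded.\<close>

lemma exists_norm_bound:
  fixes F :: "'t \<Rightarrow> 'x::banach dual set" and e :: "nat \<Rightarrow> 'x"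
  assumes e: "dense_dirs e" and F: "corr_measurable N F" and comp: "weak_star_compact_valued M F"
  obtains \<rho> :: "'t \<Rightarrow> nat" where "\<rho> \<in> measurable N (count_space UNIV)" "\<And>t. 1 \<le> \<rho> t"
    "AE t in M. \<forall>\<phi>\<in>F t. norm \<phi> \<le> real (\<rho> t)"
proof -
  \<comment> \<open>The successor gives \<open>1 \<le> \<rho> t\<close>, so division by it never
    enlarges an approximation error.\<close>
  define \<rho> where "\<rho> t = Suc (LEAST n. \<forall>\<phi>\<in>F t. norm \<phi> \<le> real n)" for t
  show thesis
  proof (rule that[of \<rho>])
    have "(\<lambda>t. LEAST n. \<forall>\<phi>\<in>F t. norm \<phi> \<le> real n) \<in> measurable N (count_space UNIV)"
      by (rule measurable_Least) (use norm_bound_measurable[OF e F] in \<open>simp add: vimage_def Int_def conj_commute\<close>)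
    then show "\<rho> \<in> measurable N (count_space UNIV)"
      unfolding \<rho>_def by (rule measurable_compose) simp
    show "1 \<le> \<rho> t" for t by (simp add: \<rho>_def)
    show "AE t in M. \<forall>\<phi>\<in>F t. norm \<phi> \<le> real (\<rho> t)"
      using comp[unfolded weak_star_compact_valued_def]
    proof eventually_elim
      fix t assume "compactin weak_star (F t)"
      then obtain C where C: "\<And>\<phi>. \<phi> \<in> F t \<Longrightarrow> norm \<phi> \<le> C" by (rule compactin_weak_star_norm_bounded) blast
      obtain n where "C \<le> real n" using real_arch_simple by blast
      then have "\<forall>\<phi>\<in>F t. norm \<phi> \<le> real n" using C by (meson order_trans)
      from LeastI[of "\<lambda>n. \<forall>\<phi>\<in>F t. norm \<phi> \<le> real n", OF this]
      show "\<forall>\<phi>\<in>F t. norm \<phi> \<le> real (\<rho> t)" unfolding \<rho>_def by force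
    qed
  qed
qed

text \<open>Dividing the probes by \<open>\<rho>\<close> carries \<open>F t\<close> to a closed
  subset of the cube; \<open>h\<close> is a preimage of the point selected there, and the factor
  \<open>\<rho>\<close> is restored in the integrals afterwards. The identity for odd probes
  presupposes no integrability: it is the source of integrability for \<open>h\<close> when
  \<open>F\<close> has no integrable bound.\<close>

lemma dual_selection:
  fixes F :: "'t \<Rightarrow> 'x::banach dual set" and e :: "nat \<Rightarrow> 'x" and I :: "nat set" and g :: "nat \<Rightarrow> 't \<Rightarrow> real"
  assumes e: "dense_dirs e" and F: "corr_measurable N F" and comp: "weak_star_compact_valued M F"
    and g[measurable]: "\<And>k. k \<in> I \<Longrightarrow> g k \<in> borel_measurable M"
    and approx: "AE t in M. \<forall>n. hull_approx e (F t) I (\<lambda>k. g k t) n"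
  obtains h where "h \<in> measurable M weak_star_borel" "AE t in M. h t \<in> F t"
    "\<And>k. k \<in> I \<Longrightarrow> integrable M (\<lambda>t. probe e k (h t)) \<Longrightarrow> integrable M (g k) \<Longrightarrow>
       (\<integral>t. probe e k (h t) \<partial>M) = (\<integral>t. g k t \<partial>M)"
    "\<And>k. k \<in> I \<Longrightarrow> odd k \<Longrightarrow> AE t in M. 0 \<le> g k t \<Longrightarrow>
       (\<integral>\<^sup>+t. ennreal (probe e k (h t)) \<partial>M) = (\<integral>\<^sup>+t. ennreal (g k t) \<partial>M)"
proof -
  obtain \<rho> :: "'t \<Rightarrow> nat" where \<rho>N[measurable]: "\<rho> \<in> measurable N (count_space UNIV)" and \<rho>1: "\<And>t. 1 \<le> \<rho> t"
    and \<rho>_le: "AE t in M. \<forall>\<phi>\<in>F t. norm \<phi> \<le> real (\<rho> t)"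
    by (rule exists_norm_bound[OF e F comp]) blast
  have \<rho>M[measurable]: "\<rho> \<in> measurable M (count_space UNIV)"
    using measurable_from_subalg[OF subalg \<rho>N] .
  have \<rho>0: "0 < real (\<rho> t)" for t using \<rho>1[of t] by simp
  have \<rho>real: "(\<lambda>t. real (\<rho> t)) \<in> borel_measurable N" by measurable
  define \<pi> where "\<pi> r \<phi> k = probe e k \<phi> / r" for r \<phi> k
  define K where "K t = \<pi> (real (\<rho> t)) ` F t" for t
  define f where "f k t = g k t / real (\<rho> t)" for k t
  have \<pi>_cont: "continuous_map weak_star euclidean (\<pi> r)" for r
    unfolding \<pi>_def by (rule continuous_map_probes)
  have \<pi>_le: "\<bar>\<pi> r \<phi> k\<bar> \<le> 1" if "norm \<phi> \<le> r" "0 < r" for r \<phi> k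
    using probe_le[OF e, of k \<phi>] that by (simp add: \<pi>_def divide_le_eq_1_pos abs_divide)
  have K_closed: "AE t in M. closed (K t)"
    using comp[unfolded weak_star_compact_valued_def]
  proof eventually_elim
    fix t assume "compactin weak_star (F t)"
    from image_compactin[OF this \<pi>_cont] show "closed (K t)"
      unfolding K_def by (intro compact_imp_closed) simp
  qed
  have K_meas: "{t \<in> space M. K t \<inter> cell c \<noteq> {}} \<in> sets N" for c
  proof -
    let ?C = "cell c"
    have C: "closed ?C" by (intro compact_imp_closed compact_cell)
    define E where "E n = {\<phi> \<in> topspace weak_star. \<pi> (real n) \<phi> \<in> ?C}" for n
    have "closedin weak_star (E n)" for n
      unfolding E_def using \<pi>_cont C by (intro closedin_continuous_map_preimage) auto
    then have E: "{t \<in> space N. F t \<inter> E n \<noteq> {}} \<in> sets N" for n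
      using F unfolding corr_measurable_def by blast
    have \<rho>n: "{t \<in> space N. \<rho> t = n} \<in> sets N" for n by measurable
    have "{t \<in> space M. K t \<inter> ?C \<noteq> {}} = (\<Union>n. {t \<in> space N. \<rho> t = n} \<inter> {t \<in> space N. F t \<inter> E n \<noteq> {}})"
      by (auto simp: K_def E_def sub_space strong_operator_topology_topspace)
    also have "\<dots> \<in> sets N" using E \<rho>n by auto
    finally show ?thesis .
  qed
  have f_m: "f k \<in> borel_measurable M" if "k \<in> I" for k
    using g[OF that] unfolding f_def by measurable
  have f_approx: "AE t in M. \<forall>n. cube_approx (K t) I (\<lambda>k. f k t) n"
    using approx \<rho>_le
  proof (eventually_elim, intro allI)
    fix t n
    assume \<rho>_le: "\<forall>\<phi>\<in>F t. norm \<phi> \<le> real (\<rho> t)"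
      and "\<forall>n. hull_approx e (F t) I (\<lambda>k. g k t) n"
    then obtain S u where S: "finite S" "S \<subseteq> F t" "\<forall>\<phi>\<in>S. 0 \<le> u \<phi>" "sum u S = 1"
      and gS: "\<forall>k\<in>I. k < n \<longrightarrow> \<bar>g k t - (\<Sum>\<phi>\<in>S. u \<phi> * probe e k \<phi>)\<bar> < 1 / real (Suc n)"
      by (elim allE[of _ n] exE conjE)
    define P where "P = \<pi> (real (\<rho> t))"
    \<comment> \<open>Weights of functionals with the same image are pooled, so that the combination
      can be indexed by points of the cube.\<close>
    define v where "v y = sum u {\<phi> \<in> S. P \<phi> = y}" for y
    have sum_v: "(\<Sum>y\<in>P ` S. v y * z y) = (\<Sum>\<phi>\<in>S. u \<phi> * z (P \<phi>))" for z :: "_ \<Rightarrow> real"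
    proof -
      have "(\<Sum>\<phi>\<in>S. u \<phi> * z (P \<phi>)) = (\<Sum>y\<in>P ` S. \<Sum>\<phi>\<in>{\<phi> \<in> S. P \<phi> = y}. u \<phi> * z (P \<phi>))"
        by (rule sum.image_gen[OF S(1)])
      also have "\<dots> = (\<Sum>y\<in>P ` S. v y * z y)"
        unfolding v_def sum_distrib_right by (intro sum.cong) auto
      finally show ?thesis ..
    qed
    have "\<bar>f k t - (\<Sum>y\<in>P ` S. v y * y k)\<bar> < 1 / real (Suc n)" if k: "k \<in> I" "k < n" for k
    proof -
      have "(\<Sum>y\<in>P ` S. v y * y k) = (\<Sum>\<phi>\<in>S. u \<phi> * probe e k \<phi>) / real (\<rho> t)"
        unfolding sum_v by (simp add: P_def \<pi>_def sum_divide_distrib)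
      then have "f k t - (\<Sum>y\<in>P ` S. v y * y k) = (g k t - (\<Sum>\<phi>\<in>S. u \<phi> * probe e k \<phi>)) / real (\<rho> t)"
        by (simp add: f_def diff_divide_distrib)
      then have "\<bar>f k t - (\<Sum>y\<in>P ` S. v y * y k)\<bar> = \<bar>g k t - (\<Sum>\<phi>\<in>S. u \<phi> * probe e k \<phi>)\<bar> / real (\<rho> t)"
        by (simp add: abs_divide)
      also have "\<dots> \<le> \<bar>g k t - (\<Sum>\<phi>\<in>S. u \<phi> * probe e k \<phi>)\<bar> / 1"
        using \<rho>1[of t] by (intro divide_left_mono) auto
      also have "\<dots> < 1 / real (Suc n)" using gS k by simp
      finally show ?thesis .
    qed
    moreover have "sum v (P ` S) = 1" using sum_v[of "\<lambda>_. 1"] S(4) by simp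
    moreover have "0 \<le> v y" for y unfolding v_def using S(3) by (intro sum_nonneg) auto
    moreover have "\<bar>y k\<bar> \<le> 1" if "y \<in> P ` S" for y k
      using that S(2) \<rho>_le \<pi>_le[OF _ \<rho>0] by (auto simp: P_def)
    moreover have "P ` S \<subseteq> K t" using S(2) by (auto simp: P_def K_def)
    ultimately show "cube_approx (K t) I (\<lambda>k. f k t) n"
      using S(1) by (intro exI[of _ "P ` S"] exI[of _ v]) auto
  qed
  obtain y :: "'t \<Rightarrow> nat \<Rightarrow> real" where y[measurable]: "\<And>k. (\<lambda>t. y t k) \<in> borel_measurable M"
    and y_le: "\<And>t k. \<bar>y t k\<bar> \<le> 1" and y_K: "AE t in M. y t \<in> K t"
    and y_int: "\<And>k A. k \<in> I \<Longrightarrow> A \<in> sets N \<Longrightarrow> (LINT t:A|M. y t k) = (LINT t:A|M. f k t)"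
    using cube_selection[of K I f, OF K_closed K_meas f_m f_approx] by blast
  from y_K obtain Z where Z: "\<And>t. t \<in> space M - Z \<Longrightarrow> y t \<in> K t" "Z \<in> null_sets M"
    by (rule AE_E3) blast
  have ZM[measurable]: "Z \<in> sets M" using Z(2) by auto
  \<comment> \<open>Any preimage will do: its values at the directions are forced to be
    \<open>real (\<rho> t) * y t (2 * k)\<close>, so \<open>h\<close> is measurable although the
    preimage is chosen pointwise.\<close>
  define h where "h t = (if t \<in> space M - Z then SOME \<phi>. \<phi> \<in> F t \<and> \<pi> (real (\<rho> t)) \<phi> = y t else 0)" for t
  have h: "h t \<in> F t \<and> \<pi> (real (\<rho> t)) (h t) = y t" if "t \<in> space M - Z" for t
  proof -
    have "\<exists>\<phi>. \<phi> \<in> F t \<and> \<pi> (real (\<rho> t)) \<phi> = y t" using Z(1)[OF that] by (auto simp: K_def)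
    from someI_ex[OF this] show ?thesis unfolding h_def if_P[OF that] .
  qed
  have probe_h: "probe e k (h t) = real (\<rho> t) * y t k" if "t \<in> space M - Z" for t k
    using h[OF that] \<rho>0[of t] by (auto simp: \<pi>_def fun_eq_iff field_simps)
  have AE_Z: "AE t in M. t \<in> space M - Z" using AE_not_in[OF Z(2)] AE_space by eventually_elim auto
  have y_integrable: "integrable M (\<lambda>t. y t k)" for k
    using y_le by (intro integrable_const_bound[where B = 1]) auto
  \<comment> \<open>For \<open>n = Suc k\<close>, \<open>f k t\<close> is within 1 of a convex
    combination of numbers in \<open>[-1,1]\<close>. This makes \<open>f k\<close> integrable even
    where \<open>g k\<close> is not known to be.\<close>
  have f_le: "AE t in M. \<bar>f k t\<bar> \<le> 2" if k: "k \<in> I" for k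
    using f_approx
  proof eventually_elim
    fix t
    assume "\<forall>n. cube_approx (K t) I (\<lambda>k. f k t) n"
    then obtain S and u :: "(nat \<Rightarrow> real) \<Rightarrow> real" where S: "\<forall>y\<in>S. \<forall>k. \<bar>y k\<bar> \<le> 1" "\<forall>y\<in>S. 0 \<le> u y" "sum u S = 1"
      and fS: "\<forall>j\<in>I. j < Suc k \<longrightarrow> \<bar>f j t - (\<Sum>y\<in>S. u y * y j)\<bar> < 1 / real (Suc (Suc k))"
      by (elim allE[of _ "Suc k"] exE conjE)
    have "\<bar>\<Sum>y\<in>S. u y * y k\<bar> \<le> (\<Sum>y\<in>S. u y * 1)"
    proof (rule order_trans[OF sum_abs], rule sum_mono)
      fix y assume "y \<in> S"
      with S(1,2) show "\<bar>u y * y k\<bar> \<le> u y * 1" by (simp add: abs_mult mult_left_le)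
    qed
    then have "\<bar>\<Sum>y\<in>S. u y * y k\<bar> \<le> 1" by (simp add: S(3))
    moreover have "1 / real (Suc (Suc k)) \<le> 1" by simp
    moreover have "\<bar>f k t - (\<Sum>y\<in>S. u y * y k)\<bar> < 1 / real (Suc (Suc k))" using fS k by simp
    ultimately show "\<bar>f k t\<bar> \<le> 2" by linarith
  qed
  have f_integrable: "integrable M (f k)" if "k \<in> I" for k
    using f_le[OF that] f_m[OF that] by (intro integrable_const_bound[where B = 2]) auto
  have \<rho>f: "real (\<rho> t) * f k t = g k t" for k t using \<rho>0[of t] by (simp add: f_def)
  show thesis
  proof (rule that[of h])
    show h_m: "h \<in> measurable M weak_star_borel"
    proof (rule weak_star_borel_measurableI[OF e])
      fix k
      have "h t (e k) = (if t \<in> Z then 0 else real (\<rho> t) * y t (2 * k))" if "t \<in> space M" for t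
        using probe_h[of t "2 * k"] that by (auto simp: probe_def) (simp add: h_def)
      then show "(\<lambda>t. h t (e k)) \<in> borel_measurable M"
        by (subst measurable_cong) measurable
    qed
    show "AE t in M. h t \<in> F t" using AE_Z by eventually_elim (use h in blast)
    note hm = weak_star_borel_measurableD[OF h_m]
    have probe_m[measurable]: "(\<lambda>t. probe e k (h t)) \<in> borel_measurable M" for k
      using hm[of "e (k div 2)"] by (cases "even k") (auto simp: probe_def)
    have AE_probe: "AE t in M. probe e k (h t) = real (\<rho> t) * y t k" for k
      using AE_Z by eventually_elim (rule probe_h)
    fix k assume k: "k \<in> I"
    show "(\<integral>t. probe e k (h t) \<partial>M) = (\<integral>t. g k t \<partial>M)"
      if int: "integrable M (\<lambda>t. probe e k (h t))" "integrable M (g k)"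
    proof -
      have "integrable M (\<lambda>t. real (\<rho> t) * y t k)"
        using int(1) AE_probe[of k] by (subst (asm) integrable_cong_AE) auto
      moreover have "integrable M (\<lambda>t. real (\<rho> t) * f k t)" using int(2) by (simp add: \<rho>f)
      ultimately have "(\<integral>t. real (\<rho> t) * y t k \<partial>M) = (\<integral>t. real (\<rho> t) * f k t \<partial>M)"
        using y_integrable f_integrable[OF k] \<rho>real y_int[OF k] by (intro weighted_integral_eq) auto
      also have "(\<integral>t. real (\<rho> t) * y t k \<partial>M) = (\<integral>t. probe e k (h t) \<partial>M)"
        using AE_probe[of k] by (intro integral_cong_AE) (auto elim!: eventually_mono)
      finally show ?thesis by (simp add: \<rho>f)
    qed
    show "(\<integral>\<^sup>+t. ennreal (probe e k (h t)) \<partial>M) = (\<integral>\<^sup>+t. ennreal (g k t) \<partial>M)"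
      if "odd k" and pos: "AE t in M. 0 \<le> g k t"
    proof -
      \<comment> \<open>An odd probe is an absolute value, so its normalised coordinate inherits the
        sign that the nonnegative identity requires.\<close>
      have "AE t in M. 0 \<le> y t k"
        using AE_probe[of k]
      proof eventually_elim
        fix t assume "probe e k (h t) = real (\<rho> t) * y t k"
        moreover have "0 \<le> probe e k (h t)" using \<open>odd k\<close> by (simp add: probe_def)
        ultimately show "0 \<le> y t k" using \<rho>0[of t] by (simp add: zero_le_mult_iff)
      qed
      moreover have "AE t in M. 0 \<le> f k t" using pos by eventually_elim (simp add: f_def)
      ultimately have "(\<integral>\<^sup>+t. ennreal (real (\<rho> t) * y t k) \<partial>M) = (\<integral>\<^sup>+t. ennreal (real (\<rho> t) * f k t) \<partial>M)"
        using y_integrable f_integrable[OF k] \<rho>real y_int[OF k] by (intro weighted_nn_integral_eq) auto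
      also have "(\<integral>\<^sup>+t. ennreal (real (\<rho> t) * y t k) \<partial>M) = (\<integral>\<^sup>+t. ennreal (probe e k (h t)) \<partial>M)"
        using AE_probe[of k] by (intro nn_integral_cong_AE) (auto elim!: eventually_mono)
      finally show ?thesis by (simp add: \<rho>f)
    qed
  qed
qed

end

section \<open>Gelfand integrals\<close>

abbreviation weak_star_ball :: "'x::real_normed_vector dual \<Rightarrow> 'x set \<Rightarrow> real \<Rightarrow> 'x dual set" where
  "weak_star_ball \<psi> X \<epsilon> \<equiv> {\<phi>. \<forall>x\<in>X. \<bar>blinfun_apply \<phi> x - blinfun_apply \<psi> x\<bar> < \<epsilon>}"

lemma openin_weak_star_ball:
  fixes \<psi> :: "'x::real_normed_vector dual"
  assumes "finite X"
  shows "openin weak_star (weak_star_ball \<psi> X \<epsilon>)"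
  using assms
proof induction
  case empty
  then show ?case using openin_topspace[of weak_star] by (simp add: strong_operator_topology_topspace)
next
  case (insert x X)
  have "continuous_map weak_star euclideanreal (\<lambda>\<phi>. \<bar>blinfun_apply \<phi> x - blinfun_apply \<psi> x\<bar>)"
    by (intro continuous_map_real_abs continuous_map_diff strong_operator_topology_continuous_evaluation) simp
  then have "openin weak_star {\<phi> \<in> topspace weak_star. \<bar>blinfun_apply \<phi> x - blinfun_apply \<psi> x\<bar> \<in> {..<\<epsilon>}}"
    by (rule openin_continuous_map_preimage) simp
  from openin_Int[OF this insert.IH] show ?case
    by (simp add: strong_operator_topology_topspace Int_def)
qed

lemma weak_star_nbhd:
  fixes \<psi> :: "'x::real_normed_vector dual"
  assumes U: "openin weak_star U" "\<psi> \<in> U"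
  obtains X \<epsilon> where "finite X" "0 < \<epsilon>" "weak_star_ball \<psi> X \<epsilon> \<subseteq> U"
proof -
  obtain V :: "('x \<Rightarrow> real) set" where V: "open V" "U = blinfun_apply -` V"
    using U(1) unfolding strong_operator_topology_def openin_pullback_topology by auto
  have "openin (product_topology (\<lambda>_. euclidean) UNIV) V"
    using V(1) by (simp add: euclidean_product_topology)
  moreover have "blinfun_apply \<psi> \<in> V" using U(2) V(2) by simp
  ultimately obtain B :: "'x \<Rightarrow> real set" where B: "blinfun_apply \<psi> \<in> PiE UNIV B" "\<And>x. open (B x)"
    "finite {x. B x \<noteq> UNIV}" "PiE UNIV B \<subseteq> V"
    by (drule_tac product_topology_open_contains_basis) auto
  let ?X = "{x. B x \<noteq> UNIV}"
  have "\<forall>x. \<exists>d>0. \<forall>z. \<bar>z - blinfun_apply \<psi> x\<bar> < d \<longrightarrow> z \<in> B x"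
  proof
    fix x
    have "blinfun_apply \<psi> x \<in> B x" using B(1) by auto
    with B(2)[of x] show "\<exists>d>0. \<forall>z. \<bar>z - blinfun_apply \<psi> x\<bar> < d \<longrightarrow> z \<in> B x"
      unfolding open_dist dist_real_def by blast
  qed
  then obtain d where d: "\<forall>x. 0 < d x \<and> (\<forall>z. \<bar>z - blinfun_apply \<psi> x\<bar> < d x \<longrightarrow> z \<in> B x)"
    by (rule choice[THEN exE])
  define \<epsilon> where "\<epsilon> = Min (insert 1 (d ` ?X))"
  have "0 < \<epsilon>" using B(3) d by (auto simp: \<epsilon>_def)
  moreover have "weak_star_ball \<psi> ?X \<epsilon> \<subseteq> U"
  proof
    fix \<phi> assume \<phi>: "\<phi> \<in> weak_star_ball \<psi> ?X \<epsilon>"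
    have "blinfun_apply \<phi> x \<in> B x" for x
    proof (cases "x \<in> ?X")
      case True
      then have "\<epsilon> \<le> d x" using B(3) by (auto simp: \<epsilon>_def)
      moreover have "\<bar>blinfun_apply \<phi> x - blinfun_apply \<psi> x\<bar> < \<epsilon>" using \<phi> True by blast
      ultimately show ?thesis using d by auto
    qed auto
    then have "blinfun_apply \<phi> \<in> V" using B(4) by auto
    then show "\<phi> \<in> U" using V(2) by simp
  qed
  ultimately show thesis using B(3) by (intro that)
qed

text \<open>Averaging over tails preserves limits: it identifies the integral of the limit of the
  averaged selections with the limit of the original integrals.\<close>

lemma tail_average_tendsto:
  fixes a :: "nat \<Rightarrow> real"
  assumes a: "a \<longlonglongrightarrow> l" and J: "\<And>n. J n \<subseteq> {n..}" and w: "\<And>n j. 0 \<le> w n j" "\<And>n. sum (w n) (J n) = 1"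
  shows "(\<lambda>n. \<Sum>j\<in>J n. w n j * a j) \<longlonglongrightarrow> l"
proof (rule LIMSEQ_I)
  fix r :: real assume r: "0 < r"
  then obtain n0 where n0: "\<And>j. j \<ge> n0 \<Longrightarrow> \<bar>a j - l\<bar> < r / 2"
    using LIMSEQ_D[OF a, of "r / 2"] by auto
  show "\<exists>n0. \<forall>n\<ge>n0. norm ((\<Sum>j\<in>J n. w n j * a j) - l) < r"
  proof (intro exI[of _ n0] allI impI)
    fix n assume n: "n \<ge> n0"
    have "(\<Sum>j\<in>J n. w n j * a j) - l = (\<Sum>j\<in>J n. w n j * (a j - l))"
      unfolding right_diff_distrib sum_subtractf sum_distrib_right[symmetric] w(2) by simp
    also have "\<bar>\<dots>\<bar> \<le> r / 2"
      using J[of n] n by (intro abs_convex_combination_le w less_imp_le[OF n0]) auto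
    finally show "norm ((\<Sum>j\<in>J n. w n j * a j) - l) < r" using r by simp
  qed
qed

lemma gelfand_integrable_bounded:
  fixes f :: "'t \<Rightarrow> 'x::real_normed_vector dual"
  assumes f: "f \<in> measurable M weak_star_borel" and H: "integrable M H" and le: "AE t in M. norm (f t) \<le> H t"
  shows "gelfand_integrable M f"
  unfolding gelfand_integrable_def
proof
  fix x
  show "integrable M (\<lambda>t. f t x)"
  proof (rule Bochner_Integration.integrable_bound)
    show "integrable M (\<lambda>t. H t * norm x)" using H by simp
    show "AE t in M. norm (f t x) \<le> norm (H t * norm x)"
      using le
    proof eventually_elim
      fix t assume "norm (f t) \<le> H t"
      then have "norm (f t) * norm x \<le> H t * norm x" by (intro mult_right_mono) auto
      then show "norm (f t x) \<le> norm (H t * norm x)"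
        using norm_blinfun[of "f t" x] by auto
    qed
  qed (rule weak_star_borel_measurableD[OF f])
qed

lemma norm_gelfand_integral_le:
  fixes f :: "'t \<Rightarrow> 'x::banach dual"
  assumes f: "f \<in> measurable M weak_star_borel" and H: "integrable M H" and le: "AE t in M. norm (f t) \<le> H t"
  shows "norm (gelfand_integral M f) \<le> \<bar>\<integral>t. H t \<partial>M\<bar>"
proof (rule norm_blinfun_bound)
  fix x
  have int: "gelfand_integrable M f" by (rule gelfand_integrable_bounded[OF f H le])
  have "norm (blinfun_apply (gelfand_integral M f) x) \<le> (\<integral>t. \<bar>f t x\<bar> \<partial>M)"
    unfolding gelfand_integral_apply[OF int] real_norm_def by (rule integral_abs_bound)
  also have "\<dots> \<le> (\<integral>t. H t * norm x \<partial>M)"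
  proof (rule integral_mono_AE)
    show "integrable M (\<lambda>t. \<bar>f t x\<bar>)"
      using int unfolding gelfand_integrable_def by (intro integrable_abs) blast
    show "AE t in M. \<bar>f t x\<bar> \<le> H t * norm x"
      using le
    proof eventually_elim
      fix t assume "norm (f t) \<le> H t"
      then have "norm (f t) * norm x \<le> H t * norm x" by (intro mult_right_mono) auto
      then show "\<bar>f t x\<bar> \<le> H t * norm x" using norm_blinfun[of "f t" x] by auto
    qed
  qed (use H in simp)
  also have "\<dots> \<le> \<bar>\<integral>t. H t \<partial>M\<bar> * norm x" by (simp add: mult_right_mono)
  finally show "norm (blinfun_apply (gelfand_integral M f) x) \<le> \<bar>\<integral>t. H t \<partial>M\<bar> * norm x" .
qed simp

text \<open>Fatou's lemma before integrability at \<open>x\<close> is known: bounds at the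
  approximating points pass to \<open>x\<close>.\<close>

lemma nn_integral_dual_liminf:
  fixes f :: "'t \<Rightarrow> 'x::real_normed_vector dual"
  assumes [measurable]: "\<And>x. (\<lambda>t. f t x) \<in> borel_measurable M" and X: "X \<longlonglongrightarrow> x"
  shows "(\<integral>\<^sup>+t. ennreal \<bar>f t x\<bar> \<partial>M) \<le> liminf (\<lambda>n. \<integral>\<^sup>+t. ennreal \<bar>f t (X n)\<bar> \<partial>M)"
proof -
  have "ennreal \<bar>f t x\<bar> = liminf (\<lambda>n. ennreal \<bar>f t (X n)\<bar>)" for t
    using X by (intro lim_imp_Liminf[symmetric] tendsto_ennrealI tendsto_rabs blinfun.tendsto tendsto_const) auto
  then have "(\<integral>\<^sup>+t. ennreal \<bar>f t x\<bar> \<partial>M) = (\<integral>\<^sup>+t. liminf (\<lambda>n. ennreal \<bar>f t (X n)\<bar>) \<partial>M)" by simp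
  also have "\<dots> \<le> liminf (\<lambda>n. \<integral>\<^sup>+t. ennreal \<bar>f t (X n)\<bar> \<partial>M)" by (intro nn_integral_liminf) measurable
  finally show ?thesis .
qed

text \<open>By Fatou the mean absolute value is a lower semicontinuous seminorm in \<open>x\<close>,
  so it is bounded by a multiple of the norm. Bounds on mean absolute values, unlike bounds on the
  integrals themselves, can establish integrability of a new selection.\<close>

lemma gelfand_abs_bounded:
  fixes f :: "'t \<Rightarrow> 'x::banach dual"
  assumes f: "gelfand_integrable M f"
  obtains C where "\<And>x. (\<integral>t. \<bar>f t x\<bar> \<partial>M) \<le> C * norm x"
proof (rule seminorm_bounded[of "\<lambda>x. \<integral>t. \<bar>f t x\<bar> \<partial>M"])
  have int: "integrable M (\<lambda>t. \<bar>f t x\<bar>)" for x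
    using f unfolding gelfand_integrable_def by (intro integrable_abs) blast
  show "(\<integral>t. \<bar>blinfun_apply (f t) (x + y)\<bar> \<partial>M) \<le> (\<integral>t. \<bar>f t x\<bar> \<partial>M) + (\<integral>t. \<bar>f t y\<bar> \<partial>M)" for x y
    unfolding Bochner_Integration.integral_add[OF int int, symmetric]
    by (intro integral_mono int Bochner_Integration.integrable_add) (simp add: blinfun.add_right)
  show "(\<integral>t. \<bar>f t (r *\<^sub>R x)\<bar> \<partial>M) = \<bar>r\<bar> * (\<integral>t. \<bar>f t x\<bar> \<partial>M)" for r x
    by (simp add: blinfun.scaleR_right abs_mult)
  show "closed {x. (\<integral>t. \<bar>f t x\<bar> \<partial>M) \<le> c}" for c
    unfolding closed_sequential_limits
  proof (intro allI impI)
    fix X l assume X: "(\<forall>n. X n \<in> {x. (\<integral>t. \<bar>f t x\<bar> \<partial>M) \<le> c}) \<and> X \<longlonglongrightarrow> l"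
    have "0 \<le> (\<integral>t. \<bar>f t (X 0)\<bar> \<partial>M)" by simp
    also have "\<dots> \<le> c" using X by blast
    finally have c: "0 \<le> c" .
    have nn: "ennreal (\<integral>t. \<bar>f t x\<bar> \<partial>M) = (\<integral>\<^sup>+t. ennreal \<bar>f t x\<bar> \<partial>M)" for x
      by (intro nn_integral_eq_integral[symmetric] int) auto
    have "ennreal (\<integral>t. \<bar>f t l\<bar> \<partial>M) \<le> liminf (\<lambda>n. \<integral>\<^sup>+t. ennreal \<bar>f t (X n)\<bar> \<partial>M)"
      unfolding nn using X f
      by (intro nn_integral_dual_liminf) (auto simp: gelfand_integrable_def intro: borel_measurable_integrable)
    also have "\<dots> \<le> ennreal c"
      using X unfolding nn[symmetric]
      by (intro order_trans[OF Liminf_le_Limsup Limsup_bounded]) (auto intro!: ennreal_leI always_eventually)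
    finally show "l \<in> {x. (\<integral>t. \<bar>f t x\<bar> \<partial>M) \<le> c}" using c by simp
  qed
qed (rule that)

text \<open>For finite \<open>p\<close> the majorant comes from \<open>s \<le> 1 + s powr p\<close>
  with \<open>s \<ge> 0\<close>; nonnegativity of \<open>h\<close> is read off from a point of the
  nonempty value \<open>F t\<close>.\<close>

lemma integrably_bounded_dominated:
  fixes F :: "'t \<Rightarrow> 'x::real_normed_vector dual set"
  assumes "prob_space M" and p: "1 < p" and F: "correspondence (space M) F" and b: "integrably_bounded p M F"
  obtains H where "integrable M H" "AE t in M. \<forall>\<phi>\<in>F t. norm \<phi> \<le> H t"
proof -
  interpret prob_space M by fact
  obtain h where h[measurable]: "h \<in> borel_measurable M"
    and hp: "if p = \<infinity> then \<exists>C. AE t in M. \<bar>h t\<bar> \<le> C else integrable M (\<lambda>t. h t powr real_of_ereal p)"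
    and sup: "AE t in M. (SUP \<phi>\<in>F t. ereal (norm \<phi>)) \<le> ereal (h t)"
    using b unfolding integrably_bounded_def by blast
  have le: "AE t in M. \<forall>\<phi>\<in>F t. norm \<phi> \<le> h t"
    using sup by eventually_elim (auto simp: SUP_le_iff)
  have "integrable M h"
  proof (cases "p = \<infinity>")
    case True
    then obtain C where "AE t in M. \<bar>h t\<bar> \<le> C" using hp by auto
    then show ?thesis by (intro integrable_const_bound[where B = C]) auto
  next
    case False
    then have int: "integrable M (\<lambda>t. h t powr real_of_ereal p)" using hp by simp
    have p1: "1 \<le> real_of_ereal p" using p False by (cases p) (auto simp: one_ereal_def)
    show ?thesis
    proof (rule Bochner_Integration.integrable_bound)
      show "integrable M (\<lambda>t. 1 + h t powr real_of_ereal p)" using int by simp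
      show "AE t in M. norm (h t) \<le> norm (1 + h t powr real_of_ereal p)"
        using le AE_space
      proof eventually_elim
        fix t assume le: "\<forall>\<phi>\<in>F t. norm \<phi> \<le> h t" and "t \<in> space M"
        then obtain \<phi> where "\<phi> \<in> F t" using F unfolding correspondence_def by blast
        with le have h0: "0 \<le> h t" using norm_ge_zero order_trans by blast
        have "h t \<le> 1 + h t powr real_of_ereal p"
        proof (cases "h t \<le> 1")
          case True
          then show ?thesis by (simp add: add_increasing2)
        next
          case False
          then have "h t powr 1 \<le> h t powr real_of_ereal p" using p1 by (intro powr_mono) auto
          then show ?thesis using False by simp
        qed
        then show "norm (h t) \<le> norm (1 + h t powr real_of_ereal p)" using h0 by simp
      qed
    qed simp
  qed
  with le show thesis by (intro that)
qed

lemma convex_hull_weak_star_closure_approx: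
  fixes F :: "'x::real_normed_vector dual set"
  assumes \<psi>: "\<psi> \<in> weak_star closure_of (convex hull F)" and "finite X" "0 < \<epsilon>"
  obtains S u where "finite S" "S \<subseteq> F" "\<And>\<phi>. \<phi> \<in> S \<Longrightarrow> 0 \<le> u \<phi>" "sum u S = (1::real)"
    "\<And>x. x \<in> X \<Longrightarrow> \<bar>blinfun_apply \<psi> x - (\<Sum>\<phi>\<in>S. u \<phi> * blinfun_apply \<phi> x)\<bar> < \<epsilon>"
proof -
  define U where "U = weak_star_ball \<psi> X \<epsilon>"
  have "openin weak_star U" unfolding U_def by (rule openin_weak_star_ball) fact
  moreover have "\<psi> \<in> U" using \<open>0 < \<epsilon>\<close> by (simp add: U_def)
  ultimately have "\<exists>\<eta>. \<eta> \<in> convex hull F \<and> \<eta> \<in> U" using \<psi> by (simp add: in_closure_of)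
  then obtain \<eta> where \<eta>: "\<eta> \<in> convex hull F" "\<forall>x\<in>X. \<bar>blinfun_apply \<eta> x - blinfun_apply \<psi> x\<bar> < \<epsilon>"
    by (auto simp: U_def)
  obtain S u where S: "finite S" "S \<subseteq> F" "\<forall>\<phi>\<in>S. 0 \<le> u \<phi>" "sum u S = 1" "(\<Sum>\<phi>\<in>S. u \<phi> *\<^sub>R \<phi>) = \<eta>"
    using \<eta>(1) unfolding convex_hull_explicit by auto
  have "blinfun_apply \<eta> x = (\<Sum>\<phi>\<in>S. u \<phi> * blinfun_apply \<phi> x)" for x
    unfolding S(5)[symmetric] blinfun.sum_left blinfun.scaleR_left by simp
  with \<eta>(2) S show thesis by (intro that[of S u]) (auto simp: abs_minus_commute)
qed

lemma gelfand_integrals_mono: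
  assumes "\<And>t. F t \<subseteq> F' t"
  shows "gelfand_integrals M F \<subseteq> gelfand_integrals M F'"
proof -
  have "selection M F f \<Longrightarrow> selection M F' f" for f
    unfolding selection_def by (erule eventually_mono) (use assms in blast)
  then show ?thesis unfolding gelfand_integrals_def by blast
qed

lemma gelfand_integral_eqI:
  fixes f :: "'t \<Rightarrow> 'x::banach dual" and e :: "nat \<Rightarrow> 'x"
  assumes e: "dense_dirs e" and f: "gelfand_integrable M f"
    and eq: "\<And>k. (\<integral>t. f t (e k) \<partial>M) = blinfun_apply \<psi> (e k)"
  shows "gelfand_integral M f = \<psi>"
  by (rule blinfun_eq_on_dense_dirs[OF e]) (simp add: gelfand_integral_apply[OF f] eq)

section \<open>Existence of selections, closed convex hulls and convexity of the set of
  integrals\<close>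

context nowhere_equivalent_subalgebra
begin

text \<open>With no coordinates prescribed, one point of \<open>F t\<close> with weight 1 fulfils
  the approximation condition.\<close>

lemma exists_measurable_selection:
  fixes F :: "'t \<Rightarrow> 'x::banach dual set" and e :: "nat \<Rightarrow> 'x"
  assumes e: "dense_dirs e" and F: "correspondence (space M) F" "corr_measurable N F" "weak_star_compact_valued M F"
  obtains h where "h \<in> measurable M weak_star_borel" "AE t in M. h t \<in> F t"
proof -
  have approx: "AE t in M. \<forall>n. hull_approx e (F t) {} (\<lambda>_. 0) n"
    using AE_space
  proof (eventually_elim, intro allI)
    fix t n assume "t \<in> space M"
    then obtain \<phi> where "\<phi> \<in> F t" using F(1) unfolding correspondence_def by blast
    then show "hull_approx e (F t) {} (\<lambda>_. 0) n"
      by (intro exI[of _ "{\<phi>}"] exI[of _ "\<lambda>_. 1"]) auto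
  qed
  show thesis
    by (rule dual_selection[OF e F(2,3) _ approx]) (simp, rule that)
qed

text \<open>Even probes are linear, so on them a value in the closed hull is approximated by finite
  combinations from \<open>F t\<close>. The resulting selection of \<open>F\<close> has the same
  integrals at all directions, and the majorant \<open>H\<close> makes it Gelfand
  integrable.\<close>

lemma gelfand_integrals_convex_hull:
  fixes F :: "'t \<Rightarrow> 'x::banach dual set" and e :: "nat \<Rightarrow> 'x"
  assumes e: "dense_dirs e" and F: "corr_measurable N F" "weak_star_compact_valued M F"
    and H: "integrable M H" "AE t in M. \<forall>\<phi>\<in>F t. norm \<phi> \<le> H t"
  shows "gelfand_integrals M F = gelfand_integrals M (\<lambda>t. weak_star closure_of (convex hull F t))"
proof
  show "gelfand_integrals M F \<subseteq> gelfand_integrals M (\<lambda>t. weak_star closure_of (convex hull F t))"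
  proof (rule gelfand_integrals_mono)
    fix t
    have "F t \<subseteq> convex hull F t" by (rule hull_subset)
    also have "\<dots> \<subseteq> weak_star closure_of (convex hull F t)"
      by (rule closure_of_subset) (simp add: strong_operator_topology_topspace)
    finally show "F t \<subseteq> weak_star closure_of (convex hull F t)" .
  qed
  show "gelfand_integrals M (\<lambda>t. weak_star closure_of (convex hull F t)) \<subseteq> gelfand_integrals M F"
  proof
    fix \<psi> assume "\<psi> \<in> gelfand_integrals M (\<lambda>t. weak_star closure_of (convex hull F t))"
    then obtain f where f: "f \<in> measurable M weak_star_borel" "gelfand_integrable M f"
      and sel: "AE t in M. f t \<in> weak_star closure_of (convex hull F t)" and \<psi>: "\<psi> = gelfand_integral M f"
      unfolding gelfand_integrals_def selection_def by blast
    \<comment> \<open>Odd probes are left out: the absolute value at a point of the hull need not be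
      an average of absolute values over \<open>F t\<close>.\<close>
    define I :: "nat set" where "I = {k. even k}"
    have approx: "AE t in M. \<forall>n. hull_approx e (F t) I (\<lambda>k. probe e k (f t)) n"
      using sel
    proof (eventually_elim, intro allI)
      fix t n assume ft: "f t \<in> weak_star closure_of (convex hull F t)"
      obtain S u where S: "finite S" "S \<subseteq> F t" "\<And>\<phi>. \<phi> \<in> S \<Longrightarrow> 0 \<le> u \<phi>" "sum u S = (1::real)"
        and approx: "\<And>x. x \<in> (\<lambda>k. e (k div 2)) ` {..<n} \<Longrightarrow>
          \<bar>f t x - (\<Sum>\<phi>\<in>S. u \<phi> * blinfun_apply \<phi> x)\<bar> < 1 / real (Suc n)"
        by (rule convex_hull_weak_star_closure_approx[OF ft, of "(\<lambda>k. e (k div 2)) ` {..<n}" "1 / real (Suc n)"]) auto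
      show "hull_approx e (F t) I (\<lambda>k. probe e k (f t)) n"
        using S approx by (intro exI[of _ S] exI[of _ u]) (simp add: I_def probe_def)
    qed
    have f_m: "(\<lambda>t. probe e k (f t)) \<in> borel_measurable M" if "k \<in> I" for k
      using that weak_star_borel_measurableD[OF f(1), of "e (k div 2)"] by (simp add: I_def probe_def)
    obtain h where h: "h \<in> measurable M weak_star_borel" "AE t in M. h t \<in> F t"
      and h_int: "\<And>k. k \<in> I \<Longrightarrow> integrable M (\<lambda>t. probe e k (h t)) \<Longrightarrow> integrable M (\<lambda>t. probe e k (f t)) \<Longrightarrow>
       (\<integral>t. probe e k (h t) \<partial>M) = (\<integral>t. probe e k (f t) \<partial>M)"
      by (rule dual_selection[OF e F f_m approx]) blast+
    have h_le: "AE t in M. norm (h t) \<le> H t" using h(2) H(2) by eventually_elim blast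
    have hG: "gelfand_integrable M h" by (rule gelfand_integrable_bounded[OF h(1) H(1) h_le])
    have "gelfand_integral M h = \<psi>"
    proof (rule gelfand_integral_eqI[OF e hG])
      fix k
      show "(\<integral>t. h t (e k) \<partial>M) = blinfun_apply \<psi> (e k)"
        using h_int[of "2 * k"] hG f(2)
        by (simp add: I_def probe_def gelfand_integrable_def \<psi> gelfand_integral_apply[OF f(2)])
    qed
    then show "\<psi> \<in> gelfand_integrals M F"
      using h hG unfolding gelfand_integrals_def selection_def by blast
  qed
qed

text \<open>There is no integrable bound here, so integrability of the new selection has to be
  produced. Prescribing the averaged absolute values as well bounds it in mean along the directions,
  and Fatou extends the bound to every \<open>x\<close>.\<close>

lemma convex_gelfand_integrals:
  fixes F :: "'t \<Rightarrow> 'x::banach dual set" and e :: "nat \<Rightarrow> 'x"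
  assumes e: "dense_dirs e" and F: "corr_measurable N F" "weak_star_compact_valued M F"
  shows "convex (gelfand_integrals M F)"
proof (rule convexI)
  fix \<psi>1 \<psi>2 and a b :: real
  assume \<psi>: "\<psi>1 \<in> gelfand_integrals M F" "\<psi>2 \<in> gelfand_integrals M F" and ab: "0 \<le> a" "0 \<le> b" "a + b = 1"
  obtain f1 where f1: "f1 \<in> measurable M weak_star_borel" "gelfand_integrable M f1" "AE t in M. f1 t \<in> F t"
    and \<psi>1: "\<psi>1 = gelfand_integral M f1"
    using \<psi>(1) unfolding gelfand_integrals_def selection_def by blast
  obtain f2 where f2: "f2 \<in> measurable M weak_star_borel" "gelfand_integrable M f2" "AE t in M. f2 t \<in> F t"
    and \<psi>2: "\<psi>2 = gelfand_integral M f2"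
    using \<psi>(2) unfolding gelfand_integrals_def selection_def by blast
  \<comment> \<open>For odd \<open>k\<close> this averages the two absolute values instead of taking
    the absolute value of the average; thus \<open>f1 t\<close> and \<open>f2 t\<close> with weights
    \<open>a\<close> and \<open>b\<close> match all coordinates exactly.\<close>
  define g where "g k t = a * probe e k (f1 t) + b * probe e k (f2 t)" for k t
  have probe_m: "(\<lambda>t. probe e k (f t)) \<in> borel_measurable M" if "f \<in> measurable M weak_star_borel" for f k
    using weak_star_borel_measurableD[OF that, of "e (k div 2)"] by (cases "even k") (auto simp: probe_def)
  have g_m: "g k \<in> borel_measurable M" for k
    using probe_m[OF f1(1), of k] probe_m[OF f2(1), of k] unfolding g_def by measurable
  have approx: "AE t in M. \<forall>n. hull_approx e (F t) UNIV (\<lambda>k. g k t) n"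
    using f1(3) f2(3)
  proof (eventually_elim, intro allI)
    fix t n assume t: "f1 t \<in> F t" "f2 t \<in> F t"
    \<comment> \<open>The two weights add up if the selections coincide at \<open>t\<close>.\<close>
    define u where "u \<phi> = (if \<phi> = f1 t then a else 0) + (if \<phi> = f2 t then b else 0)" for \<phi>
    have *: "(\<Sum>\<phi>\<in>{f1 t, f2 t}. u \<phi> * z \<phi>) = a * z (f1 t) + b * z (f2 t)" for z :: "_ \<Rightarrow> real"
      by (cases "f1 t = f2 t") (auto simp: u_def algebra_simps)
    have "sum u {f1 t, f2 t} = 1" using *[of "\<lambda>_. 1"] ab(3) by simp
    moreover have "0 \<le> u \<phi>" for \<phi> using ab by (simp add: u_def)
    moreover have "\<bar>g k t - (\<Sum>\<phi>\<in>{f1 t, f2 t}. u \<phi> * probe e k \<phi>)\<bar> < 1 / real (Suc n)" for k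
      unfolding * by (simp add: g_def)
    ultimately show "hull_approx e (F t) UNIV (\<lambda>k. g k t) n"
      using t by (intro exI[of _ "{f1 t, f2 t}"] exI[of _ u] conjI) auto
  qed
  obtain h where h: "h \<in> measurable M weak_star_borel" "AE t in M. h t \<in> F t"
    and h_int: "\<And>k. k \<in> UNIV \<Longrightarrow> integrable M (\<lambda>t. probe e k (h t)) \<Longrightarrow> integrable M (g k) \<Longrightarrow>
       (\<integral>t. probe e k (h t) \<partial>M) = (\<integral>t. g k t \<partial>M)"
    and h_nn: "\<And>k. k \<in> UNIV \<Longrightarrow> odd k \<Longrightarrow> AE t in M. 0 \<le> g k t \<Longrightarrow>
       (\<integral>\<^sup>+t. ennreal (probe e k (h t)) \<partial>M) = (\<integral>\<^sup>+t. ennreal (g k t) \<partial>M)"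
    by (rule dual_selection[OF e F g_m approx]) blast
  note hm[measurable] = weak_star_borel_measurableD[OF h(1)]
  have i1: "integrable M (\<lambda>t. f1 t x)" and i2: "integrable M (\<lambda>t. f2 t x)" for x
    using f1(2) f2(2) unfolding gelfand_integrable_def by blast+
  obtain C1 where C1: "\<And>x. (\<integral>t. \<bar>f1 t x\<bar> \<partial>M) \<le> C1 * norm x"
    by (rule gelfand_abs_bounded[OF f1(2)]) blast
  obtain C2 where C2: "\<And>x. (\<integral>t. \<bar>f2 t x\<bar> \<partial>M) \<le> C2 * norm x"
    by (rule gelfand_abs_bounded[OF f2(2)]) blast
  define C where "C = a * C1 + b * C2"
  \<comment> \<open>The bound must be proportional to \<open>norm (e k)\<close>: in approximations
    of \<open>x\<close> the scalars \<open>r n\<close> may be unbounded, while the norms of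
    \<open>r n *\<^sub>R e (k n)\<close> converge.\<close>
  have h_ek: "(\<integral>\<^sup>+t. ennreal \<bar>h t (e k)\<bar> \<partial>M) \<le> ennreal (C * norm (e k))" for k
  proof -
    have "(\<integral>\<^sup>+t. ennreal \<bar>h t (e k)\<bar> \<partial>M)
        = (\<integral>\<^sup>+t. ennreal (a * \<bar>f1 t (e k)\<bar> + b * \<bar>f2 t (e k)\<bar>) \<partial>M)"
      using h_nn[of "Suc (2 * k)"] ab by (simp add: probe_def g_def)
    also have "\<dots> = ennreal (\<integral>t. a * \<bar>f1 t (e k)\<bar> + b * \<bar>f2 t (e k)\<bar> \<partial>M)"
      using i1 i2 ab by (intro nn_integral_eq_integral) auto
    also have "\<dots> \<le> ennreal (C * norm (e k))"
    proof (rule ennreal_leI)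
      have "(\<integral>t. a * \<bar>f1 t (e k)\<bar> + b * \<bar>f2 t (e k)\<bar> \<partial>M)
          = a * (\<integral>t. \<bar>f1 t (e k)\<bar> \<partial>M) + b * (\<integral>t. \<bar>f2 t (e k)\<bar> \<partial>M)"
        using i1 i2 by simp
      also have "\<dots> \<le> a * (C1 * norm (e k)) + b * (C2 * norm (e k))"
        using C1 C2 ab by (intro add_mono mult_left_mono) auto
      finally show "(\<integral>t. a * \<bar>f1 t (e k)\<bar> + b * \<bar>f2 t (e k)\<bar> \<partial>M) \<le> C * norm (e k)"
        by (simp add: C_def algebra_simps)
    qed
    finally show ?thesis .
  qed
  have hG: "gelfand_integrable M h"
    unfolding gelfand_integrable_def
  proof
    fix x
    obtain k r where x: "(\<lambda>n. r n *\<^sub>R e (k n)) \<longlonglongrightarrow> x" using dense_dirs_tendsto[OF e] .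
    have "(\<integral>\<^sup>+t. ennreal (norm (h t x)) \<partial>M)
        \<le> liminf (\<lambda>n. \<integral>\<^sup>+t. ennreal \<bar>h t (r n *\<^sub>R e (k n))\<bar> \<partial>M)"
      unfolding real_norm_def by (rule nn_integral_dual_liminf[OF hm x])
    also have "\<dots> \<le> liminf (\<lambda>n. ennreal (C * norm (r n *\<^sub>R e (k n))))"
    proof (intro Liminf_mono always_eventually allI)
      fix n
      have "(\<integral>\<^sup>+t. ennreal \<bar>h t (r n *\<^sub>R e (k n))\<bar> \<partial>M)
          = (\<integral>\<^sup>+t. ennreal \<bar>r n\<bar> * ennreal \<bar>h t (e (k n))\<bar> \<partial>M)"
        by (intro nn_integral_cong) (simp add: blinfun.scaleR_right abs_mult ennreal_mult)
      also have "\<dots> = ennreal \<bar>r n\<bar> * (\<integral>\<^sup>+t. ennreal \<bar>h t (e (k n))\<bar> \<partial>M)"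
        by (intro nn_integral_cmult) measurable
      also have "\<dots> \<le> ennreal \<bar>r n\<bar> * ennreal (C * norm (e (k n)))"
        by (intro mult_left_mono h_ek) simp
      also have "\<dots> = ennreal (C * norm (r n *\<^sub>R e (k n)))"
        by (simp add: ennreal_mult'[symmetric] mult.left_commute)
      finally show "(\<integral>\<^sup>+t. ennreal \<bar>h t (r n *\<^sub>R e (k n))\<bar> \<partial>M) \<le> ennreal (C * norm (r n *\<^sub>R e (k n)))" .
    qed
    also have "\<dots> = ennreal (C * norm x)"
      using tendsto_ennrealI[OF tendsto_mult_left[OF tendsto_norm[OF x], of C]]
      by (intro lim_imp_Liminf) auto
    also have "\<dots> < \<infinity>" by simp
    finally show "integrable M (\<lambda>t. h t x)"
      by (intro integrableI_bounded) auto
  qed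
  have "gelfand_integral M h = a *\<^sub>R \<psi>1 + b *\<^sub>R \<psi>2"
  proof (rule gelfand_integral_eqI[OF e hG])
    fix k
    have "integrable M (g (2 * k))" using i1 i2 by (simp add: g_def[abs_def] probe_def)
    then show "(\<integral>t. h t (e k) \<partial>M) = blinfun_apply (a *\<^sub>R \<psi>1 + b *\<^sub>R \<psi>2) (e k)"
      using h_int[of "2 * k"] hG i1 i2
      by (simp add: probe_def g_def gelfand_integrable_def \<psi>1 \<psi>2 gelfand_integral_apply[OF f1(2)]
          gelfand_integral_apply[OF f2(2)] blinfun.add_left blinfun.scaleR_left)
  qed
  then show "a *\<^sub>R \<psi>1 + b *\<^sub>R \<psi>2 \<in> gelfand_integrals M F"
    using h hG unfolding gelfand_integrals_def selection_def mem_Collect_eq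
    by (intro exI[of _ h]) auto
qed

end

section \<open>Weak-star limits of integrals: closedness, compactness and upper
  hemicontinuity\<close>

lemma tail_average_in_closure_hull:
  fixes f :: "nat \<Rightarrow> 'x::real_normed_vector dual" and \<psi> :: "'x dual"
  assumes J: "\<And>n. finite (J n)" "\<And>n. J n \<subseteq> {n..}" and w: "\<And>n j. 0 \<le> w n j" "\<And>n. sum (w n) (J n) = 1"
    and f: "\<And>W. openin weak_star W \<Longrightarrow> F \<subseteq> W \<Longrightarrow> \<forall>\<^sub>F n in sequentially. f n \<in> W"
    and lim: "\<And>x. (\<lambda>n. \<Sum>j\<in>J n. w n j * blinfun_apply (f j) x) \<longlonglongrightarrow> blinfun_apply \<psi> x"
  shows "\<psi> \<in> weak_star closure_of (convex hull F)"
  unfolding in_closure_of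
proof (intro conjI allI impI)
  show "\<psi> \<in> topspace weak_star" by (simp add: strong_operator_topology_topspace)
  fix U assume U: "\<psi> \<in> U \<and> openin weak_star U"
  obtain X \<epsilon> where X: "finite X" "0 < \<epsilon>"
    and sub: "weak_star_ball \<psi> X \<epsilon> \<subseteq> U"
    by (rule weak_star_nbhd[of U \<psi>]) (use U in auto)
  \<comment> \<open>The assumption on \<open>f\<close> concerns only open supersets of
    \<open>F\<close>. Membership in this one means being within \<open>\<epsilon> / 2\<close> of a
    point of \<open>F\<close> on the finite set \<open>X\<close>, so in a late tail average every
    \<open>f j\<close> can be exchanged for a point of \<open>F\<close>; the other half of
    \<open>\<epsilon>\<close> pays for the distance to \<open>\<psi>\<close>.\<close>
  define W where "W = (\<Union>\<psi>\<in>F. weak_star_ball \<psi> X (\<epsilon> / 2))"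
  have "openin weak_star W"
    unfolding W_def by (rule openin_Union, erule imageE, hypsubst, rule openin_weak_star_ball[OF X(1)])
  moreover have "F \<subseteq> W" using X(2) by (auto simp: W_def intro!: bexI)
  ultimately have "\<forall>\<^sub>F n in sequentially. f n \<in> W" by (rule f)
  then obtain n0 where n0: "\<forall>n\<ge>n0. f n \<in> W" unfolding eventually_sequentially by blast
  have "\<forall>\<^sub>F n in sequentially. \<forall>x\<in>X. \<bar>(\<Sum>j\<in>J n. w n j * blinfun_apply (f j) x) - blinfun_apply \<psi> x\<bar> < \<epsilon> / 2"
    using X tendstoD[OF lim, of "\<epsilon> / 2"] by (intro eventually_ball_finite) (auto simp: dist_real_def)
  then obtain n1 where n1: "\<forall>n\<ge>n1. \<forall>x\<in>X. \<bar>(\<Sum>j\<in>J n. w n j * blinfun_apply (f j) x) - blinfun_apply \<psi> x\<bar> < \<epsilon> / 2"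
    unfolding eventually_sequentially by blast
  define n where "n = max n0 n1"
  have "\<forall>j. \<exists>\<phi>. j \<in> J n \<longrightarrow> \<phi> \<in> F \<and> (\<forall>x\<in>X. \<bar>blinfun_apply (f j) x - blinfun_apply \<phi> x\<bar> < \<epsilon> / 2)"
  proof
    fix j
    show "\<exists>\<phi>. j \<in> J n \<longrightarrow> \<phi> \<in> F \<and> (\<forall>x\<in>X. \<bar>blinfun_apply (f j) x - blinfun_apply \<phi> x\<bar> < \<epsilon> / 2)"
    proof (cases "j \<in> J n")
      case True
      then have "n0 \<le> j" using J(2)[of n] by (auto simp: n_def)
      then have "f j \<in> W" using n0 by blast
      then show ?thesis by (auto simp: W_def)
    qed simp
  qed
  then obtain \<phi> where "\<forall>j. j \<in> J n \<longrightarrow> \<phi> j \<in> F \<and> (\<forall>x\<in>X. \<bar>blinfun_apply (f j) x - blinfun_apply (\<phi> j) x\<bar> < \<epsilon> / 2)"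
    by (rule choice[THEN exE])
  then have \<phi>F: "\<And>j. j \<in> J n \<Longrightarrow> \<phi> j \<in> F"
    and \<phi>: "\<And>j x. j \<in> J n \<Longrightarrow> x \<in> X \<Longrightarrow> \<bar>blinfun_apply (f j) x - blinfun_apply (\<phi> j) x\<bar> < \<epsilon> / 2"
    by auto
  define \<eta> where "\<eta> = (\<Sum>j\<in>J n. w n j *\<^sub>R \<phi> j)"
  have "\<eta> \<in> convex hull F"
    unfolding \<eta>_def using J(1) w \<phi>F
    by (intro convex_sum convex_convex_hull) (auto intro: hull_inc)
  moreover have "\<bar>blinfun_apply \<eta> x - blinfun_apply \<psi> x\<bar> < \<epsilon>" if x: "x \<in> X" for x
  proof -
    have "blinfun_apply \<eta> x - (\<Sum>j\<in>J n. w n j * blinfun_apply (f j) x)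
        = (\<Sum>j\<in>J n. w n j * (blinfun_apply (\<phi> j) x - blinfun_apply (f j) x))"
      by (simp add: \<eta>_def blinfun.sum_left blinfun.scaleR_left right_diff_distrib sum_subtractf)
    also have "\<bar>\<dots>\<bar> \<le> \<epsilon> / 2"
      using \<phi>[OF _ x] by (intro abs_convex_combination_le w) (simp add: abs_minus_commute less_imp_le)
    finally have 1: "\<bar>blinfun_apply \<eta> x - (\<Sum>j\<in>J n. w n j * blinfun_apply (f j) x)\<bar> \<le> \<epsilon> / 2" .
    have "\<bar>(\<Sum>j\<in>J n. w n j * blinfun_apply (f j) x) - blinfun_apply \<psi> x\<bar> < \<epsilon> / 2"
      using n1 x by (simp add: n_def)
    with 1 show ?thesis by linarith
  qed
  ultimately show "\<exists>y. y \<in> convex hull F \<and> y \<in> U" using sub by blast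
qed

text \<open>Convex combinations of tails of the selections converge weak-star almost everywhere to
  some \<open>g\<close> with values in the closed hull, and dominated convergence identifies the
  integral of \<open>g\<close> with \<open>\<zeta>\<close>. The assumption through open sets
  \<open>W\<close> covers both a fixed correspondence and selections of values that approach
  \<open>F t\<close> only upper hemicontinuously.\<close>

lemma gelfand_integrals_closure:
  fixes f :: "nat \<Rightarrow> 't \<Rightarrow> 'x::banach dual" and e :: "nat \<Rightarrow> 'x" and F :: "'t \<Rightarrow> 'x dual set" and \<zeta> :: "'x dual"
  assumes "prob_space M" and e: "dense_dirs e"
    and f: "\<And>n. f n \<in> measurable M weak_star_borel"
    and H: "integrable M H" and le: "\<And>n. AE t in M. norm (f n t) \<le> H t"
    and W: "AE t in M. \<forall>W. openin weak_star W \<and> F t \<subseteq> W \<longrightarrow> (\<forall>\<^sub>F n in sequentially. f n t \<in> W)"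
    and lim: "\<And>x. (\<lambda>n. gelfand_integral M (f n) x) \<longlonglongrightarrow> blinfun_apply \<zeta> x"
  shows "\<zeta> \<in> gelfand_integrals M (\<lambda>t. weak_star closure_of (convex hull F t))"
proof -
  interpret prob_space M by fact
  note fm[measurable] = weak_star_borel_measurableD[OF f]
  note Hm[measurable] = borel_measurable_integrable[OF H]
  \<comment> \<open>Adding 1 keeps the divisor positive in the normalisation below.\<close>
  define B where "B t = 1 + \<bar>H t\<bar>" for t
  have Bm[measurable]: "B \<in> borel_measurable M" unfolding B_def by measurable
  have B0: "0 < B t" for t by (simp add: B_def add_pos_nonneg)
  have B_int: "integrable M B" unfolding B_def using H by simp
  have leB: "AE t in M. \<forall>n. norm (f n t) \<le> B t"
  proof -
    have "AE t in M. \<forall>n. norm (f n t) \<le> H t" using le by (simp add: AE_all_countable)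
    then show ?thesis
    proof eventually_elim
      fix t assume *: "\<forall>n. norm (f n t) \<le> H t"
      have "H t \<le> B t" by (simp add: B_def)
      with * show "\<forall>n. norm (f n t) \<le> B t" using order_trans by blast
    qed
  qed
  \<comment> \<open>The bound by 1 is demanded everywhere but known only almost everywhere; the
    cut-off supplies it and changes nothing where the norms are at most \<open>B t\<close>.\<close>
  define u where "u n k t = (let z = f n t (e k) / B t in if \<bar>z\<bar> \<le> 1 then z else 0)" for n k t
  have um: "u n k \<in> borel_measurable M" for n k unfolding u_def Let_def by measurable
  obtain J w where J: "\<And>n. finite (J n)" "\<And>n. J n \<subseteq> {n..}" and w: "\<And>n j. 0 \<le> w n j" "\<And>n. sum (w n) (J n) = 1"
    and conv: "AE t in M. \<forall>k. convergent (\<lambda>n. \<Sum>j\<in>J n. w n j * u j k t)"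
  proof (rule convex_combinations_converge_AE_family[of M u])
    show "prob_space M" by fact
    show "\<bar>u n k t\<bar> \<le> 1" for n k t by (simp add: u_def Let_def)
  qed (auto intro: um)
  define G where "G n t = (\<Sum>j\<in>J n. w n j *\<^sub>R f j t)" for n t
  have G_apply: "G n t x = (\<Sum>j\<in>J n. w n j * f j t x)" for n t x
    by (simp add: G_def blinfun.sum_left blinfun.scaleR_left)
  have Gm[measurable]: "(\<lambda>t. G n t x) \<in> borel_measurable M" for n x
    unfolding G_apply by measurable
  have G_le: "norm (G n t) \<le> B t" if "\<forall>n. norm (f n t) \<le> B t" for n t
  proof -
    have "norm (G n t) \<le> (\<Sum>j\<in>J n. w n j * B t)"
      unfolding G_def
    proof (rule order_trans[OF norm_sum], rule sum_mono)
      fix j show "norm (w n j *\<^sub>R f j t) \<le> w n j * B t"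
        using mult_left_mono[OF that[rule_format, of j] w(1)] w(1) by simp
    qed
    then show ?thesis unfolding sum_distrib_right[symmetric] w(2) by simp
  qed
  let ?lim = "\<lambda>t \<psi>. norm \<psi> \<le> B t \<and> (\<forall>x. (\<lambda>n. blinfun_apply (G n t) x) \<longlonglongrightarrow> blinfun_apply \<psi> x)"
  have "AE t in M. \<exists>\<psi>. ?lim t \<psi>"
    using conv leB
  proof eventually_elim
    fix t assume conv: "\<forall>k. convergent (\<lambda>n. \<Sum>j\<in>J n. w n j * u j k t)" and leB: "\<forall>n. norm (f n t) \<le> B t"
    have "convergent (\<lambda>n. G n t (e k))" for k
    proof -
      have u_eq: "u j k t = f j t (e k) / B t" for j
      proof -
        have "\<bar>f j t (e k)\<bar> \<le> norm (f j t) * norm (e k)" using norm_blinfun[of "f j t" "e k"] by simp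
        also have "\<dots> \<le> norm (f j t)"
          using e by (intro mult_left_le) (auto simp: dense_dirs_def)
        also have "\<dots> \<le> B t" using leB by blast
        finally have "\<bar>f j t (e k) / B t\<bar> \<le> 1" using B0[of t] by (simp add: abs_divide)
        then show ?thesis by (simp add: u_def)
      qed
      have "convergent (\<lambda>n. B t * (\<Sum>j\<in>J n. w n j * u j k t))"
        using conv by (intro convergent_mult convergent_const) blast
      moreover have "B t * (\<Sum>j\<in>J n. w n j * u j k t) = G n t (e k)" for n
        unfolding G_apply u_eq sum_distrib_left using B0[of t] by (intro sum.cong) auto
      ultimately show ?thesis by simp
    qed
    from bounded_dual_limit[of e "\<lambda>n. G n t", OF e G_le[OF leB] this]
    show "\<exists>\<psi>. ?lim t \<psi>" by metis
  qed
  then obtain Z where Z: "\<And>t. t \<in> space M - Z \<Longrightarrow> \<exists>\<psi>. ?lim t \<psi>"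
    and ZM: "Z \<in> null_sets M"
    by (rule AE_E3) blast
  note [measurable] = null_setsD2[OF ZM]
  \<comment> \<open>The limit is chosen pointwise; measurability follows because its values at
    directions are limits of measurable functions.\<close>
  define g where "g t = (if t \<in> space M - Z then SOME \<psi>. ?lim t \<psi> else 0)" for t
  have g: "?lim t (g t)" if "t \<in> space M - Z" for t
    unfolding g_def if_P[OF that] by (rule someI_ex[OF Z[OF that]])
  have AE_Z: "AE t in M. t \<in> space M - Z" using AE_not_in[OF ZM] AE_space by eventually_elim auto
  have gm: "g \<in> measurable M weak_star_borel"
  proof (rule weak_star_borel_measurableI[OF e])
    fix k
    have "g t (e k) = (if t \<in> Z then 0 else lim (\<lambda>n. G n t (e k)))" if "t \<in> space M" for t
    proof (cases "t \<in> Z")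
      case False
      then have "(\<lambda>n. G n t (e k)) \<longlonglongrightarrow> g t (e k)" using g[of t] that by blast
      from limI[OF this] False show ?thesis by simp
    qed (simp add: g_def)
    then show "(\<lambda>t. g t (e k)) \<in> borel_measurable M"
      by (subst measurable_cong) measurable
  qed
  have g_le: "AE t in M. norm (g t) \<le> B t" using AE_Z by eventually_elim (use g in blast)
  have gG: "gelfand_integrable M g" by (rule gelfand_integrable_bounded[OF gm B_int g_le])
  have f_int: "gelfand_integrable M (f n)" for n by (rule gelfand_integrable_bounded[OF f H le])
  have "gelfand_integral M g = \<zeta>"
  proof (rule blinfun_eqI)
    fix x
    have "(\<lambda>n. \<integral>t. G n t x \<partial>M) \<longlonglongrightarrow> (\<integral>t. g t x \<partial>M)"
    proof (rule integral_dominated_convergence)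
      show "integrable M (\<lambda>t. B t * norm x)" using B_int by simp
      show "AE t in M. (\<lambda>n. G n t x) \<longlonglongrightarrow> g t x"
        using AE_Z by eventually_elim (use g in blast)
      show "AE t in M. norm (G n t x) \<le> B t * norm x" for n
        using leB
      proof eventually_elim
        fix t assume "\<forall>n. norm (f n t) \<le> B t"
        from mult_right_mono[OF G_le[OF this] norm_ge_zero]
        show "norm (G n t x) \<le> B t * norm x"
          using norm_blinfun order_trans by blast
      qed
    qed (use weak_star_borel_measurableD[OF gm] Gm in auto)
    moreover have "(\<integral>t. G n t x \<partial>M) = (\<Sum>j\<in>J n. w n j * gelfand_integral M (f j) x)" for n
      unfolding G_apply gelfand_integral_apply[OF f_int]
      using f_int by (subst Bochner_Integration.integral_sum) (auto simp: gelfand_integrable_def)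
    ultimately have "(\<lambda>n. \<Sum>j\<in>J n. w n j * gelfand_integral M (f j) x) \<longlonglongrightarrow> (\<integral>t. g t x \<partial>M)"
      by simp
    from LIMSEQ_unique[OF this tail_average_tendsto[OF lim J(2) w]]
    show "blinfun_apply (gelfand_integral M g) x = blinfun_apply \<zeta> x"
      by (simp add: gelfand_integral_apply[OF gG])
  qed
  moreover have "AE t in M. g t \<in> weak_star closure_of (convex hull F t)"
    using AE_Z W
  proof eventually_elim
    fix t assume t: "t \<in> space M - Z"
      and W: "\<forall>W. openin weak_star W \<and> F t \<subseteq> W \<longrightarrow> (\<forall>\<^sub>F n in sequentially. f n t \<in> W)"
    show "g t \<in> weak_star closure_of (convex hull F t)"
    proof (rule tail_average_in_closure_hull[OF J w])
      show "(\<lambda>n. \<Sum>j\<in>J n. w n j * f j t x) \<longlonglongrightarrow> g t x" for x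
        using g[OF t] unfolding G_apply by blast
    qed (use W in blast)
  qed
  ultimately show ?thesis
    using gm gG unfolding gelfand_integrals_def selection_def mem_Collect_eq
    by (intro exI[of _ g]) auto
qed

context nowhere_equivalent_subalgebra
begin

text \<open>The majorant bounds the integrals in norm, so sequential closedness is enough. A limit
  is at first the integral of a selection of the closed hull only, but the hull has the same
  integrals as \<open>F\<close>.\<close>

lemma compactin_gelfand_integrals:
  fixes F :: "'t \<Rightarrow> 'x::banach dual set" and e :: "nat \<Rightarrow> 'x"
  assumes e: "dense_dirs e" and F: "corr_measurable N F" "weak_star_compact_valued M F"
    and H: "integrable M H" "AE t in M. \<forall>\<phi>\<in>F t. norm \<phi> \<le> H t"
  shows "compactin weak_star (gelfand_integrals M F)"
proof (rule compactin_weak_star[OF e])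
  have sel_le: "AE t in M. norm (f t) \<le> H t" if "selection M F f" for f
    using that H(2) unfolding selection_def by eventually_elim blast
  show "norm \<phi> \<le> \<bar>\<integral>t. H t \<partial>M\<bar>" if \<phi>: "\<phi> \<in> gelfand_integrals M F" for \<phi>
  proof -
    obtain f where "f \<in> measurable M weak_star_borel" "selection M F f" "\<phi> = gelfand_integral M f"
      using \<phi> unfolding gelfand_integrals_def by blast
    then show ?thesis using norm_gelfand_integral_le[OF _ H(1) sel_le] by simp
  qed
  fix \<phi> :: "nat \<Rightarrow> 'x dual" and \<psi> :: "'x dual"
  assume \<phi>: "\<And>n. \<phi> n \<in> gelfand_integrals M F"
    and lim: "\<And>x. (\<lambda>n. blinfun_apply (\<phi> n) x) \<longlonglongrightarrow> blinfun_apply \<psi> x"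
  have "\<forall>n. \<exists>f. f \<in> measurable M weak_star_borel \<and> selection M F f \<and> \<phi> n = gelfand_integral M f"
    using \<phi> unfolding gelfand_integrals_def by blast
  then obtain f where "\<forall>n. f n \<in> measurable M weak_star_borel \<and> selection M F (f n) \<and> \<phi> n = gelfand_integral M (f n)"
    by (rule choice[THEN exE])
  then have f: "\<And>n. f n \<in> measurable M weak_star_borel" and sel: "\<And>n. selection M F (f n)"
    and \<phi>f: "\<And>n. \<phi> n = gelfand_integral M (f n)" by auto
  have "AE t in M. \<forall>n. f n t \<in> F t" using sel by (simp add: selection_def AE_all_countable)
  then have W: "AE t in M. \<forall>W. openin weak_star W \<and> F t \<subseteq> W \<longrightarrow> (\<forall>\<^sub>F n in sequentially. f n t \<in> W)"
    by eventually_elim (auto intro!: always_eventually)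
  show "\<psi> \<in> gelfand_integrals M F"
    unfolding gelfand_integrals_convex_hull[OF e F H]
    by (rule gelfand_integrals_closure[OF prob_space_axioms e f H(1) sel_le[OF sel] W])
      (use lim in \<open>simp add: \<phi>f\<close>)
qed

text \<open>If it failed at \<open>y0\<close>, integrals outside \<open>V\<close> would occur for
  parameters tending to \<open>y0\<close>. Being norm bounded, they have a weak-star convergent
  subsequence, and its limit belongs to the integrals at \<open>y0\<close> although it lies outside
  \<open>V\<close>.\<close>

lemma upper_hemicontinuous_gelfand_integrals:
  fixes F :: "'t \<times> 'y \<Rightarrow> 'x::banach dual set" and e :: "nat \<Rightarrow> 'x"
  assumes e: "dense_dirs e" and H: "integrable M H" "AE t in M. \<forall>\<phi>\<in>G t. norm \<phi> \<le> H t"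
    and G: "weak_star_compact_valued M G" and "Metric_space Y d"
    and corr: "correspondence (space M \<times> Y) F"
    and closed: "\<And>y. y \<in> Y \<Longrightarrow> weak_star_closed_valued M (\<lambda>t. F (t, y))"
    and FG: "\<And>y. y \<in> Y \<Longrightarrow> AE t in M. F (t, y) \<subseteq> G t"
    and meas: "\<And>y. y \<in> Y \<Longrightarrow> corr_measurable N (\<lambda>t. F (t, y))"
    and uhc: "\<And>t. t \<in> space M \<Longrightarrow> upper_hemicontinuous (Metric_space.mtopology Y d) weak_star (\<lambda>y. F (t, y))"
  shows "upper_hemicontinuous (Metric_space.mtopology Y d) weak_star (\<lambda>y. gelfand_integrals M (\<lambda>t. F (t, y)))"
proof -
  interpret Y: Metric_space Y d by fact
  have comp: "weak_star_compact_valued M (\<lambda>t. F (t, y))" if "y \<in> Y" for y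
    using G closed[OF that] FG[OF that]
    unfolding weak_star_compact_valued_def weak_star_closed_valued_def
    by eventually_elim (rule closed_compactin)
  have FH: "AE t in M. \<forall>\<phi>\<in>F (t, y). norm \<phi> \<le> H t" if "y \<in> Y" for y
    using H(2) FG[OF that] by eventually_elim blast
  have sel_le: "AE t in M. norm (f t) \<le> H t" if "y \<in> Y" "selection M (\<lambda>t. F (t, y)) f" for y f
    using that(2) FH[OF that(1)] unfolding selection_def by eventually_elim blast
  have nonempty: "gelfand_integrals M (\<lambda>t. F (t, y)) \<noteq> {}" if y: "y \<in> Y" for y
  proof -
    have "correspondence (space M) (\<lambda>t. F (t, y))" using corr y by (auto simp: correspondence_def)
    then obtain h where h: "h \<in> measurable M weak_star_borel" "AE t in M. h t \<in> F (t, y)"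
      by (rule exists_measurable_selection[OF e _ meas[OF y] comp[OF y]])
    then have "selection M (\<lambda>t. F (t, y)) h" by (simp add: selection_def)
    with h(1) gelfand_integrable_bounded[OF h(1) H(1) sel_le[OF y this]]
    show ?thesis unfolding gelfand_integrals_def by blast
  qed
  have key: "\<exists>U. openin Y.mtopology U \<and> y0 \<in> U \<and> (\<forall>y\<in>U. gelfand_integrals M (\<lambda>t. F (t, y)) \<subseteq> V)"
    if y0: "y0 \<in> Y" and V: "openin weak_star V" "gelfand_integrals M (\<lambda>t. F (t, y0)) \<subseteq> V" for y0 V
  proof (rule ccontr)
    assume no: "\<nexists>U. openin Y.mtopology U \<and> y0 \<in> U \<and> (\<forall>y\<in>U. gelfand_integrals M (\<lambda>t. F (t, y)) \<subseteq> V)"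
    \<comment> \<open>Parameter and selection are paired so that one choice supplies both
      sequences.\<close>
    have "\<exists>p. fst p \<in> Y.mball y0 (inverse (real (Suc n))) \<and> snd p \<in> measurable M weak_star_borel \<and>
        selection M (\<lambda>t. F (t, fst p)) (snd p) \<and> gelfand_integral M (snd p) \<notin> V" for n
    proof -
      have "openin Y.mtopology (Y.mball y0 (inverse (real (Suc n))))" "y0 \<in> Y.mball y0 (inverse (real (Suc n)))"
        using y0 by (auto simp del: of_nat_Suc)
      then have "\<exists>y\<in>Y.mball y0 (inverse (real (Suc n))). \<not> gelfand_integrals M (\<lambda>t. F (t, y)) \<subseteq> V"
        using no by meson
      then obtain y where "y \<in> Y.mball y0 (inverse (real (Suc n)))" "\<not> gelfand_integrals M (\<lambda>t. F (t, y)) \<subseteq> V"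
        by (elim bexE)
      moreover from this(2) obtain f where "f \<in> measurable M weak_star_borel" "selection M (\<lambda>t. F (t, y)) f"
        "gelfand_integral M f \<notin> V"
        unfolding gelfand_integrals_def by blast
      ultimately show ?thesis by (intro exI[of _ "(y, f)"]) simp
    qed
    then have "\<forall>n. \<exists>p. fst p \<in> Y.mball y0 (inverse (real (Suc n))) \<and> snd p \<in> measurable M weak_star_borel \<and>
        selection M (\<lambda>t. F (t, fst p)) (snd p) \<and> gelfand_integral M (snd p) \<notin> V" ..
    then obtain p where p: "\<forall>n. fst (p n) \<in> Y.mball y0 (inverse (real (Suc n))) \<and> snd (p n) \<in> measurable M weak_star_borel \<and>
        selection M (\<lambda>t. F (t, fst (p n))) (snd (p n)) \<and> gelfand_integral M (snd (p n)) \<notin> V"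
      by (rule choice[THEN exE])
    define y where "y n = fst (p n)" for n
    define f where "f n = snd (p n)" for n
    have y: "y n \<in> Y.mball y0 (inverse (real (Suc n)))" and f: "f n \<in> measurable M weak_star_borel"
      and sel: "selection M (\<lambda>t. F (t, y n)) (f n)" and nV: "gelfand_integral M (f n) \<notin> V" for n
      using p unfolding y_def f_def by blast+
    have yY: "y n \<in> Y" for n using y[of n] by (simp add: Y.in_mball)
    have f_le: "AE t in M. norm (f n t) \<le> H t" for n by (rule sel_le[OF yY sel])
    obtain r \<zeta> where r: "strict_mono r" and "norm \<zeta> \<le> \<bar>\<integral>t. H t \<partial>M\<bar>"
      and lim: "\<And>x. (\<lambda>n. blinfun_apply (gelfand_integral M (f (r n))) x) \<longlonglongrightarrow> blinfun_apply \<zeta> x"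
      using bounded_dual_subseq[of e "\<lambda>n. gelfand_integral M (f n)", OF e norm_gelfand_integral_le[OF f H(1) f_le]]
      by blast
    have "AE t in M. \<forall>n. f n t \<in> F (t, y n)" using sel by (simp add: selection_def AE_all_countable)
    \<comment> \<open>The exceptional null set stems from the countably many selections alone; at
      any other \<open>t\<close>, hemicontinuity of \<open>F\<close> in the parameter handles all
      \<open>W\<close> at once.\<close>
    then have W: "AE t in M. \<forall>W. openin weak_star W \<and> F (t, y0) \<subseteq> W \<longrightarrow> (\<forall>\<^sub>F n in sequentially. f (r n) t \<in> W)"
      using AE_space
    proof (eventually_elim, intro allI impI)
      fix t W assume fF: "\<forall>n. f n t \<in> F (t, y n)" and t: "t \<in> space M"
        and W: "openin weak_star W \<and> F (t, y0) \<subseteq> W"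
      have "\<exists>U. openin Y.mtopology U \<and> y0 \<in> U \<and> (\<forall>y\<in>U. F (t, y) \<subseteq> W)"
        using uhc[OF t] W y0 unfolding upper_hemicontinuous_def by simp
      then obtain U where U: "openin Y.mtopology U" "y0 \<in> U" "\<forall>y\<in>U. F (t, y) \<subseteq> W"
        by (elim exE conjE)
      obtain \<delta> where \<delta>: "0 < \<delta>" "Y.mball y0 \<delta> \<subseteq> U"
        using U(1,2) unfolding Y.openin_mtopology by blast
      obtain m where m: "inverse (real (Suc m)) < \<delta>" using reals_Archimedean[OF \<delta>(1)] by blast
      have "f (r n) t \<in> W" if "m \<le> n" for n
      proof -
        have "m \<le> r n" using that seq_suble[OF r, of n] by simp
        have "d y0 (y (r n)) < inverse (real (Suc (r n)))" using y[of "r n"] unfolding Y.in_mball by blast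
        also have "\<dots> \<le> inverse (real (Suc m))" using \<open>m \<le> r n\<close> by (intro le_imp_inverse_le) auto
        also note m
        finally have "y (r n) \<in> Y.mball y0 \<delta>" using y0 yY by (simp add: Y.in_mball)
        then show ?thesis using \<delta>(2) U(3) fF by blast
      qed
      then show "\<forall>\<^sub>F n in sequentially. f (r n) t \<in> W" by (rule eventually_sequentiallyI)
    qed
    have "\<zeta> \<in> gelfand_integrals M (\<lambda>t. weak_star closure_of (convex hull F (t, y0)))"
      by (rule gelfand_integrals_closure[OF prob_space_axioms e f H(1) f_le W lim])
    then have "\<zeta> \<in> V"
      using gelfand_integrals_convex_hull[OF e meas[OF y0] comp[OF y0] H(1) FH[OF y0]] V(2) by auto
    \<comment> \<open>The complement of \<open>V\<close> is weak-star closed and contains every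
      integral of the sequence, hence its limit.\<close>
    moreover have "\<zeta> \<in> topspace weak_star - V"
      by (rule closedin_weak_star_limit[OF _ _ lim])
        (use V(1) nV in \<open>auto simp: closedin_def strong_operator_topology_topspace double_diff\<close>)
    ultimately show False by blast
  qed
  show ?thesis
    unfolding upper_hemicontinuous_def
  proof (intro conjI ballI allI impI)
    show "correspondence (topspace Y.mtopology) (\<lambda>y. gelfand_integrals M (\<lambda>t. F (t, y)))"
      using nonempty by (simp add: correspondence_def)
  qed (use key in \<open>auto simp: strong_operator_topology_topspace\<close>)
qed

end

theorem proposition3:
  fixes M N :: "'t measure"
  assumes "prob_space M" and "complete_measure M" and "atomless M"
    and "subalgebra M N" and "countably_generated N"
    and "separable_space (euclidean :: 'x::banach topology)"
    and "nowhere_equivalent M N"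
  shows
    "(\<forall>F :: 't \<Rightarrow> 'x dual set.
        correspondence (space M) F \<and> corr_measurable N F \<and> weak_star_compact_valued M F \<longrightarrow>
        convex (gelfand_integrals M F))
   \<and>
     (\<forall>(p :: ereal) (F :: 't \<Rightarrow> 'x dual set).
        1 < p \<and> correspondence (space M) F \<and> corr_measurable N F \<and>
        integrably_bounded p M F \<and> weak_star_compact_valued M F \<longrightarrow>
        compactin weak_star (gelfand_integrals M F))
   \<and>
     (\<forall>(p :: ereal) (F :: 't \<Rightarrow> 'x dual set).
        1 < p \<and> correspondence (space M) F \<and> corr_measurable N F \<and>
        integrably_bounded p M F \<and> weak_star_compact_valued M F \<longrightarrow>
        gelfand_integrals M F =
          gelfand_integrals M (\<lambda>t. weak_star closure_of (convex hull F t)))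
   \<and>
     (\<forall>(p :: ereal) (G :: 't \<Rightarrow> 'x dual set) (Y :: 'y set) (d :: 'y \<Rightarrow> 'y \<Rightarrow> real)
        (F :: 't \<times> 'y \<Rightarrow> 'x dual set).
        1 < p \<and> correspondence (space M) G \<and> corr_measurable N G \<and>
        integrably_bounded p M G \<and> weak_star_compact_valued M G \<and>
        Metric_space Y d \<and>
        correspondence (space M \<times> Y) F \<and>
        (\<forall>y\<in>Y. weak_star_closed_valued M (\<lambda>t. F (t, y))) \<and>
        (\<forall>y\<in>Y. AE t in M. F (t, y) \<subseteq> G t) \<and>
        (\<forall>y\<in>Y. corr_measurable N (\<lambda>t. F (t, y))) \<and>
        (\<forall>t\<in>space M.
           upper_hemicontinuous (Metric_space.mtopology Y d) weak_star (\<lambda>y. F (t, y))) \<longrightarrow>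
        upper_hemicontinuous (Metric_space.mtopology Y d) weak_star
          (\<lambda>y. gelfand_integrals M (\<lambda>t. F (t, y))))"
proof -
  interpret prob_space M by fact
  interpret nowhere_equivalent_subalgebra M N
    by unfold_locales (use assms in auto)
  obtain e :: "nat \<Rightarrow> 'x" where e: "dense_dirs e"
    using exists_dense_dirs[OF assms(6)] .
  show ?thesis
  proof (intro conjI allI impI; elim conjE)
    show "convex (gelfand_integrals M F)"
      if "corr_measurable N F" "weak_star_compact_valued M F" for F :: "'t \<Rightarrow> 'x dual set"
      by (rule convex_gelfand_integrals[OF e that])
  next
    fix p :: ereal and F :: "'t \<Rightarrow> 'x dual set"
    assume F: "1 < p" "correspondence (space M) F" "corr_measurable N F" "integrably_bounded p M F"
      "weak_star_compact_valued M F"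
    \<comment> \<open>The bound of order \<open>p\<close> is traded for an integrable majorant, the
      form in which domination enters the limit arguments.\<close>
    obtain H where "integrable M H" "AE t in M. \<forall>\<phi>\<in>F t. norm \<phi> \<le> H t"
      using integrably_bounded_dominated[OF assms(1) F(1,2,4)] .
    then show "compactin weak_star (gelfand_integrals M F)"
      by (rule compactin_gelfand_integrals[OF e F(3,5)])
  next
    fix p :: ereal and F :: "'t \<Rightarrow> 'x dual set"
    assume F: "1 < p" "correspondence (space M) F" "corr_measurable N F" "integrably_bounded p M F"
      "weak_star_compact_valued M F"
    obtain H where "integrable M H" "AE t in M. \<forall>\<phi>\<in>F t. norm \<phi> \<le> H t"
      using integrably_bounded_dominated[OF assms(1) F(1,2,4)] .
    then show "gelfand_integrals M F = gelfand_integrals M (\<lambda>t. weak_star closure_of (convex hull F t))"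
      by (rule gelfand_integrals_convex_hull[OF e F(3,5)])
  next
    fix p :: ereal and G :: "'t \<Rightarrow> 'x dual set" and Y :: "'y set" and d and F :: "'t \<times> 'y \<Rightarrow> 'x dual set"
    assume G: "1 < p" "correspondence (space M) G" "integrably_bounded p M G" "weak_star_compact_valued M G"
      and F: "Metric_space Y d" "correspondence (space M \<times> Y) F"
        "\<forall>y\<in>Y. weak_star_closed_valued M (\<lambda>t. F (t, y))"
        "\<forall>y\<in>Y. AE t in M. F (t, y) \<subseteq> G t"
        "\<forall>y\<in>Y. corr_measurable N (\<lambda>t. F (t, y))"
        "\<forall>t\<in>space M. upper_hemicontinuous (Metric_space.mtopology Y d) weak_star (\<lambda>y. F (t, y))"
    obtain H where H: "integrable M H" "AE t in M. \<forall>\<phi>\<in>G t. norm \<phi> \<le> H t"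
      using integrably_bounded_dominated[OF assms(1) G(1,2,3)] .
    show "upper_hemicontinuous (Metric_space.mtopology Y d) weak_star
        (\<lambda>y. gelfand_integrals M (\<lambda>t. F (t, y)))"
      by (rule upper_hemicontinuous_gelfand_integrals[OF e H G(4) F(1,2)]) (use F(3-6) in blast)+
  qed
qed

end
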